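(* Let the group $G=A_1A_2\cdots A_n$ be the product of finitely many pairwise permutable periodic locally cyclic subgroups $A_1,\dots,A_n$. Then $G$ is a periodic locally supersoluble group.
   Context: $G=A_1A_2\cdots A_n$ means every element of $G$ has the form $a_1a_2\cdots a_n$ with $a_i\in A_i$. The subgroups $A_1,\dots,A_n$ are pairwise permutable if $A_iA_j=A_jA_i$ for all $i,j$. A group is locally cyclic if each of its finitely generated subgroups is cyclic, and locally supersoluble if each of its finitely generated subgroups is supersoluble (has a finite series of normal subgroups with cyclic factors). *)

theory Defs
  imports "HOL-Algebra.Algebra"
begin

text \<open>The predicates below take a group as a record. A subgroup \<open>A\<close> of \<open>G\<close>, regarded as
  a group in its own right, is \<open>G\<lparr>carrier := A\<rparr>\<close>.\<close>

definition periodic_group :: "('a, 'b) monoid_scheme \<Rightarrow> bool"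
  where "periodic_group G \<longleftrightarrow> (\<forall>x \<in> carrier G. \<exists>m::nat. m > 0 \<and> x [^]\<^bsub>G\<^esub> m = \<one>\<^bsub>G\<^esub>)"

definition locally_cyclic :: "('a, 'b) monoid_scheme \<Rightarrow> bool"
  where "locally_cyclic G \<longleftrightarrow>
    (\<forall>S. finite S \<and> S \<subseteq> carrier G \<longrightarrow> cyclic_group (subgroup_generated G S))"

text \<open>All terms of the series are normal in the whole group, not only in the next term.\<close>

definition supersoluble :: "('a, 'b) monoid_scheme \<Rightarrow> bool"
  where "supersoluble G \<longleftrightarrow>
    (\<exists>(k::nat) (N :: nat \<Rightarrow> 'a set).
       N 0 = {\<one>\<^bsub>G\<^esub>} \<and> N k = carrier G \<and>
       (\<forall>i \<le> k. N i \<lhd> G) \<and>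
       (\<forall>i < k. N i \<subseteq> N (Suc i) \<and> cyclic_group ((G\<lparr>carrier := N (Suc i)\<rparr>) Mod (N i))))"

definition locally_supersoluble :: "('a, 'b) monoid_scheme \<Rightarrow> bool"
  where "locally_supersoluble G \<longleftrightarrow>
    (\<forall>S. finite S \<and> S \<subseteq> carrier G \<longrightarrow> supersoluble (subgroup_generated G S))"

text \<open>\<open>G = A\<^sub>1 A\<^sub>2 \<dots> A\<^sub>n\<close>: the group is not commutative, so the product
  \<open>a\<^sub>1 a\<^sub>2 \<dots> a\<^sub>n\<close> is folded over the list of indices in increasing order.\<close>

definition is_product_of :: "('a, 'b) monoid_scheme \<Rightarrow> nat \<Rightarrow> (nat \<Rightarrow> 'a set) \<Rightarrow> bool"
  where "is_product_of G n A \<longleftrightarrow>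
    (\<forall>g \<in> carrier G. \<exists>a. (\<forall>i \<in> {1..n}. a i \<in> A i) \<and>
       g = foldr (\<lambda>x y. x \<otimes>\<^bsub>G\<^esub> y) (map a [1..<Suc n]) \<one>\<^bsub>G\<^esub>)"

definition pairwise_permutable :: "('a, 'b) monoid_scheme \<Rightarrow> nat \<Rightarrow> (nat \<Rightarrow> 'a set) \<Rightarrow> bool"
  where "pairwise_permutable G n A \<longleftrightarrow>
    (\<forall>i \<in> {1..n}. \<forall>j \<in> {1..n}. A i <#>\<^bsub>G\<^esub> A j = A j <#>\<^bsub>G\<^esub> A i)"

end

theory Submission
  imports Defs "HOL-Number_Theory.Residues"
begin

hide_const (open) Divisibility.prime

text \<open>The key is a normal subgroup of prime order in every nontrivial group of the given kind whose
  elements involve boundedly many primes. Quotients are again of this kind, so Zorn's lemma lets one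
  climb through normal subgroups in steps of prime order; this yields local finiteness and, by
  intersecting the steps with a finite subgroup, supersolubility. A finite set of elements involves
  only finitely many primes, and the parts of the \<open>A\<^sub>i\<close> for these primes still permute.

  For two factors, the normal subgroup generated by the commutators \<open>[a, b]\<close> is abelian by
  Ito's theorem and becomes a commutative radical ring; an element of it with square zero gives an
  element of prime order in \<open>A\<close> or \<open>B\<close> generating a normal subgroup. Climbing then shows
  that, for every set of primes, the corresponding parts of \<open>A\<close> and \<open>B\<close> permute.

  For several factors let \<open>p\<close> be the largest prime involved and consider the subgroups of order \<open>p\<close>
  in those \<open>A\<^sub>i\<close> whose \<open>p\<close>-part has the largest exponent. They commute with each other, and
  the commutators \<open>[A\<^sub>j, A\<^sub>k]\<close> act trivially on the group they generate, since they act
  unipotently and with order prime to \<open>p\<close>. If \<open>A\<^sub>j\<close> moves the subgroup of order \<open>p\<close> of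
  \<open>A\<^sub>i\<close>, then fewer factors move the one of \<open>A\<^sub>j\<close>; hence one of these subgroups is
  moved by no factor.\<close>

subsection \<open>Periodic locally cyclic subgroups\<close>

text \<open>The group may be infinite, so there is no order to induct on. Several statements are
  therefore put as implications: what holds modulo \<open>N\<close> holds outright. Such an
  implication is trivial for the trivial \<open>N\<close> and gains one step of prime order at a
  time; at \<open>N = carrier G\<close> its premise is empty. The largest prime \<open>p\<close>
  matters because a \<open>p\<close>-element normalising a group of prime order
  \<open>q \<le> p\<close> centralises it. Hence the \<open>p\<close>-elements of
  \<open>A\<^sub>i A\<^sub>j\<close> stay in the product of the two \<open>p\<close>-parts. With
  infinitely many primes there is no largest one, and cutting the factors down to finitely many
  primes is legitimate only once these parts are known to permute. So the case of two factors comes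
  first and has to find its normal subgroup without any bound on the primes. In the radical ring on
  the commutator subgroup \<open>U\<close>, addition is the group product and \<open>1 + u\<close>
  acts as conjugation by the \<open>A\<close>-part of \<open>u\<close>. This is injective, and
  finite orders leave only finitely many powers of an element, so elements are nilpotent.\<close>

text \<open>Natural exponents suffice for cyclic groups of torsion elements. The letters \<open>plc\<close> stand
  for periodic and locally cyclic.\<close>

definition cyc :: "('a, 'b) monoid_scheme \<Rightarrow> 'a \<Rightarrow> 'a set"
  where "cyc G x = range (\<lambda>k::nat. x [^]\<^bsub>G\<^esub> k)"

definition torsion :: "('a, 'b) monoid_scheme \<Rightarrow> 'a \<Rightarrow> bool"
  where "torsion G x \<longleftrightarrow> (\<exists>n::nat. n > 0 \<and> x [^]\<^bsub>G\<^esub> n = \<one>\<^bsub>G\<^esub>)"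

definition plc :: "('a, 'b) monoid_scheme \<Rightarrow> 'a set \<Rightarrow> bool"
  where "plc G A \<longleftrightarrow> subgroup A G \<and> (\<forall>x\<in>A. torsion G x) \<and>
    (\<forall>x\<in>A. \<forall>y\<in>A. \<exists>z\<in>A. x \<in> cyc G z \<and> y \<in> cyc G z)"

lemma (in group) inv_cancel_left [simp]:
  "x \<in> carrier G \<Longrightarrow> y \<in> carrier G \<Longrightarrow> x \<otimes> (inv x \<otimes> y) = y"
  "x \<in> carrier G \<Longrightarrow> y \<in> carrier G \<Longrightarrow> inv x \<otimes> (x \<otimes> y) = y"
  by (simp_all flip: m_assoc)

lemma (in group) cyc_closed: "x \<in> carrier G \<Longrightarrow> y \<in> cyc G x \<Longrightarrow> y \<in> carrier G"
  by (auto simp: cyc_def)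

lemma (in group) cyc_self: "x \<in> carrier G \<Longrightarrow> x \<in> cyc G x"
  unfolding cyc_def by (metis nat_pow_eone rangeI)

lemma pow_in_cyc: "x [^]\<^bsub>G\<^esub> (k::nat) \<in> cyc G x"
  by (simp add: cyc_def)

lemma one_in_cyc: "\<one>\<^bsub>G\<^esub> \<in> cyc G x"
  using pow_in_cyc[where k=0] by (simp)

lemma cycE:
  assumes "y \<in> cyc G x" obtains k::nat where "y = x [^]\<^bsub>G\<^esub> k"
  using assms by (auto simp: cyc_def)

lemma (in group) cyc_mult: "x \<in> carrier G \<Longrightarrow> y \<in> cyc G x \<Longrightarrow> z \<in> cyc G x \<Longrightarrow> y \<otimes> z \<in> cyc G x"
  by (auto simp: cyc_def nat_pow_mult)

lemma (in group) cyc_trans: "x \<in> carrier G \<Longrightarrow> y \<in> cyc G x \<Longrightarrow> cyc G y \<subseteq> cyc G x"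
  by (auto simp: cyc_def nat_pow_pow)

lemma (in group) cyc_commute:
  "x \<in> carrier G \<Longrightarrow> y \<in> cyc G x \<Longrightarrow> z \<in> cyc G x \<Longrightarrow> y \<otimes> z = z \<otimes> y"
  by (auto simp: cyc_def nat_pow_mult add.commute)

lemma (in group) torsion_pow: "x \<in> carrier G \<Longrightarrow> torsion G x \<Longrightarrow> torsion G (x [^] (k::nat))"
  unfolding torsion_def by (metis mult.commute nat_pow_one nat_pow_pow)

lemma (in group) inv_pow_in_cyc:
  assumes "x \<in> carrier G" "torsion G x"
  shows "inv (x [^] (k::nat)) \<in> cyc G x"
proof -
  obtain n where n: "n > 0" "x [^] (n::nat) = \<one>"
    using assms by (auto simp: torsion_def)
  have "x [^] (n * k - k) \<otimes> x [^] k = \<one>"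
    using n assms by (simp add: nat_pow_mult le_add_diff_inverse2 flip: nat_pow_pow)
  then have "inv (x [^] k) = x [^] (n * k - k)"
    using assms by (simp add: inv_equality)
  then show ?thesis by (simp add: pow_in_cyc)
qed

lemma (in group) cyc_inv: "x \<in> carrier G \<Longrightarrow> torsion G x \<Longrightarrow> y \<in> cyc G x \<Longrightarrow> inv y \<in> cyc G x"
  using inv_pow_in_cyc cycE by metis

lemma (in group) cyc_subgroup: "x \<in> carrier G \<Longrightarrow> torsion G x \<Longrightarrow> subgroup (cyc G x) G"
  using one_in_cyc[of G x] by (intro subgroupI) (auto simp: cyc_mult cyc_inv cyc_closed)

lemma (in group) subgroup_cyc: "subgroup A G \<Longrightarrow> x \<in> A \<Longrightarrow> cyc G x \<subseteq> A"
proof -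
  assume A: "subgroup A G" and x: "x \<in> A"
  have "x [^] (k::nat) \<in> A" for k
    by (induction k) (simp_all add: subgroup.one_closed[OF A] subgroup.m_closed[OF A _ x])
  then show "cyc G x \<subseteq> A" by (auto simp: cyc_def)
qed

lemma (in group) subgroup_pow: "subgroup A G \<Longrightarrow> x \<in> A \<Longrightarrow> x [^] (k::nat) \<in> A"
  using subgroup_cyc[of A x] pow_in_cyc[of G x k] by auto

lemma (in group) pow_cong:
  assumes "x \<in> carrier G" "x [^] (p::nat) = \<one>" "[i = j] (mod p)"
  shows "x [^] i = x [^] (j::nat)"
proof -
  have "int p dvd int j - int i"
    using assms(3) by (metis cong_iff_dvd_diff cong_int_iff cong_sym)
  moreover have "int (ord x) dvd int p"
    using assms pow_eq_id by simp
  ultimately have "x [^] int i = x [^] int j"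
    using assms(1) int_pow_eq dvd_trans by blast
  then show ?thesis by (simp add: int_pow_int)
qed

lemma (in group) finite_cyc:
  assumes "x \<in> carrier G" "torsion G x" shows "finite (cyc G x)"
proof -
  obtain n where n: "n > 0" "x [^] (n::nat) = \<one>"
    using assms by (auto simp: torsion_def)
  have "x [^] k = x [^] (k mod n)" for k
    using n assms by (intro pow_cong[of x n]) auto
  then have "cyc G x \<subseteq> (\<lambda>k. x [^] k) ` {..<n}"
    unfolding cyc_def using n mod_less_divisor[OF n(1)] by (metis image_eqI image_subsetI lessThan_iff)
  then show ?thesis by (meson finite_imageI finite_lessThan finite_subset)
qed

lemma (in group) prime_pow_one:
  assumes "x \<in> carrier G" "x [^] (m::nat) = \<one>" "x [^] (n::nat) = \<one>" "coprime m n"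
  shows "x = \<one>"
proof -
  have "ord x dvd m" "ord x dvd n" using assms pow_eq_id by auto
  then have "ord x = 1" using assms(4) coprime_common_divisor by (metis nat_dvd_1_iff_1)
  then show ?thesis using assms ord_eq_1 by blast
qed

lemma (in group) cyc_prime_gen:
  assumes "x \<in> carrier G" "prime (p::nat)" "x [^] p = \<one>" "y \<in> cyc G x" "y \<noteq> \<one>"
  shows "x \<in> cyc G y"
proof -
  obtain k where k: "y = x [^] (k::nat)" using assms(4) cycE by metis
  have "\<not> p dvd k" using assms k pow_eq_id dvd_trans by metis
  then have "coprime k p" using assms(2) using prime_imp_coprime coprime_commute by blast
  then obtain l where "[k * l = 1] (mod p)" using cong_solve_coprime_nat by (metis One_nat_def)
  then have "x [^] (k * l) = x [^] (1::nat)" using assms pow_cong by blast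
  then have "y [^] l = x" using k assms by (simp add: nat_pow_pow)
  then show ?thesis using pow_in_cyc by metis
qed

lemma (in group) cyc_prime_eq:
  assumes "x \<in> carrier G" "prime (p::nat)" "x [^] p = \<one>" "y \<in> cyc G x" "y \<noteq> \<one>"
  shows "cyc G y = cyc G x"
  using cyc_prime_gen[OF assms] cyc_trans cyc_closed assms by (metis subset_antisym)

lemma (in group) exists_prime_power:
  assumes "x \<in> carrier G" "torsion G x" "x \<noteq> \<one>"
  obtains p z where "prime (p::nat)" "z \<in> cyc G x" "z \<noteq> \<one>" "z [^] p = \<one>" "p dvd ord x"
proof -
  have "ord x \<noteq> 0" using assms ord_eq_0 by (auto simp: torsion_def)
  moreover have "ord x \<noteq> 1" using assms ord_eq_1 by blast
  ultimately obtain p where p: "prime p" "p dvd ord x"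
    using prime_factor_nat by blast
  define z where "z = x [^] (ord x div p)"
  have "z [^] p = \<one>" using p assms by (simp add: z_def nat_pow_pow)
  moreover have "z \<noteq> \<one>"
  proof
    assume "z = \<one>"
    then have "ord x dvd ord x div p" using assms pow_eq_id by (simp add: z_def)
    moreover have "0 < ord x div p" "ord x div p < ord x"
      using p \<open>ord x \<noteq> 0\<close> prime_gt_1_nat[OF p(1)]
      by (auto simp: div_greater_zero_iff dest: dvd_imp_le)
    ultimately show False using dvd_imp_le by fastforce
  qed
  ultimately show ?thesis using that[of p z] p by (simp add: z_def pow_in_cyc)
qed

lemma (in group) plc_subgroup: "plc G A \<Longrightarrow> subgroup A G" by (simp add: plc_def)
lemma (in group) plc_torsion: "plc G A \<Longrightarrow> x \<in> A \<Longrightarrow> torsion G x" by (simp add: plc_def)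
lemma (in group) plc_closed: "plc G A \<Longrightarrow> x \<in> A \<Longrightarrow> x \<in> carrier G"
  using plc_subgroup subgroup.mem_carrier by metis

lemma (in group) plc_gen:
  assumes "plc G A" "x \<in> A" "y \<in> A"
  obtains z where "z \<in> A" "x \<in> cyc G z" "y \<in> cyc G z"
  using assms unfolding plc_def by metis

lemma (in group) plc_commute:
  assumes "plc G A" "x \<in> A" "y \<in> A" shows "x \<otimes> y = y \<otimes> x"
  using plc_gen[OF assms] cyc_commute plc_closed assms by metis

text \<open>A cyclic group has only one subgroup of each order.\<close>

lemma (in group) plc_pow_mem:
  assumes A: "plc G A" and x: "x \<in> A" and y: "y \<in> A" and e: "y [^] ord x = \<one>"
  shows "y \<in> cyc G x"
proof -
  obtain z where z: "z \<in> A" "x \<in> cyc G z" "y \<in> cyc G z" using plc_gen[OF A x y] .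
  obtain i j where i: "x = z [^] (i::nat)" and j: "y = z [^] (j::nat)" using z cycE by metis
  have zc: "z \<in> carrier G" using A z plc_closed by blast
  define n where "n = ord z"
  have n0: "n \<noteq> 0" using plc_torsion[OF A z(1)] ord_eq_0[OF zc] by (auto simp: n_def torsion_def)
  \<comment> \<open>The order of \<open>x\<close> divides \<open>n div g\<close>, so this exponent
    kills \<open>y\<close>. Hence \<open>g\<close> divides \<open>j\<close>, while \<open>x\<close>
    already generates \<open>z [^] g\<close>.\<close>
  define g where "g = gcd i n"
  have g0: "g > 0" using n0 by (simp add: g_def)
  have "x [^] (n div g) = \<one>"
  proof -
    obtain i' m where "i = g * i'" "n = g * m" unfolding g_def by (meson dvdE gcd_dvd1 gcd_dvd2)
    then have "n dvd i * (n div g)" using g0 by (simp add: mult.assoc)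
    then show ?thesis using zc pow_eq_id i by (simp add: n_def nat_pow_pow)
  qed
  then have "ord x dvd n div g" using pow_eq_id plc_closed A x by blast
  then have "y [^] (n div g) = \<one>" using e
    by (metis A dvdE nat_pow_one nat_pow_pow plc_closed y)
  then have "n dvd j * (n div g)" using zc j pow_eq_id by (simp add: n_def nat_pow_pow)
  moreover obtain m where m: "n = g * m" using g_def by (metis dvdE gcd_dvd2)
  ultimately have gj: "g dvd j" using n0 g0 by auto
  obtain u where u: "[i * u = g] (mod n)" using cong_solve_nat[of i n] g_def by blast
  obtain w where w: "j = g * w" using gj by blast
  have "[i * (u * w) = j] (mod n)" using u w by (metis cong_scalar_right mult.assoc)
  then have "z [^] (i * (u * w)) = z [^] j" using zc by (intro pow_cong) (auto simp: n_def)
  then have "y = x [^] (u * w)" using i j zc by (simp add: nat_pow_pow)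
  then show ?thesis by (simp add: pow_in_cyc)
qed

lemma (in group) plc_prime_mem:
  assumes "plc G A" "x \<in> A" "y \<in> A" "prime (p::nat)" "x \<noteq> \<one>" "x [^] p = \<one>" "y [^] p = \<one>"
  shows "y \<in> cyc G x"
proof -
  have "ord x dvd p" using assms plc_closed pow_eq_id by blast
  moreover have "ord x \<noteq> 1" using assms plc_closed ord_eq_1 by blast
  ultimately have "ord x = p" using assms(4) prime_nat_iff by blast
  then show ?thesis using plc_pow_mem assms by blast
qed

lemma (in group) conj_pow:
  "g \<in> carrier G \<Longrightarrow> x \<in> carrier G \<Longrightarrow> (g \<otimes> x \<otimes> inv g) [^] (k::nat) = g \<otimes> x [^] k \<otimes> inv g"
  by (induction k) (simp_all add: m_assoc)

text \<open>Conjugates have equal order, and by \<open>plc_pow_mem\<close> there is room in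
  \<open>A\<close> for only one cyclic subgroup of that order. So it suffices to see the conjugate
  inside \<open>A\<close> to know that \<open>g\<close> preserves \<open>cyc G x\<close>.\<close>

lemma (in group) plc_conj:
  assumes "plc G A" "x \<in> A" "g \<in> carrier G" "g \<otimes> x \<otimes> inv g \<in> A"
  shows "g \<otimes> x \<otimes> inv g \<in> cyc G x"
  using assms plc_pow_mem[OF assms(1,2,4)] conj_pow plc_closed by simp

text \<open>On \<open>cyc G x\<close> the element \<open>g\<close> acts as a power map
  \<open>y \<mapsto> y [^] c\<close>, so together with \<open>cyc G x\<close> it preserves every
  cyclic subgroup of it.\<close>

lemma (in group) conj_cyc:
  assumes "g \<in> carrier G" "x \<in> carrier G" "g \<otimes> x \<otimes> inv g \<in> cyc G x" "y \<in> cyc G x"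
  shows "g \<otimes> y \<otimes> inv g \<in> cyc G y"
proof -
  obtain k where k: "y = x [^] (k::nat)" using assms cycE by metis
  obtain c where c: "g \<otimes> x \<otimes> inv g = x [^] (c::nat)" using assms cycE by metis
  have "g \<otimes> y \<otimes> inv g = y [^] c"
    using conj_pow[of g x k] assms k c by (simp add: nat_pow_pow mult.commute)
  then show ?thesis by (simp add: pow_in_cyc)
qed

lemma (in group) plc_subset:
  assumes A: "plc G A" and B: "subgroup B G" "B \<subseteq> A"
  shows "plc G B"
  unfolding plc_def
proof (intro conjI ballI)
  show "subgroup B G" by fact
  show "torsion G x" if "x \<in> B" for x using that A B plc_torsion by blast
  fix x y assume xy: "x \<in> B" "y \<in> B"
  obtain z where z: "z \<in> A" "x \<in> cyc G z" "y \<in> cyc G z" using plc_gen A B xy by blast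
  have zc: "z \<in> carrier G" using A z plc_closed by blast
  obtain i j where ij: "x = z [^] (i::nat)" "y = z [^] (j::nat)" using z cycE by metis
  define n where "n = ord z"
  define g where "g = gcd i j"
  have n0: "n \<noteq> 0" using plc_torsion[OF A z(1)] ord_eq_0[OF zc] by (auto simp: n_def torsion_def)
  have "z [^] g \<in> B"
  proof -
    \<comment> \<open>A Bezout identity puts \<open>z [^] g\<close> into \<open>B\<close>, and both
      \<open>x\<close> and \<open>y\<close> are powers of it.\<close>
    obtain u v where uv: "int g = int i * u + int j * v"
      using bezout_int[of "int i" "int j"] by (metis g_def gcd_int_int_eq mult.commute)
    have "z [^] int g = (z [^] int i) [^] u \<otimes> (z [^] int j) [^] v"
      using zc by (simp only: uv int_pow_mult int_pow_pow)
    then have "z [^] g = x [^] u \<otimes> y [^] v" using ij by (simp add: int_pow_int)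
    then show ?thesis using B xy
      by (simp add: subgroup.m_closed subgroup_int_pow_closed)
  qed
  moreover have "x \<in> cyc G (z [^] g)" "y \<in> cyc G (z [^] g)"
    using ij zc pow_in_cyc[of G "z [^] g"] unfolding g_def
    by (metis dvd_def gcd_dvd1 gcd_dvd2 nat_pow_pow)+
  ultimately show "\<exists>z\<in>B. x \<in> cyc G z \<and> y \<in> cyc G z" by blast
qed

subsection \<open>Images and quotients\<close>

lemma (in group_hom) cyc_image: "x \<in> carrier G \<Longrightarrow> h ` cyc G x = cyc H (h x)"
  by (simp add: cyc_def image_image hom_nat_pow)

lemma (in group_hom) torsion_image: "x \<in> carrier G \<Longrightarrow> torsion G x \<Longrightarrow> torsion H (h x)"
  unfolding torsion_def by (metis hom_nat_pow hom_one)

lemma (in group_hom) plc_image: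
  assumes "plc G A" shows "plc H (h ` A)"
  unfolding plc_def
proof (intro conjI ballI)
  have sub: "A \<subseteq> carrier G" using assms G.plc_closed by blast
  show "subgroup (h ` A) H" using assms G.plc_subgroup subgroup_img_is_subgroup by blast
  show "torsion H y" if "y \<in> h ` A" for y
    using that sub assms torsion_image G.plc_torsion by blast
  fix x y assume "x \<in> h ` A" "y \<in> h ` A"
  then obtain a b where ab: "a \<in> A" "b \<in> A" "x = h a" "y = h b" by blast
  obtain z where "z \<in> A" "a \<in> cyc G z" "b \<in> cyc G z" using G.plc_gen assms ab by blast
  then show "\<exists>z\<in>h ` A. x \<in> cyc H z \<and> y \<in> cyc H z"
    using ab sub cyc_image by blast
qed

lemma (in group) quotient_hom: "N \<lhd> G \<Longrightarrow> group_hom G (G Mod N) (\<lambda>x. N #> x)"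
  by (simp add: group_hom_def group_hom_axioms_def normal.factorgroup_is_group normal.r_coset_hom_Mod)

lemma (in group) quotient_eq:
  assumes "N \<lhd> G" "x \<in> carrier G" "y \<in> carrier G"
  shows "N #> x = N #> y \<longleftrightarrow> (\<exists>n\<in>N. x = n \<otimes> y)"
proof
  have sN: "subgroup N G" using assms normal_imp_subgroup by blast
  assume "N #> x = N #> y"
  then have "x \<in> N #> y" using rcos_self[OF assms(2) sN] by simp
  then show "\<exists>n\<in>N. x = n \<otimes> y" by (auto simp: r_coset_def)
next
  have sN: "subgroup N G" using assms normal_imp_subgroup by blast
  assume "\<exists>n\<in>N. x = n \<otimes> y"
  then have "x \<in> N #> y" by (auto simp: r_coset_def)
  then show "N #> x = N #> y" using repr_independence assms sN by metis
qed

lemma (in group) quotient_one: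
  assumes "N \<lhd> G" "x \<in> carrier G"
  shows "N #> x = \<one>\<^bsub>G Mod N\<^esub> \<longleftrightarrow> x \<in> N"
  using assms by (metis coset_join1 coset_join2 normal_imp_subgroup one_FactGroup subgroup.subset)

lemma (in group_hom) normal_vimage:
  assumes "M \<lhd> H" shows "{x \<in> carrier G. h x \<in> M} \<lhd> G"
proof -
  have "subgroup M H" using assms normal_imp_subgroup by blast
  then have "subgroup {x \<in> carrier G. h x \<in> M} G"
    by (intro G.subgroupI) (auto simp: subgroup.one_closed subgroup.m_closed subgroup.m_inv_closed intro!: exI[of _ \<one>])
  then show ?thesis using assms
    by (auto intro!: G.normal_invI simp: H.normal_inv_iff)
qed

lemma (in group) normal_Union_chain:
  assumes "C \<noteq> {}" "\<And>N. N \<in> C \<Longrightarrow> N \<lhd> G" "\<And>M N. M \<in> C \<Longrightarrow> N \<in> C \<Longrightarrow> M \<subseteq> N \<or> N \<subseteq> M"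
  shows "\<Union>C \<lhd> G"
proof (rule normal_invI)
  have s: "subgroup N G" if "N \<in> C" for N using assms(2)[OF that] normal_imp_subgroup by blast
  show "subgroup (\<Union>C) G"
  proof (rule subgroupI)
    show "\<Union>C \<subseteq> carrier G" using s subgroup.subset by (metis Sup_least)
    show "\<Union>C \<noteq> {}" using s subgroup.one_closed assms(1) by fastforce
    show "inv a \<in> \<Union>C" if "a \<in> \<Union>C" for a
      using that s subgroup.m_inv_closed by (metis Union_iff)
    show "a \<otimes> b \<in> \<Union>C" if ab: "a \<in> \<Union>C" "b \<in> \<Union>C" for a b
    proof -
      obtain M N where MN: "M \<in> C" "N \<in> C" "a \<in> M" "b \<in> N" using ab by blast
      then have "M \<subseteq> N \<or> N \<subseteq> M" using assms(3) by blast
      then obtain K where "K \<in> C" "a \<in> K" "b \<in> K" using MN by blast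
      then show ?thesis using s subgroup.m_closed by (metis Union_iff)
    qed
  qed
  show "x \<otimes> a \<otimes> inv x \<in> \<Union>C" if "x \<in> carrier G" "a \<in> \<Union>C" for x a
    using that assms(2) normal_inv_iff by (metis Union_iff)
qed

lemma (in group) maximal_normal:
  assumes one: "Q {\<one>}"
    and chain: "\<And>C. C \<noteq> {} \<Longrightarrow> (\<And>N. N \<in> C \<Longrightarrow> N \<lhd> G \<and> Q N) \<Longrightarrow>
      (\<And>M N. M \<in> C \<Longrightarrow> N \<in> C \<Longrightarrow> M \<subseteq> N \<or> N \<subseteq> M) \<Longrightarrow> Q (\<Union>C)"
  obtains N where "N \<lhd> G" "Q N" "\<And>M. M \<lhd> G \<Longrightarrow> N \<subseteq> M \<Longrightarrow> Q M \<Longrightarrow> M = N"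
proof -
  define F where "F = {N. N \<lhd> G \<and> Q N}"
  have "\<exists>M\<in>F. \<forall>K\<in>F. M \<subseteq> K \<longrightarrow> K = M"
  proof (rule subset_Zorn_nonempty)
    show "F \<noteq> {}" using one one_is_normal by (auto simp: F_def)
    fix C assume C: "C \<noteq> {}" "subset.chain F C"
    then have "\<And>N. N \<in> C \<Longrightarrow> N \<lhd> G \<and> Q N" "\<And>M N. M \<in> C \<Longrightarrow> N \<in> C \<Longrightarrow> M \<subseteq> N \<or> N \<subseteq> M"
      unfolding subset_chain_def F_def by blast+
    then show "\<Union>C \<in> F"
      using chain[OF C(1)] normal_Union_chain[OF C(1)] by (auto simp: F_def)
  qed
  then show thesis using that unfolding F_def by blast
qed

subsection \<open>Products of two permutable subgroups\<close>

definition (in group) cj where "cj g v = g \<otimes> v \<otimes> inv g"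

context group
begin

lemma cj_closed [simp]: "g \<in> carrier G \<Longrightarrow> v \<in> carrier G \<Longrightarrow> cj g v \<in> carrier G"
  by (simp add: cj_def)

lemma cj_mult: "g \<in> carrier G \<Longrightarrow> u \<in> carrier G \<Longrightarrow> v \<in> carrier G \<Longrightarrow> cj g (u \<otimes> v) = cj g u \<otimes> cj g v"
  by (simp add: cj_def m_assoc)

lemma cj_comp: "g \<in> carrier G \<Longrightarrow> h \<in> carrier G \<Longrightarrow> v \<in> carrier G \<Longrightarrow> cj (g \<otimes> h) v = cj g (cj h v)"
  by (simp add: cj_def m_assoc inv_mult_group)

lemma cj_inv: "g \<in> carrier G \<Longrightarrow> v \<in> carrier G \<Longrightarrow> cj g (inv v) = inv (cj g v)"
  by (simp add: cj_def m_assoc inv_mult_group)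

lemma cj_pow: "g \<in> carrier G \<Longrightarrow> v \<in> carrier G \<Longrightarrow> cj g (v [^] (k::nat)) = cj g v [^] k"
  by (simp add: cj_def conj_pow)

lemma cj_one [simp]: "g \<in> carrier G \<Longrightarrow> cj g \<one> = \<one>"
  by (simp add: cj_def)

lemma one_cj [simp]: "v \<in> carrier G \<Longrightarrow> cj \<one> v = v"
  by (simp add: cj_def)

lemma cj_inv_cancel: "g \<in> carrier G \<Longrightarrow> v \<in> carrier G \<Longrightarrow> cj (inv g) (cj g v) = v"
  by (simp add: cj_def m_assoc)

lemma cj_eq_iff: "g \<in> carrier G \<Longrightarrow> v \<in> carrier G \<Longrightarrow> cj g v = v \<longleftrightarrow> g \<otimes> v = v \<otimes> g"
proof (rule iffI)
  assume *: "g \<in> carrier G" "v \<in> carrier G" and "cj g v = v"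
  then have "cj g v \<otimes> g = v \<otimes> g" by simp
  then show "g \<otimes> v = v \<otimes> g" using * by (simp add: cj_def m_assoc)
next
  assume *: "g \<in> carrier G" "v \<in> carrier G" and "g \<otimes> v = v \<otimes> g"
  then show "cj g v = v" by (simp add: cj_def m_assoc)
qed

end

text \<open>One inclusion between the two products is enough, since inversion gives the other
  (\<open>perm'\<close>). The product may be smaller than the carrier; \<open>full_product\<close>
  adds equality.\<close>

locale two_factors = group +
  fixes A B
  assumes plcA: "plc G A" and plcB: "plc G B"
    and perm: "\<And>a b. a \<in> A \<Longrightarrow> b \<in> B \<Longrightarrow> \<exists>a'\<in>A. \<exists>b'\<in>B. b \<otimes> a = a' \<otimes> b'"
begin

lemma Ac [simp]: "a \<in> A \<Longrightarrow> a \<in> carrier G" using plcA plc_closed by blast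
lemma Bc [simp]: "a \<in> B \<Longrightarrow> a \<in> carrier G" using plcB plc_closed by blast

lemma sA: "subgroup A G" using plcA plc_subgroup by blast
lemma sB: "subgroup B G" using plcB plc_subgroup by blast

lemma A_closed [simp]: "\<one> \<in> A" "a \<in> A \<Longrightarrow> inv a \<in> A" "a \<in> A \<Longrightarrow> b \<in> A \<Longrightarrow> a \<otimes> b \<in> A"
  using sA by (auto simp: subgroup.one_closed subgroup.m_inv_closed subgroup.m_closed)

lemma B_closed [simp]: "\<one> \<in> B" "a \<in> B \<Longrightarrow> inv a \<in> B" "a \<in> B \<Longrightarrow> b \<in> B \<Longrightarrow> a \<otimes> b \<in> B"
  using sB by (auto simp: subgroup.one_closed subgroup.m_inv_closed subgroup.m_closed)

lemma A_pow [simp]: "a \<in> A \<Longrightarrow> a [^] (k::nat) \<in> A"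
  using subgroup_pow[OF sA] by simp

lemma B_pow [simp]: "a \<in> B \<Longrightarrow> a [^] (k::nat) \<in> B"
  using subgroup_pow[OF sB] by simp

lemma A_comm: "a \<in> A \<Longrightarrow> b \<in> A \<Longrightarrow> a \<otimes> b = b \<otimes> a" using plc_commute[OF plcA] by blast
lemma B_comm: "a \<in> B \<Longrightarrow> b \<in> B \<Longrightarrow> a \<otimes> b = b \<otimes> a" using plc_commute[OF plcB] by blast

lemma A_lcomm: "a \<in> A \<Longrightarrow> b \<in> A \<Longrightarrow> x \<in> carrier G \<Longrightarrow> a \<otimes> (b \<otimes> x) = b \<otimes> (a \<otimes> x)"
  using A_comm by (simp flip: m_assoc)
lemma B_lcomm: "a \<in> B \<Longrightarrow> b \<in> B \<Longrightarrow> x \<in> carrier G \<Longrightarrow> a \<otimes> (b \<otimes> x) = b \<otimes> (a \<otimes> x)"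
  using B_comm by (simp flip: m_assoc)

lemma perm':
  assumes "a \<in> A" "b \<in> B" shows "\<exists>b'\<in>B. \<exists>a'\<in>A. a \<otimes> b = b' \<otimes> a'"
proof -
  obtain a' b' where *: "a' \<in> A" "b' \<in> B" "inv b \<otimes> inv a = a' \<otimes> b'"
    using perm[of "inv a" "inv b"] assms by auto
  have "a \<otimes> b = inv (inv b \<otimes> inv a)" using assms by (simp add: inv_mult_group)
  also have "\<dots> = inv b' \<otimes> inv a'" using * by (simp add: inv_mult_group)
  finally show ?thesis using * by (meson A_closed(2) B_closed(2))
qed

lemma swap: "two_factors G B A"
  using plcA plcB perm' by unfold_locales auto

section \<open>Ito's theorem: the commutators of the two factors commute\<close>

definition comm where "comm x y = x \<otimes> y \<otimes> inv x \<otimes> inv y"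

lemma comm_closed [simp]: "x \<in> carrier G \<Longrightarrow> y \<in> carrier G \<Longrightarrow> comm x y \<in> carrier G"
  by (simp add: comm_def)

lemma cj_eq_one: "x \<in> carrier G \<Longrightarrow> v \<in> carrier G \<Longrightarrow> cj x v = \<one> \<Longrightarrow> v = \<one>"
proof -
  assume *: "x \<in> carrier G" "v \<in> carrier G" "cj x v = \<one>"
  have "cj (inv x) (cj x v) = v" using *(1,2) by (simp add: cj_def m_assoc)
  then show "v = \<one>" using *(1,3) by (simp add: cj_one)
qed

lemma cj_comm: "x \<in> carrier G \<Longrightarrow> a \<in> carrier G \<Longrightarrow> b \<in> carrier G \<Longrightarrow> cj x (comm a b) = comm (cj x a) (cj x b)"
  by (simp add: cj_def comm_def m_assoc inv_mult_group)

lemma cj_A: "a \<in> A \<Longrightarrow> b \<in> A \<Longrightarrow> cj a b = b"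
  using A_comm[of a b] by (simp add: cj_def m_assoc)

lemma cj_B: "a \<in> B \<Longrightarrow> b \<in> B \<Longrightarrow> cj a b = b"
  using B_comm[of a b] by (simp add: cj_def m_assoc)

text \<open>\<open>c\<close> commutes with \<open>a\<close> and cancels. With
  \<open>comm_drop_B\<close> this lets conjugates of the form \<open>b' \<otimes> a'\<close> or
  \<open>a' \<otimes> b'\<close> be replaced inside a commutator by their \<open>B\<close>-part or
  \<open>A\<close>-part.\<close>

lemma comm_drop_A:
  assumes "a \<in> A" "b \<in> B" "c \<in> A" shows "comm a (b \<otimes> c) = comm a b"
proof -
  have "c \<otimes> (inv a \<otimes> (inv c \<otimes> inv b)) = inv a \<otimes> inv b"
    using assms A_lcomm[of c "inv a" "inv c \<otimes> inv b"] by simp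
  then show ?thesis using assms by (simp add: comm_def m_assoc inv_mult_group)
qed

lemma comm_drop_B:
  assumes "a \<in> A" "b \<in> B" "c \<in> B" shows "comm (a \<otimes> c) b = comm a b"
proof -
  have "c \<otimes> (b \<otimes> (inv c \<otimes> (inv a \<otimes> inv b))) = b \<otimes> (inv a \<otimes> inv b)"
    using assms B_lcomm[of c b "inv c \<otimes> (inv a \<otimes> inv b)"] by simp
  then show ?thesis using assms by (simp add: comm_def m_assoc inv_mult_group)
qed

lemma cj_A_B:
  assumes "x \<in> A" "b \<in> B" obtains b' a' where "b' \<in> B" "a' \<in> A" "cj x b = b' \<otimes> a'"
proof -
  obtain b' a' where *: "b' \<in> B" "a' \<in> A" "x \<otimes> b = b' \<otimes> a'" using perm' assms by blast
  then have "cj x b = b' \<otimes> (a' \<otimes> inv x)" using assms by (simp add: cj_def m_assoc)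
  then show ?thesis using that[of b' "a' \<otimes> inv x"] * assms by simp
qed

lemma cj_B_A:
  assumes "y \<in> B" "a \<in> A" obtains a' b' where "a' \<in> A" "b' \<in> B" "cj y a = a' \<otimes> b'"
proof -
  obtain b' a' where *: "b' \<in> B" "a' \<in> A" "y \<otimes> a = a' \<otimes> b'" using perm assms by blast
  then have "cj y a = a' \<otimes> (b' \<otimes> inv y)" using assms by (simp add: cj_def m_assoc)
  then show ?thesis using that[of a' "b' \<otimes> inv y"] * assms by simp
qed

definition D where "D = {comm a b | a b. a \<in> A \<and> b \<in> B}"
definition U where "U = generate G D"

lemma D_closed: "D \<subseteq> carrier G" by (auto simp: D_def)

text \<open>Conjugation by \<open>x\<close> fixes \<open>a\<close> and turns \<open>b\<close> into
  \<open>b' \<otimes> a'\<close>, of which the commutator sees only \<open>b'\<close>.\<close>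

lemma cj_A_D:
  assumes "x \<in> A" "d \<in> D" shows "cj x d \<in> D"
proof -
  obtain a b where ab: "a \<in> A" "b \<in> B" "d = comm a b" using assms D_def by auto
  obtain b' a' where "b' \<in> B" "a' \<in> A" "cj x b = b' \<otimes> a'" using cj_A_B assms(1) ab(2) by blast
  then have "cj x d = comm a b'" using ab assms by (simp add: cj_comm cj_A comm_drop_A)
  then show ?thesis using ab \<open>b' \<in> B\<close> by (auto simp: D_def)
qed

text \<open>Ito's computation, which makes the commutators of \<open>A\<close> and \<open>B\<close> commute.\<close>

lemma cj_D_commute:
  assumes "x \<in> A" "y \<in> B" "d \<in> D"
  shows "cj x (cj y d) = cj y (cj x d)"
proof -
  obtain a b where ab: "a \<in> A" "b \<in> B" "d = comm a b" using assms D_def by auto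
  obtain b1 a1 where 1: "b1 \<in> B" "a1 \<in> A" "cj x b = b1 \<otimes> a1" using cj_A_B assms(1) ab(2) by blast
  obtain a2 b2 where 2: "b2 \<in> B" "a2 \<in> A" "cj y a = a2 \<otimes> b2" using cj_B_A assms(2) ab(1) by blast
  have "cj y (cj x d) = comm a2 b1"
    using 1 2 ab assms by (simp add: cj_comm cj_A cj_B comm_drop_A comm_drop_B)
  moreover have "cj x (cj y d) = comm a2 b1"
    using 1 2 ab assms by (simp add: cj_comm cj_A cj_B comm_drop_A comm_drop_B)
  ultimately show ?thesis by simp
qed

lemma cj_eq_commute: "x \<in> carrier G \<Longrightarrow> v \<in> carrier G \<Longrightarrow> cj x v = v \<longleftrightarrow> x \<otimes> v = v \<otimes> x"
proof (rule iffI)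
  assume *: "x \<in> carrier G" "v \<in> carrier G" and "cj x v = v"
  then have "cj x v \<otimes> x = v \<otimes> x" by simp
  then show "x \<otimes> v = v \<otimes> x" using * by (simp add: cj_def m_assoc)
next
  assume *: "x \<in> carrier G" "v \<in> carrier G" and "x \<otimes> v = v \<otimes> x"
  then show "cj x v = v" by (simp add: cj_def m_assoc)
qed

text \<open>Conjugations by \<open>A\<close> and by \<open>B\<close> commute with each other on
  \<open>D\<close>, so a commutator \<open>comm a b\<close> conjugates the elements of
  \<open>D\<close> trivially.\<close>

lemma D_commute:
  assumes "c \<in> D" "d \<in> D" shows "c \<otimes> d = d \<otimes> c"
proof -
  obtain a b where ab: "a \<in> A" "b \<in> B" "c = comm a b" using assms D_def by auto
  have dc: "d \<in> carrier G" using assms D_closed by blast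
  have "cj (inv b) (cj (inv a) d) = cj (inv a) (cj (inv b) d)"
    using cj_D_commute[of "inv a" "inv b" d] ab assms by simp
  then have "cj a (cj b (cj (inv b) (cj (inv a) d))) = cj a (cj b (cj (inv a) (cj (inv b) d)))"
    by simp
  then have "d = cj c d"
    using ab dc by (simp add: comm_def cj_def m_assoc inv_mult_group)
  then show ?thesis using cj_eq_commute[of c d] dc assms D_closed by auto
qed

end

lemma (in group) commute_generate:
  assumes "y \<in> generate G S" "S \<subseteq> carrier G" "x \<in> carrier G" "\<And>s. s \<in> S \<Longrightarrow> x \<otimes> s = s \<otimes> x"
  shows "x \<otimes> y = y \<otimes> x"
  using assms(1)
proof (induction rule: generate.induct)
  case one then show ?case using assms by simp
next
  case (incl h) then show ?case using assms by simp
next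
  case (inv h)
  then have "h \<in> carrier G" "x \<otimes> h = h \<otimes> x" using assms by auto
  then show ?case using assms(3) by (metis inv_closed inv_solve_left inv_solve_right m_assoc m_closed)
next
  case (eng h1 h2)
  have c: "h1 \<in> carrier G" "h2 \<in> carrier G" using eng generate_in_carrier[OF assms(2)] by auto
  have "x \<otimes> (h1 \<otimes> h2) = x \<otimes> h1 \<otimes> h2" using c assms(3) by (simp add: m_assoc)
  also have "\<dots> = h1 \<otimes> (x \<otimes> h2)" using eng c assms(3) by (simp add: m_assoc)
  also have "\<dots> = h1 \<otimes> h2 \<otimes> x" using eng assms(3) c by (simp add: m_assoc)
  finally show ?case .
qed

lemma (in group) set_multI: "a \<in> A \<Longrightarrow> b \<in> B \<Longrightarrow> a \<otimes> b \<in> A <#> B"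
  by (auto simp: set_mult_def)

lemma (in group) set_multE:
  assumes "x \<in> A <#> B" obtains a b where "a \<in> A" "b \<in> B" "x = a \<otimes> b"
  using assms by (auto simp: set_mult_def)

lemma (in group) subgroup_set_mult_commute:
  assumes A: "subgroup A G" and B: "subgroup B G" and AB: "A <#> B = B <#> A"
  shows "subgroup (A <#> B) G"
proof (rule subgroupI)
  have c: "A \<subseteq> carrier G" "B \<subseteq> carrier G" using assms subgroup.subset by auto
  then show "A <#> B \<subseteq> carrier G" using set_mult_closed by blast
  show "A <#> B \<noteq> {}"
    using set_multI[OF subgroup.one_closed[OF A] subgroup.one_closed[OF B]] by blast
  fix x assume "x \<in> A <#> B"
  then obtain a b where ab: "a \<in> A" "b \<in> B" "x = a \<otimes> b" by (rule set_multE)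
  then have "inv x = inv b \<otimes> inv a" using c by (simp add: inv_mult_group subset_eq)
  then show "inv x \<in> A <#> B"
    using AB set_multI[OF subgroup.m_inv_closed[OF B ab(2)] subgroup.m_inv_closed[OF A ab(1)]] by simp
  fix y assume "y \<in> A <#> B"
  then obtain a' b' where ab': "a' \<in> A" "b' \<in> B" "y = a' \<otimes> b'" by (rule set_multE)
  have "b \<otimes> a' \<in> A <#> B" using set_multI[OF ab(2) ab'(1)] AB by simp
  then obtain a'' b'' where ab'': "a'' \<in> A" "b'' \<in> B" "b \<otimes> a' = a'' \<otimes> b''" by (rule set_multE)
  have cc: "a \<in> carrier G" "b \<in> carrier G" "a' \<in> carrier G" "b' \<in> carrier G"
    "a'' \<in> carrier G" "b'' \<in> carrier G" using ab ab' ab'' c by auto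
  have "x \<otimes> y = a \<otimes> (b \<otimes> a') \<otimes> b'" using ab ab' cc by (simp add: m_assoc)
  also have "\<dots> = (a \<otimes> a'') \<otimes> (b'' \<otimes> b')" using ab''(3) cc by (simp add: m_assoc)
  finally show "x \<otimes> y \<in> A <#> B"
    using set_multI[OF subgroup.m_closed[OF A ab(1) ab''(1)] subgroup.m_closed[OF B ab''(2) ab'(2)]] by simp
qed

lemma (in group) finite_generate_commute:
  assumes "finite S" "S \<subseteq> carrier G" "\<And>s. s \<in> S \<Longrightarrow> torsion G s"
    "\<And>s t. s \<in> S \<Longrightarrow> t \<in> S \<Longrightarrow> s \<otimes> t = t \<otimes> s"
  shows "finite (generate G S)"
  using assms
proof (induction S rule: finite_induct)
  case empty then show ?case using generate_empty by simp
next
  case (insert x S)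
  let ?K = "cyc G x <#> generate G S"
  have x: "x \<in> carrier G" "torsion G x" and S: "S \<subseteq> carrier G" using insert by auto
  have fin: "finite (generate G S)" using insert by simp
  have gc: "generate G S \<subseteq> carrier G" using generate_incl S by blast
  have sub: "subgroup (generate G S) G" using generate_is_subgroup S by blast
  have sc: "subgroup (cyc G x) G" using cyc_subgroup x by blast
  have comm: "y \<otimes> z = z \<otimes> y" if "y \<in> cyc G x" "z \<in> generate G S" for y z
  proof -
    have "x \<otimes> z = z \<otimes> x" using commute_generate[OF that(2) S x(1)] insert by simp
    moreover have "z \<in> carrier G" using that gc by blast
    ultimately have "z \<otimes> x [^] k = x [^] k \<otimes> z" for k :: nat
      using x(1) by (induction k) (simp_all, metis m_assoc nat_pow_closed)
    then show ?thesis using that(1) cycE by metis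
  qed
  have "cyc G x <#> generate G S = generate G S <#> cyc G x"
    unfolding set_mult_def using comm by force
  then have "subgroup ?K G" using subgroup_set_mult_commute sc sub by blast
  moreover have "insert x S \<subseteq> ?K"
  proof
    fix y assume "y \<in> insert x S"
    then consider "y = x" | "y \<in> S" by blast
    then show "y \<in> ?K"
    proof cases
      case 1
      then have "y = x \<otimes> \<one>" using x by simp
      then show ?thesis unfolding set_mult_def
        using cyc_self[OF x(1)] subgroup.one_closed[OF sub] by blast
    next
      case 2
      then have "y = \<one> \<otimes> y" "y \<in> generate G S" using S by (auto simp: generate.incl)
      then show ?thesis unfolding set_mult_def using one_in_cyc[of G x] by blast
    qed
  qed
  ultimately have "generate G (insert x S) \<subseteq> ?K" using generate_subgroup_incl by blast
  moreover have "finite ?K" unfolding set_mult_def using finite_cyc[OF x] fin by simp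
  ultimately show ?case using finite_subset by blast
qed

section \<open>The commutative radical ring on the commutator subgroup\<close>

context two_factors
begin

lemma U_sub: "subgroup U G" unfolding U_def using generate_is_subgroup[OF D_closed] .

lemma U_c [simp]: "u \<in> U \<Longrightarrow> u \<in> carrier G" using subgroup.mem_carrier[OF U_sub] .

lemma U_closed [simp]: "\<one> \<in> U" "u \<in> U \<Longrightarrow> inv u \<in> U" "u \<in> U \<Longrightarrow> v \<in> U \<Longrightarrow> u \<otimes> v \<in> U"
  using U_sub by (auto simp: subgroup.one_closed subgroup.m_inv_closed subgroup.m_closed)

lemma U_pow [simp]: "u \<in> U \<Longrightarrow> u [^] (k::nat) \<in> U"
  using subgroup_pow[OF U_sub] by simp

lemma D_U: "a \<in> A \<Longrightarrow> b \<in> B \<Longrightarrow> comm a b \<in> U"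
  unfolding U_def by (rule generate.incl) (auto simp: D_def)

lemma U_comm:
  assumes "u \<in> U" "v \<in> U" shows "u \<otimes> v = v \<otimes> u"
proof -
  have "u \<otimes> d = d \<otimes> u" if "d \<in> D" for d
    using commute_generate[of u D d] assms(1) that D_closed D_commute unfolding U_def by (metis subsetD)
  then show ?thesis
    using commute_generate[of v D u] assms D_closed U_c unfolding U_def by metis
qed

lemma U_lcomm: "u \<in> U \<Longrightarrow> v \<in> U \<Longrightarrow> x \<in> carrier G \<Longrightarrow> u \<otimes> (v \<otimes> x) = v \<otimes> (u \<otimes> x)"
  using U_comm by (simp flip: m_assoc)

lemma cj_U:
  assumes "g \<in> carrier G" "\<And>d. d \<in> D \<Longrightarrow> cj g d \<in> D" "u \<in> U"
  shows "cj g u \<in> U"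
  using assms(3) unfolding U_def
proof (induction rule: generate.induct)
  case one
  then show ?case using assms(1) generate.one by (simp add: cj_one)
next
  case (incl h)
  then show ?case using assms(2) generate.incl by metis
next
  case (inv h)
  then have "cj g (inv h) = inv (cj g h)" using assms(1) D_closed by (simp add: cj_inv subset_eq)
  then show ?case using generate.inv[OF assms(2)[OF inv]] by simp
next
  case (eng h1 h2)
  then show ?case using assms(1) generate_in_carrier[OF D_closed] generate.eng by (simp add: cj_mult)
qed

lemma cj_A_U [simp]: "a \<in> A \<Longrightarrow> u \<in> U \<Longrightarrow> cj a u \<in> U"
  using cj_U cj_A_D by simp

text \<open>The radical ring: \<open>u = a b\<close> in \<open>U\<close> with \<open>a \<in> A\<close> and \<open>b \<in> B\<close>
  multiplies \<open>v\<close> to the commutator of \<open>a\<close> and \<open>v\<close>.\<close>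

definition factor where "factor u a \<longleftrightarrow> a \<in> A \<and> inv a \<otimes> u \<in> B"

definition tt where "tt a v = cj a v \<otimes> inv v"

definition fac where "fac u = (SOME a. factor u a)"

definition star where "star u v = tt (fac u) v"

lemma AB_mult:
  assumes "a \<in> A" "b \<in> B" "c \<in> A" "d \<in> B"
  shows "\<exists>x\<in>A. \<exists>y\<in>B. (a \<otimes> b) \<otimes> (c \<otimes> d) = x \<otimes> y"
proof -
  obtain c' b' where *: "c' \<in> A" "b' \<in> B" "b \<otimes> c = c' \<otimes> b'" using perm assms by blast
  have "(a \<otimes> b) \<otimes> (c \<otimes> d) = a \<otimes> (b \<otimes> c) \<otimes> d" using assms by (simp add: m_assoc)
  also have "\<dots> = (a \<otimes> c') \<otimes> (b' \<otimes> d)" unfolding *(3) using assms * by (simp add: m_assoc)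
  finally show ?thesis using assms * by (meson A_closed(3) B_closed(3))
qed

lemma AB_inv:
  assumes "a \<in> A" "b \<in> B" shows "\<exists>x\<in>A. \<exists>y\<in>B. inv (a \<otimes> b) = x \<otimes> y"
  using perm[of "inv a" "inv b"] assms by (simp add: inv_mult_group)

lemma U_AB:
  assumes "u \<in> U" shows "\<exists>a\<in>A. \<exists>b\<in>B. u = a \<otimes> b"
proof -
  have D: "\<exists>a\<in>A. \<exists>b\<in>B. d = a \<otimes> b" if d: "d \<in> D" for d
  proof -
    obtain a b where ab: "a \<in> A" "b \<in> B" "d = comm a b" using d D_def by auto
    obtain x y where xy: "x \<in> A" "y \<in> B" "(a \<otimes> b) \<otimes> (inv a \<otimes> inv b) = x \<otimes> y"
      using AB_mult[of a b "inv a" "inv b"] ab by auto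
    then have "d = x \<otimes> y" using ab by (simp add: comm_def m_assoc)
    then show ?thesis using xy by blast
  qed
  show ?thesis using assms unfolding U_def
  proof (induction rule: generate.induct)
    case one
    have "\<one> = \<one> \<otimes> \<one>" by simp
    then show ?case using A_closed(1) B_closed(1) by blast
  next
    case (incl h) then show ?case using D by blast
  next
    case (inv h) then show ?case using D AB_inv by metis
  next
    case (eng h1 h2) then show ?case using AB_mult by metis
  qed
qed

lemma factor_ex: "u \<in> U \<Longrightarrow> \<exists>a. factor u a"
  using U_AB[of u] by (auto simp: factor_def)

lemma factor_fac: "u \<in> U \<Longrightarrow> factor u (fac u)"
  unfolding fac_def using factor_ex someI_ex by metis

lemma factor_A: "factor u a \<Longrightarrow> a \<in> A" by (simp add: factor_def)

lemma tt_U [simp]: "a \<in> A \<Longrightarrow> v \<in> U \<Longrightarrow> tt a v \<in> U" by (simp add: tt_def)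

lemma tt_mult:
  assumes "a \<in> A" "u \<in> U" "v \<in> U" shows "tt a (u \<otimes> v) = tt a u \<otimes> tt a v"
proof -
  have "cj a v \<otimes> (inv v \<otimes> inv u) = inv u \<otimes> (cj a v \<otimes> inv v)"
    using assms U_lcomm[of "cj a v" "inv u" "inv v"] U_comm[of "inv v" "inv u"] by simp
  then show ?thesis using assms by (simp add: tt_def cj_mult inv_mult_group m_assoc)
qed

lemma tt_one: "a \<in> A \<Longrightarrow> tt a \<one> = \<one>"
  by (simp add: tt_def cj_one)

lemma tt_inv: "a \<in> A \<Longrightarrow> u \<in> U \<Longrightarrow> tt a (inv u) = inv (tt a u)"
  using tt_mult[of a u "inv u"] tt_mult[of a "inv u" u] tt_one[of a] by (simp add: inv_equality)

lemma tt_pow: "a \<in> A \<Longrightarrow> u \<in> U \<Longrightarrow> tt a (u [^] (k::nat)) = tt a u [^] k"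
  by (induction k) (simp_all add: tt_one tt_mult)

lemma tt_cj: "a \<in> A \<Longrightarrow> b \<in> A \<Longrightarrow> u \<in> U \<Longrightarrow> tt a (cj b u) = cj b (tt a u)"
  using A_comm[of a b] by (simp add: tt_def cj_mult cj_inv flip: cj_comp)

lemma tt_tt: "a \<in> A \<Longrightarrow> b \<in> A \<Longrightarrow> u \<in> U \<Longrightarrow> tt a (tt b u) = tt b (tt a u)"
  by (simp add: tt_def[of b] tt_mult tt_inv tt_cj)

text \<open>The left side is the circle operation \<open>u + v + u v\<close> of the ring; the right
  side separates it into an \<open>A\<close>-part and a \<open>B\<close>-part.\<close>

lemma factor_mult:
  assumes "u \<in> U" "v \<in> U" "factor u a" "factor v c"
  shows "cj a v \<otimes> u = (a \<otimes> c) \<otimes> ((inv c \<otimes> v) \<otimes> (inv a \<otimes> u))"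
  using assms by (simp add: factor_def cj_def m_assoc)

text \<open>Both parts in \<open>factor_mult\<close> are symmetric, because \<open>A\<close> and
  \<open>B\<close> are abelian. This one identity shows that \<open>star\<close> is commutative and
  also that it does not depend on the chosen factorisation.\<close>

lemma tt_commute:
  assumes u: "u \<in> U" and v: "v \<in> U" and a: "factor u a" and c: "factor v c"
  shows "tt a v = tt c u"
proof -
  have "cj a v \<otimes> u = cj c u \<otimes> v"
    using factor_mult[OF u v a c] factor_mult[OF v u c a] a c A_comm[of a c]
      B_comm[of "inv c \<otimes> v" "inv a \<otimes> u"] by (simp add: factor_def)
  then have "cj a v \<otimes> u \<otimes> inv u \<otimes> inv v = cj c u \<otimes> v \<otimes> inv u \<otimes> inv v" by simp
  moreover have "a \<in> A" "c \<in> A" using a c by (auto simp: factor_def)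
  moreover have "v \<otimes> (inv u \<otimes> inv v) = inv u"
    using u v U_lcomm[of v "inv u" "inv v"] by simp
  ultimately show ?thesis using u v by (simp add: tt_def m_assoc)
qed

lemma star_factor: "u \<in> U \<Longrightarrow> v \<in> U \<Longrightarrow> factor u a \<Longrightarrow> star u v = tt a v"
  unfolding star_def using tt_commute factor_fac by metis

lemma star_commute: "u \<in> U \<Longrightarrow> v \<in> U \<Longrightarrow> star u v = star v u"
  unfolding star_def using tt_commute factor_fac by metis

lemma fac_A [simp]: "u \<in> U \<Longrightarrow> fac u \<in> A" using factor_fac factor_A by blast

lemma star_U [simp]: "u \<in> U \<Longrightarrow> v \<in> U \<Longrightarrow> star u v \<in> U"
  by (simp add: star_def)

lemma star_inv: "u \<in> U \<Longrightarrow> v \<in> U \<Longrightarrow> star u (inv v) = inv (star u v)"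
  by (simp add: star_def tt_inv)

lemma star_one: "u \<in> U \<Longrightarrow> star u \<one> = \<one>"
  by (simp add: star_def tt_one)

lemma star_pow: "u \<in> U \<Longrightarrow> v \<in> U \<Longrightarrow> star u (v [^] (k::nat)) = star u v [^] k"
  by (simp add: star_def tt_pow)

text \<open>By commutativity \<open>w\<close> can act from the left, where it and \<open>u\<close>
  act as the commuting operators \<open>tt (fac w)\<close> and \<open>tt (fac u)\<close>.\<close>

lemma star_assoc:
  assumes "u \<in> U" "v \<in> U" "w \<in> U" shows "star (star u v) w = star u (star v w)"
proof -
  have "star (star u v) w = star w (star u v)" using assms star_commute by simp
  also have "\<dots> = star u (star w v)" using assms by (simp add: star_def tt_tt)
  also have "\<dots> = star u (star v w)" using assms star_commute by simp
  finally show ?thesis .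
qed

text \<open>In ring terms \<open>r v = - v\<close> means that \<open>1 + r\<close> kills
  \<open>v\<close>, but \<open>1 + r\<close> acts as conjugation by \<open>fac r\<close>, which is
  injective.\<close>

lemma star_quasi:
  assumes "r \<in> U" "v \<in> U" "star r v = inv v" shows "v = \<one>"
proof -
  have "cj (fac r) v \<otimes> inv v = \<one> \<otimes> inv v" using assms by (simp add: star_def tt_def)
  then have "cj (fac r) v = \<one>" using assms by simp
  then show ?thesis by (rule cj_eq_one[rotated 2]) (use assms in simp_all)
qed

section \<open>Torsion and nilpotency in the radical ring\<close>

lemma A_torsion: "a \<in> A \<Longrightarrow> \<exists>n::nat. n > 0 \<and> a [^] n = \<one>"
  using plc_torsion[OF plcA] by (simp add: torsion_def)

lemma B_torsion: "a \<in> B \<Longrightarrow> \<exists>n::nat. n > 0 \<and> a [^] n = \<one>"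
  using plc_torsion[OF plcB] by (simp add: torsion_def)

text \<open>With \<open>u = a b\<close>, sorting the factors of a power of \<open>u\<close> costs
  only an element \<open>tt a s\<close>. An exponent that kills \<open>a\<close> and
  \<open>b\<close> therefore puts that power of \<open>u\<close> into the image of
  \<open>tt a\<close>.\<close>

lemma pow_prod:
  fixes k :: nat
  assumes "u \<in> U" "factor u a"
  shows "\<exists>s\<in>U. a [^] k \<otimes> (inv a \<otimes> u) [^] k = u [^] k \<otimes> tt a s"
proof (induction k)
  case 0
  have "a \<in> A" using assms by (simp add: factor_def)
  then show ?case using tt_one U_closed(1) by (intro bexI[of _ \<one>]) auto
next
  case (Suc k)
  then obtain s where s: "s \<in> U" "a [^] k \<otimes> (inv a \<otimes> u) [^] k = u [^] k \<otimes> tt a s" by blast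
  have a: "a \<in> A" using assms by (simp add: factor_def)
  define b where "b = inv a \<otimes> u"
  have b: "b \<in> carrier G" using a assms by (simp add: b_def)
  have "a [^] Suc k \<otimes> b [^] Suc k = a \<otimes> (a [^] k \<otimes> b [^] k) \<otimes> b"
    using a b A_lcomm[of "a [^] k" a] by (simp add: m_assoc)
  also have "\<dots> = cj a (u [^] k \<otimes> tt a s) \<otimes> u"
    using s a assms by (simp add: b_def cj_def m_assoc)
  also have "\<dots> = cj a (u [^] k) \<otimes> cj a (tt a s) \<otimes> u"
    using s a assms by (simp add: cj_mult)
  also have "cj a (u [^] k) = tt a (u [^] k) \<otimes> u [^] k" using a assms by (simp add: tt_def m_assoc)
  also have "tt a (u [^] k) \<otimes> u [^] k \<otimes> cj a (tt a s) \<otimes> u = u [^] Suc k \<otimes> (tt a (u [^] k) \<otimes> tt a (cj a s))"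
    using a assms s U_comm[of "tt a (u [^] k)" "u [^] k \<otimes> cj a (tt a s) \<otimes> u"]
      U_comm[of "cj a (tt a s)" u] U_comm[of "cj a (tt a s)" "tt a (u [^] k)"]
    by (simp add: m_assoc tt_cj)
  also have "\<dots> = u [^] Suc k \<otimes> tt a (u [^] k \<otimes> cj a s)"
    using a assms s by (simp add: tt_mult)
  finally show ?case using a assms s by (intro bexI[of _ "u [^] k \<otimes> cj a s"]) (simp_all add: b_def)
qed

text \<open>Some \<open>u [^] n\<close> lies in the image of \<open>tt a\<close>. By
  \<open>tt_commute\<close> it equals \<open>tt c u\<close> for some \<open>c\<close> in
  \<open>A\<close>, so \<open>c\<close> raises \<open>u\<close> to the power \<open>n + 1\<close>.
  As \<open>c\<close> has finite order \<open>N\<close>, the positive exponent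
  \<open>(n + 1) ^ N - 1\<close> kills \<open>u\<close>.\<close>

lemma U_torsion:
  assumes u: "u \<in> U" shows "torsion G u"
proof -
  obtain a where a: "factor u a" using factor_ex u by blast
  have aA: "a \<in> A" "inv a \<otimes> u \<in> B" using a by (auto simp: factor_def)
  obtain n1 where n1: "n1 > 0" "a [^] (n1::nat) = \<one>" using A_torsion aA by blast
  obtain n2 where n2: "n2 > 0" "(inv a \<otimes> u) [^] (n2::nat) = \<one>" using B_torsion aA by blast
  define n where "n = n1 * n2"
  have "a [^] n = (a [^] n1) [^] n2" "(inv a \<otimes> u) [^] n = ((inv a \<otimes> u) [^] n2) [^] n1"
    using aA u by (simp_all add: n_def nat_pow_pow mult.commute del: nat_pow_Suc)
  then have n: "n > 0" "a [^] n = \<one>" "(inv a \<otimes> u) [^] n = \<one>"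
    using n1 n2 by (simp_all add: n_def)
  obtain s where s: "s \<in> U" "u [^] n \<otimes> tt a s = \<one>" using pow_prod[OF u a, of n] n by auto
  then have un: "tt a (inv s) = u [^] n"
    using u aA by (simp add: tt_inv inv_equality)
  obtain c where c: "factor (inv s) c" using factor_ex[of "inv s"] s by auto
  have cA: "c \<in> A" using c by (simp add: factor_def)
  have "tt c u = u [^] n" using tt_commute[OF u _ a c] un s by simp
  then have "cj c u = u [^] n \<otimes> u" using u cA by (simp add: tt_def inv_solve_right')
  then have cj: "cj c u = u [^] (n + 1)" by simp
  have pw: "cj (c [^] k) u = u [^] ((n + 1) ^ k)" for k :: nat
  proof (induction k)
    case 0 then show ?case using u by (simp add: one_cj)
  next
    case (Suc k)
    have "cj (c [^] Suc k) u = cj (c [^] k) (cj c u)" using cA u by (simp add: cj_comp)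
    also have "\<dots> = (cj (c [^] k) u) [^] (n + 1)" unfolding cj using cA u by (intro cj_pow) simp_all
    also have "\<dots> = u [^] ((n + 1) ^ k * (n + 1))" unfolding Suc using u by (simp only: nat_pow_pow U_c)
    finally show ?case by (simp add: mult.commute)
  qed
  obtain N where N: "N > 0" "c [^] (N::nat) = \<one>" using A_torsion cA by blast
  have "u [^] ((n + 1) ^ N) = u" using pw[of N] N u by (simp add: one_cj)
  moreover have "1 < (n + 1) ^ N" using n N by (intro one_less_power) auto
  then have m: "(n + 1) ^ N = Suc ((n + 1) ^ N - 1)" "(n + 1) ^ N - 1 > 0" by auto
  moreover define m where "m = (n + 1) ^ N - 1"
  ultimately have "u [^] m \<otimes> u = \<one> \<otimes> u" using u by (metis U_c l_one nat_pow_Suc)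
  then have "u [^] m = \<one>" using u by (simp only: r_cancel U_c nat_pow_closed one_closed)
  moreover have "m > 0" using m m_def by simp
  ultimately show ?thesis unfolding torsion_def by blast
qed

text \<open>The ring has no identity, so counting starts at \<open>e\<close> itself:
  \<open>spow e k\<close> is the ring power with exponent \<open>k + 1\<close>. This accounts for
  the \<open>Suc\<close> in \<open>spow_add\<close>.\<close>

fun spow where
  "spow e 0 = e"
| "spow e (Suc k) = star e (spow e k)"

lemma spow_U [simp]: "e \<in> U \<Longrightarrow> spow e k \<in> U"
  by (induction k) simp_all

lemma spow_add: "e \<in> U \<Longrightarrow> star (spow e k) (spow e l) = spow e (Suc (k + l))"
  by (induction k) (simp_all add: star_assoc)

lemma spow_one_mono: "e \<in> U \<Longrightarrow> spow e k = \<one> \<Longrightarrow> k \<le> l \<Longrightarrow> spow e l = \<one>"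
  by (induction l) (auto simp: le_Suc_eq star_one)

lemma spow_prime: "e \<in> U \<Longrightarrow> e [^] (p::nat) = \<one> \<Longrightarrow> spow e k [^] p = \<one>"
  by (induction k) (simp_all add: star_one flip: star_pow)

text \<open>With \<open>a = fac e\<close>, multiplication by \<open>e\<close> is
  \<open>tt a\<close>. So all ring powers stay in the group generated by the conjugates of
  \<open>e\<close> under powers of \<open>a\<close>; these are finitely many, and a finitely
  generated abelian torsion group is finite.\<close>

lemma finite_spow:
  assumes e: "e \<in> U" shows "finite (range (spow e))"
proof -
  define a where "a = fac e"
  have a: "a \<in> A" using e by (simp add: a_def)
  obtain n where n: "n > 0" "a [^] (n::nat) = \<one>" using A_torsion a by blast
  define S where "S = (\<lambda>i. cj (a [^] i) e) ` {..<n}"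
  have S: "S \<subseteq> U" using a e by (auto simp: S_def)
  have Sc: "S \<subseteq> carrier G" using S U_c by blast
  have fin: "finite (generate G S)"
  proof (rule finite_generate_commute)
    show "finite S" by (simp add: S_def)
    show "torsion G s" if "s \<in> S" for s using U_torsion[OF subsetD[OF S that]] .
    show "s \<otimes> t = t \<otimes> s" if "s \<in> S" "t \<in> S" for s t
      using U_comm[OF subsetD[OF S that(1)] subsetD[OF S that(2)]] .
  qed (rule Sc)
  have inS: "cj (a [^] i) e \<in> S" for i :: nat
  proof -
    have "a [^] i = a [^] (i mod n)" using a n by (intro pow_cong[of a n]) auto
    then show ?thesis using n unfolding S_def by auto
  qed
  have actS: "cj a s \<in> S" if s: "s \<in> S" for s
  proof -
    obtain i :: nat where "s = cj (a [^] i) e" using s unfolding S_def by blast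
    then have "cj a s = cj (a [^] (Suc i)) e"
      using a e A_comm[of a "a [^] i"] by (simp flip: cj_comp)
    then show ?thesis using inS[of "Suc i"] by simp
  qed
  have cj: "cj a s \<in> generate G S" if "s \<in> generate G S" for s
    using that
  proof (induction rule: generate.induct)
    case one then show ?case using a generate.one by (simp add: cj_one)
  next
    case (incl h) then show ?case using actS generate.incl by metis
  next
    case (inv h)
    then have "cj a (inv h) = inv (cj a h)" using a Sc by (simp add: cj_inv subset_eq)
    then show ?case using generate.inv[OF actS[OF inv]] by simp
  next
    case (eng h1 h2)
    then show ?case using a generate_in_carrier[OF Sc] generate.eng by (simp add: cj_mult)
  qed
  have "spow e k \<in> generate G S" for k
  proof (induction k)
    case 0
    have "e \<in> S" using inS[of 0] e by (simp add: one_cj)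
    then show ?case using generate.incl by simp
  next
    case (Suc k)
    have "inv (spow e k) \<in> generate G S"
      using subgroup.m_inv_closed[OF generate_is_subgroup[OF Sc]] Suc by blast
    then show ?case using cj[OF Suc] generate.eng
      by (simp add: star_def tt_def flip: a_def)
  qed
  then have "range (spow e) \<subseteq> generate G S" by blast
  then show ?thesis using fin by (rule finite_subset)
qed

text \<open>Two ring powers of \<open>e\<close> coincide, which reads \<open>r v = v\<close> with
  \<open>v\<close> and \<open>r\<close> powers of \<open>e\<close>. Applying
  \<open>star_quasi\<close> to \<open>- r\<close> gives \<open>v = 0\<close>, so \<open>e\<close> is
  nilpotent, and its last nonzero power has square zero.\<close>

lemma square_zero:
  assumes "e \<in> U" "e \<noteq> \<one>" "e [^] (p::nat) = \<one>"
  obtains f where "f \<in> U" "f \<noteq> \<one>" "f [^] p = \<one>" "star f f = \<one>"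
proof -
  have "\<not> inj (spow e)" using finite_spow[OF assms(1)] finite_imageD infinite_UNIV_nat by blast
  then obtain i' j' where "i' \<noteq> j'" "spow e i' = spow e j'" unfolding inj_def by blast
  then obtain i j where ij: "i < j" "spow e i = spow e j"
    by (cases "i' < j'") (metis, metis linorder_neqE_nat)
  define v where "v = spow e i"
  \<comment> \<open>Subtracting 1 compensates for the shift in \<open>spow\<close>.\<close>
  define m where "m = j - i - 1"
  have "star (spow e m) v = v"
    using ij spow_add[OF assms(1), of m i] by (simp add: v_def m_def)
  then have "star v (inv (spow e m)) = inv v"
    using assms(1) star_commute[of v "spow e m"] by (simp add: star_inv v_def)
  then have "star (inv (spow e m)) v = inv v"
    using assms(1) star_commute[of v "inv (spow e m)"] by (simp add: v_def)
  then have i: "spow e i = \<one>" using star_quasi[of "inv (spow e m)" v] assms(1) by (simp add: v_def)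
  define k where "k = (LEAST k. spow e k = \<one>)"
  have k: "spow e k = \<one>" unfolding k_def by (rule LeastI[of _ i]) (rule i)
  then have "k \<noteq> 0" using assms(2) by (metis spow.simps(1))
  then obtain l where l: "k = Suc l" using not0_implies_Suc by blast
  have "spow e l \<noteq> \<one>" using not_less_Least[of l "\<lambda>k. spow e k = \<one>"] l k_def by auto
  moreover have "star (spow e l) (spow e l) = \<one>"
    using spow_one_mono[OF assms(1) k, of "Suc (l + l)"] spow_add[OF assms(1), of l l] l by simp
  ultimately show ?thesis using that[of "spow e l"] assms spow_prime by simp
qed

text \<open>Square zero means that \<open>a\<close> commutes with \<open>e\<close>, hence with the
  \<open>B\<close>-part \<open>b\<close>, so powers of \<open>e\<close> factor as
  \<open>a [^] k \<otimes> b [^] k\<close>. From \<open>e [^] p = \<one>\<close> it follows that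
  \<open>a [^] p\<close> lies in both \<open>A\<close> and \<open>B\<close>.\<close>

lemma square_zero_factor:
  fixes p :: nat
  assumes e: "e \<in> U" "e [^] p = \<one>" "star e e = \<one>" "factor e a" and AB: "A \<inter> B = {\<one>}"
  shows "a [^] p = \<one>" "factor (e [^] k) (a [^] (k::nat))"
proof -
  define b where "b = inv a \<otimes> e"
  have a: "a \<in> A" and b: "b \<in> B" using e by (auto simp: factor_def b_def)
  have eab: "e = a \<otimes> b" using a e by (simp add: b_def)
  have "tt a e = \<one>" using star_factor e by metis
  then have "cj a e = e" using a e by (simp add: tt_def inv_solve_right')
  then have "a \<otimes> e = e \<otimes> a" using cj_eq_commute a e by simp
  then have ab: "a \<otimes> b = b \<otimes> a" using eab a b by (simp add: m_assoc)
  have ek: "e [^] k = a [^] k \<otimes> b [^] k" for k :: nat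
    unfolding eab by (rule pow_mult_distrib[OF ab]) (use a b in simp_all)
  have "a [^] p = inv (b [^] p)" using ek[of p] e a b by (simp add: inv_equality)
  then have "a [^] p \<in> B" using b by simp
  then have "a [^] p \<in> A \<inter> B" using a by simp
  then show "a [^] p = \<one>" using AB by simp
  show "factor (e [^] k) (a [^] k)" using ek[of k] a b by (simp add: factor_def)
qed

text \<open>The product \<open>f = e r\<close> has square zero as well, so the
  \<open>A\<close>-parts of \<open>e\<close> and \<open>f\<close> both lie in the one subgroup of
  order \<open>p\<close> of \<open>A\<close>. As \<open>U\<close> meets \<open>B\<close> trivially,
  \<open>f\<close> is a multiple \<open>k e\<close>. If \<open>p\<close> did not divide
  \<open>k\<close>, some multiple of \<open>r\<close> would send \<open>e\<close> to
  \<open>- e\<close>, against \<open>star_quasi\<close>.\<close>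

lemma square_zero_central:
  assumes e: "e \<in> U" "e \<noteq> \<one>" "e [^] (p::nat) = \<one>" "prime p" "star e e = \<one>"
    and AB: "A \<inter> B = {\<one>}" and UB: "U \<inter> B = {\<one>}" and r: "r \<in> U"
  shows "star e r = \<one>"
proof -
  define f where "f = star e r"
  have f: "f \<in> U" "f [^] p = \<one>"
  proof -
    show "f \<in> U" using e r by (simp add: f_def)
    have "f = star r e" using e r star_commute by (simp add: f_def)
    then show "f [^] p = \<one>" using e r by (simp add: star_one flip: star_pow)
  qed
  have "star f f = star e (star r (star e r))" using e r by (simp add: f_def star_assoc)
  also have "\<dots> = star e (star e (star r r))"
    using e r star_assoc[of r e r] star_assoc[of e r r] star_commute[of r e] by simp
  also have "\<dots> = star (star e e) (star r r)" using e r star_assoc[of e e "star r r"] by simp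
  also have "\<dots> = \<one>" using e r star_commute[of "\<one>" "star r r"] by (simp add: star_one)
  finally have ff: "star f f = \<one>" .
  define a where "a = fac e"
  define c where "c = fac f"
  have a: "factor e a" "a \<in> A" and c: "factor f c" "c \<in> A"
    using e f factor_fac by (simp_all add: a_def c_def)
  have "a \<noteq> \<one>"
  proof
    assume "a = \<one>"
    then have "e \<in> B" using a e by (simp add: factor_def)
    then show False using UB e by blast
  qed
  then have "c \<in> cyc G a"
    using plc_prime_mem[OF plcA a(2) c(2) e(4)] square_zero_factor(1)[OF e(1,3,5) a(1) AB]
      square_zero_factor(1)[OF f ff c(1) AB] by simp
  then obtain k where k: "c = a [^] (k::nat)" using cycE by metis
  have "inv c \<otimes> f \<in> B" "inv c \<otimes> e [^] k \<in> B"
    using c(1) square_zero_factor(2)[OF e(1,3,5) a(1) AB, of k] k by (auto simp: factor_def)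
  \<comment> \<open>\<open>f\<close> and \<open>e [^] k\<close> have the same \<open>A\<close>-part
    \<open>c\<close>, so they differ by an element of \<open>B\<close>.\<close>
  then have "inv (inv c \<otimes> e [^] k) \<otimes> (inv c \<otimes> f) \<in> B" by simp
  moreover have "inv (inv c \<otimes> e [^] k) \<otimes> (inv c \<otimes> f) = inv (e [^] k) \<otimes> f"
    using c e f by (simp add: inv_mult_group m_assoc)
  ultimately have "inv (e [^] k) \<otimes> f \<in> U \<inter> B" using e f by simp
  then have "inv (e [^] k) \<otimes> f = \<one>" using UB by simp
  then have fk: "f = e [^] k" using e f by (metis U_c inv_cancel_left(1) nat_pow_closed r_one)
  show ?thesis
  proof (cases "p dvd k")
    case True
    then have "e [^] k = \<one>" using e by (metis U_c dvdE nat_pow_one nat_pow_pow)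
    then show ?thesis using fk f_def by simp
  next
    case False
    then have "coprime k p" using e(4) prime_imp_coprime coprime_commute by blast
    then obtain l where l: "[k * l = 1] (mod p)" using cong_solve_coprime_nat by (metis One_nat_def)
    \<comment> \<open>\<open>l\<close> inverts \<open>k\<close> modulo \<open>p\<close> and
      \<open>p - 1\<close> stands for \<open>-1\<close>, so \<open>e\<close> times
      \<open>r [^] j\<close> is \<open>- e\<close>.\<close>
    define j where "j = l * (p - 1)"
    have "[k * j = p - 1] (mod p)" using cong_scalar_right[OF l, of "p - 1"] by (simp add: j_def mult.assoc)
    then have "e [^] (k * j) = e [^] (p - 1)" using e by (intro pow_cong[of e p]) auto
    moreover have "e [^] (p - 1) = inv e"
    proof -
      have "e [^] (p - 1) \<otimes> e = e [^] p" using prime_gt_0_nat[OF e(4)] by (simp flip: nat_pow_Suc)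
      then show ?thesis using e inv_equality by simp
    qed
    ultimately have "star e (r [^] j) = inv e"
      using e r fk f_def by (simp add: star_pow nat_pow_pow)
    then have "star (r [^] j) e = inv e" using e r star_commute by simp
    then show ?thesis using star_quasi[of "r [^] j" e] e r by simp
  qed
qed

text \<open>The \<open>A\<close>-part of a square-zero element works: that the element annihilates
  \<open>U\<close> says exactly that its \<open>A\<close>-part centralises \<open>U\<close>. It is
  nontrivial because \<open>U\<close> meets \<open>B\<close> trivially.\<close>

lemma central_A_or_B:
  assumes AB: "A \<inter> B = {\<one>}" and U: "U \<noteq> {\<one>}" and UB: "U \<inter> B = {\<one>}"
  obtains x p where "x \<in> A" "x \<noteq> \<one>" "prime (p::nat)" "x [^] p = \<one>" "\<And>r. r \<in> U \<Longrightarrow> x \<otimes> r = r \<otimes> x"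
proof -
  obtain u where u: "u \<in> U" "u \<noteq> \<one>" using U U_closed(1) by blast
  obtain p e0 where e0: "prime (p::nat)" "e0 \<in> cyc G u" "e0 \<noteq> \<one>" "e0 [^] p = \<one>"
    using exists_prime_power[of u] u U_torsion by (metis U_c)
  have "e0 \<in> U" using subgroup_cyc[OF U_sub u(1)] e0 by blast
  then obtain e where e: "e \<in> U" "e \<noteq> \<one>" "e [^] p = \<one>" "star e e = \<one>"
    using square_zero e0 by metis
  define a where "a = fac e"
  have a: "factor e a" "a \<in> A" using e factor_fac by (simp_all add: a_def)
  have "a \<noteq> \<one>"
  proof
    assume "a = \<one>"
    then have "e \<in> B" using a e by (simp add: factor_def)
    then show False using UB e by blast
  qed
  moreover have "a [^] p = \<one>" using square_zero_factor(1)[OF e(1,3,4) a(1) AB] .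
  moreover have "a \<otimes> r = r \<otimes> a" if r: "r \<in> U" for r
  proof -
    have "tt a r = \<one>" using square_zero_central[OF e(1,2,3) e0(1) e(4) AB UB r] star_factor[OF e(1) r a(1)] by simp
    then have "cj a r = r" using a r by (simp add: tt_def inv_solve_right')
    then show ?thesis using cj_eq_commute a r by simp
  qed
  ultimately show ?thesis using that a e0 by blast
qed

text \<open>Only elements of \<open>A\<close> and \<open>B\<close> conjugate here, since the carrier
  may exceed the product. The notion is symmetric in \<open>A\<close> and \<open>B\<close>, which
  allows their roles to be exchanged.\<close>

definition normal_prime :: "'a \<Rightarrow> bool" where
  "normal_prime z \<longleftrightarrow> z \<in> A \<union> B \<and> z \<noteq> \<one> \<and> (\<exists>p::nat. prime p \<and> z [^] p = \<one>) \<and>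
    (\<forall>g\<in>A \<union> B. g \<otimes> z \<otimes> inv g \<in> cyc G z)"

lemma conj_self: "x \<in> carrier G \<Longrightarrow> g \<in> carrier G \<Longrightarrow> g \<otimes> x = x \<otimes> g \<Longrightarrow> g \<otimes> x \<otimes> inv g \<in> cyc G x"
  using cyc_self by (simp add: m_assoc)

lemma central_normal_prime:
  assumes z: "z \<in> A \<union> B" "z \<noteq> \<one>" and c: "\<And>g. g \<in> A \<union> B \<Longrightarrow> g \<otimes> z = z \<otimes> g"
  shows "\<exists>z. normal_prime z"
proof -
  have zc: "z \<in> carrier G" "torsion G z"
    using z A_torsion B_torsion by (auto simp: torsion_def)
  obtain p y where y: "prime (p::nat)" "y \<in> cyc G z" "y \<noteq> \<one>" "y [^] p = \<one>"
    using exists_prime_power[OF zc z(2)] by metis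
  obtain k where k: "y = z [^] (k::nat)" using y cycE by metis
  have "g \<otimes> y = y \<otimes> g" if "g \<in> A \<union> B" for g
  proof -
    have "g \<in> carrier G" using that by auto
    then have "g \<otimes> z [^] i = z [^] i \<otimes> g" for i :: nat
    proof (induction i)
      case (Suc i)
      then have "g \<otimes> z [^] Suc i = z [^] i \<otimes> (g \<otimes> z)" using zc by (simp flip: m_assoc)
      then show ?case using Suc c[OF that] zc by (simp add: m_assoc)
    qed simp
    then show ?thesis using k by simp
  qed
  moreover have "y \<in> A \<union> B" using k z by auto
  ultimately have "normal_prime y" unfolding normal_prime_def using y conj_self by (metis Ac Bc UnE)
  then show ?thesis by blast
qed

text \<open>If all conjugates of \<open>x\<close> by \<open>B\<close> stay in \<open>A\<close>, then
  \<open>x\<close> itself works by \<open>plc_conj\<close>. Otherwise some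
  \<open>cj h x = a1 \<otimes> b1\<close> has \<open>b1 \<noteq> \<one>\<close>, and this
  \<open>b1\<close> commutes with both factors.\<close>

lemma central_commutators:
  assumes x: "x \<in> A" "x \<noteq> \<one>" "prime (p::nat)" "x [^] p = \<one>"
    and c: "\<And>a b. a \<in> A \<Longrightarrow> b \<in> B \<Longrightarrow> x \<otimes> comm a b = comm a b \<otimes> x"
  shows "\<exists>z. normal_prime z"
proof (cases "\<forall>h\<in>B. h \<otimes> x \<otimes> inv h \<in> A")
  case True
  have "g \<otimes> x \<otimes> inv g \<in> cyc G x" if "g \<in> A \<union> B" for g
    using that
  proof
    assume "g \<in> A" then show ?thesis using A_comm[of g x] x conj_self by simp
  next
    assume "g \<in> B" then show ?thesis using plc_conj[OF plcA x(1)] True by simp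
  qed
  then have "normal_prime x" unfolding normal_prime_def using x by auto
  then show ?thesis by blast
next
  case False
  then obtain h where h: "h \<in> B" "cj h x \<notin> A" unfolding cj_def by blast
  obtain a1 b1 where ab: "a1 \<in> A" "b1 \<in> B" "cj h x = a1 \<otimes> b1" using cj_B_A h x by metis
  have "b1 \<noteq> \<one>" using h ab by auto
  moreover have "g \<otimes> b1 = b1 \<otimes> g" if "g \<in> A" for g
  proof -
    have xc: "x \<in> carrier G" using x by simp
    have hc: "h \<in> carrier G" using h by simp
    have gc: "g \<in> carrier G" using that by simp
    \<comment> \<open>Conjugating \<open>g\<close> by \<open>inv h\<close> gives \<open>g\<close>
      times a commutator, and \<open>x\<close> commutes with both. Conjugated back by
      \<open>h\<close>, this says that \<open>cj h x\<close> commutes with \<open>g\<close>.\<close>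
    have "inv h \<otimes> g \<otimes> h = g \<otimes> comm (inv g) (inv h)"
      using gc hc by (simp add: comm_def m_assoc)
    moreover have "x \<otimes> (g \<otimes> comm (inv g) (inv h)) = g \<otimes> (x \<otimes> comm (inv g) (inv h))"
      using A_lcomm[of x g "comm (inv g) (inv h)"] x that h by simp
    moreover have "\<dots> = g \<otimes> comm (inv g) (inv h) \<otimes> x"
      using c[of "inv g" "inv h"] that h xc by (simp add: m_assoc)
    ultimately have "x \<otimes> (inv h \<otimes> g \<otimes> h) = (inv h \<otimes> g \<otimes> h) \<otimes> x" by simp
    then have "cj h (x \<otimes> (inv h \<otimes> g \<otimes> h)) = cj h ((inv h \<otimes> g \<otimes> h) \<otimes> x)" by simp
    then have "cj h x \<otimes> g = g \<otimes> cj h x" using xc hc gc by (simp add: cj_def m_assoc)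
    then have "a1 \<otimes> (b1 \<otimes> g) = a1 \<otimes> (g \<otimes> b1)"
      unfolding ab(3) using ab A_lcomm[of g a1 b1] that by (simp add: m_assoc)
    then show ?thesis using ab gc by simp
  qed
  moreover have "g \<otimes> b1 = b1 \<otimes> g" if "g \<in> B" for g using that ab B_comm by blast
  ultimately show ?thesis using central_normal_prime[of b1] ab by blast
qed

end

text \<open>Common elements commute with both factors, and if \<open>U\<close> is trivial all
  elements of the factors do. If \<open>U\<close> meets \<open>B\<close>, an element of the
  intersection commutes with the abelian group \<open>U\<close>, hence with all commutators, and
  \<open>central_commutators\<close> applies with the factors exchanged. Otherwise the radical ring
  supplies the element.\<close>

lemma (in two_factors) normal_prime_exists:
  assumes "A \<noteq> {\<one>} \<or> B \<noteq> {\<one>}"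
  shows "\<exists>z. normal_prime z"
proof -
  interpret S: two_factors G B A by (rule swap)
  have sw: "S.normal_prime z = normal_prime z" for z
    unfolding S.normal_prime_def normal_prime_def by blast
  have cinv: "S.comm b a = inv (comm a b)" if "a \<in> A" "b \<in> B" for a b
    using that by (simp add: S.comm_def comm_def inv_mult_group m_assoc)
  consider (int) "A \<inter> B \<noteq> {\<one>}" | (triv) "A \<inter> B = {\<one>}" "U = {\<one>}"
    | (UB) "A \<inter> B = {\<one>}" "U \<noteq> {\<one>}" "U \<inter> B = {\<one>}" | (UB') "U \<inter> B \<noteq> {\<one>}" by blast
  then show ?thesis
  proof cases
    case int
    then obtain z where "z \<in> A" "z \<in> B" "z \<noteq> \<one>" using A_closed(1) B_closed(1) by blast
    then show ?thesis using central_normal_prime[of z] A_comm B_comm by blast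
  next
    case triv
    have comm: "a \<otimes> b = b \<otimes> a" if "a \<in> A" "b \<in> B" for a b
    proof -
      have "comm a b = \<one>" using D_U[OF that] triv by simp
      then have "cj a b = b" using that by (simp add: comm_def cj_def inv_solve_right')
      then show ?thesis using cj_eq_commute that by simp
    qed
    obtain z where z: "z \<in> A \<union> B" "z \<noteq> \<one>" using assms A_closed(1) B_closed(1) by blast
    then have "g \<otimes> z = z \<otimes> g" if "g \<in> A \<union> B" for g
      using comm that A_comm B_comm by (metis UnE)
    then show ?thesis using central_normal_prime[OF z] by blast
  next
    case UB
    obtain x p where x: "x \<in> A" "x \<noteq> \<one>" "prime (p::nat)" "x [^] p = \<one>" "\<And>r. r \<in> U \<Longrightarrow> x \<otimes> r = r \<otimes> x"
      using central_A_or_B[OF UB] by blast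
    then show ?thesis using central_commutators[OF x(1-4)] D_U by simp
  next
    case UB'
    then obtain y where y: "y \<in> U" "y \<in> B" "y \<noteq> \<one>" using U_closed(1) B_closed(1) by blast
    then have yc: "y \<in> carrier G" by simp
    obtain p x where x: "prime (p::nat)" "x \<in> cyc G y" "x \<noteq> \<one>" "x [^] p = \<one>"
      using exists_prime_power[OF yc] y U_torsion by metis
    have xUB: "x \<in> U" "x \<in> B" using x y subgroup_cyc[OF U_sub] subgroup_cyc[OF sB] by blast+
    have "x \<otimes> S.comm b a = S.comm b a \<otimes> x" if "b \<in> B" "a \<in> A" for b a
      using cinv[of a b] D_U[of a b] U_comm[of x "inv (comm a b)"] that xUB by simp
    then show ?thesis using S.central_commutators[OF xUB(2) x(3,1,4)] sw by blast
  qed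
qed

subsection \<open>Elements whose order involves only given primes\<close>

text \<open>Any annihilating exponent may serve, not just the order, so that powers, conjugates and
  images keep the same witness.\<close>

definition pelt :: "('a, 'b) monoid_scheme \<Rightarrow> (nat \<Rightarrow> bool) \<Rightarrow> 'a \<Rightarrow> bool"
  where "pelt G P x \<longleftrightarrow> (\<exists>n::nat. n > 0 \<and> x [^]\<^bsub>G\<^esub> n = \<one>\<^bsub>G\<^esub> \<and> (\<forall>q. prime q \<longrightarrow> q dvd n \<longrightarrow> P q))"

definition part :: "('a, 'b) monoid_scheme \<Rightarrow> (nat \<Rightarrow> bool) \<Rightarrow> 'a set \<Rightarrow> 'a set"
  where "part G P A = {x \<in> A. pelt G P x}"

lemma peltE:
  assumes "pelt G P x"
  obtains n :: nat where "n > 0" "x [^]\<^bsub>G\<^esub> n = \<one>\<^bsub>G\<^esub>" "\<And>q. prime q \<Longrightarrow> q dvd n \<Longrightarrow> P q"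
  using assms unfolding pelt_def by blast

lemma peltI:
  assumes "n > 0" "x [^]\<^bsub>G\<^esub> (n::nat) = \<one>\<^bsub>G\<^esub>" "\<And>q. prime q \<Longrightarrow> q dvd n \<Longrightarrow> P q"
  shows "pelt G P x"
  using assms unfolding pelt_def by blast

lemma pelt_torsion: "pelt G P x \<Longrightarrow> torsion G x"
  unfolding pelt_def torsion_def by blast

lemma (in group) torsion_pelt: "torsion G x \<Longrightarrow> pelt G (\<lambda>_. True) x"
  unfolding pelt_def torsion_def by blast

lemma (in group) pelt_mult:
  assumes "x \<in> carrier G" "y \<in> carrier G" "x \<otimes> y = y \<otimes> x" "pelt G P x" "pelt G P y"
  shows "pelt G P (x \<otimes> y)"
proof -
  obtain n where n: "n > 0" "x [^] (n::nat) = \<one>" "\<And>q. prime q \<Longrightarrow> q dvd n \<Longrightarrow> P q"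
    using peltE[OF assms(4)] by metis
  obtain m where m: "m > 0" "y [^] (m::nat) = \<one>" "\<And>q. prime q \<Longrightarrow> q dvd m \<Longrightarrow> P q"
    using peltE[OF assms(5)] by metis
  have "x [^] (n * m) = (x [^] n) [^] m" "y [^] (n * m) = (y [^] m) [^] n"
    using assms by (simp_all add: nat_pow_pow mult.commute)
  then have "(x \<otimes> y) [^] (n * m) = \<one>"
    using pow_mult_distrib[OF assms(3,1,2), of "n * m"] n(2) m(2) by simp
  then show ?thesis using n(1,3) m(1,3) by (intro peltI[of "n * m"]) (auto dest: prime_dvd_multD)
qed

lemma (in group) pelt_pow:
  assumes "x \<in> carrier G" "pelt G P x" shows "pelt G P (x [^] (k::nat))"
proof -
  obtain n where n: "n > 0" "x [^] (n::nat) = \<one>" "\<And>q. prime q \<Longrightarrow> q dvd n \<Longrightarrow> P q"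
    using peltE[OF assms(2)] by metis
  have "(x [^] k) [^] n = (x [^] n) [^] k" using assms by (simp add: nat_pow_pow mult.commute)
  then show ?thesis using n by (intro peltI[of n]) auto
qed

lemma (in group) pelt_cyc: "x \<in> carrier G \<Longrightarrow> pelt G P x \<Longrightarrow> y \<in> cyc G x \<Longrightarrow> pelt G P y"
  using pelt_pow cycE by metis

lemma (in group) pelt_one: "pelt G P \<one>"
  by (rule peltI[of 1]) auto

lemma (in group) pelt_conj:
  assumes "g \<in> carrier G" "x \<in> carrier G" "pelt G P x" shows "pelt G P (g \<otimes> x \<otimes> inv g)"
proof -
  obtain n where n: "n > 0" "x [^] (n::nat) = \<one>" "\<And>q. prime q \<Longrightarrow> q dvd n \<Longrightarrow> P q"
    using peltE[OF assms(3)] by metis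
  show ?thesis by (rule peltI[of n]) (use n assms conj_pow in auto)
qed

lemma coprime_of_primes:
  assumes "m > 0" "\<And>q. prime q \<Longrightarrow> q dvd m \<Longrightarrow> P q" "\<And>q. prime q \<Longrightarrow> q dvd n \<Longrightarrow> \<not> P q"
  shows "coprime m (n::nat)"
proof (rule ccontr)
  assume "\<not> coprime m n"
  then have "gcd m n \<noteq> 1" using coprime_iff_gcd_eq_1 by blast
  then obtain q where "prime q" "q dvd gcd m n" using prime_factor_nat by blast
  then show False using assms by (meson dvd_trans gcd_dvd1 gcd_dvd2)
qed

lemma (in group) pelt_disjoint:
  assumes "x \<in> carrier G" "pelt G P x" "pelt G (\<lambda>q. \<not> P q) x" shows "x = \<one>"
proof -
  obtain n where n: "n > 0" "x [^] (n::nat) = \<one>" "\<And>q. prime q \<Longrightarrow> q dvd n \<Longrightarrow> P q"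
    using peltE[OF assms(2)] by metis
  obtain m where m: "m > 0" "x [^] (m::nat) = \<one>" "\<And>q. prime q \<Longrightarrow> q dvd m \<Longrightarrow> \<not> P q"
    using peltE[OF assms(3)] by metis
  have "coprime n m" by (rule coprime_of_primes[of n P]) (use n m in auto)
  then show ?thesis using prime_pow_one n m assms by blast
qed

lemma (in group) pelt_prime_coprime:
  assumes "x \<in> carrier G" "pelt G P x" "x [^] (q::nat) = \<one>" "prime q" "\<not> P q" shows "x = \<one>"
proof (rule pelt_disjoint[OF assms(1,2)])
  show "pelt G (\<lambda>q. \<not> P q) x"
    by (rule peltI[of q]) (use assms prime_gt_0_nat primes_dvd_imp_eq in auto)
qed

lemma prime_split:
  "n > 0 \<Longrightarrow> \<exists>n1 n2::nat. n = n1 * n2 \<and> (\<forall>q. prime q \<longrightarrow> q dvd n1 \<longrightarrow> P q) \<and>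
    (\<forall>q. prime q \<longrightarrow> q dvd n2 \<longrightarrow> \<not> P q)"
proof (induction n rule: less_induct)
  case (less n)
  show ?case
  proof (cases "n = 1")
    case True then show ?thesis by (intro exI[of _ 1]) auto
  next
    case False
    then obtain q where q: "prime q" "q dvd n" using prime_factor_nat by blast
    then obtain m where m: "n = q * m" by blast
    have "m < n" "m > 0" using m q less.prems prime_gt_1_nat[OF q(1)] by auto
    then obtain n1 n2 where n: "m = n1 * n2" "\<forall>q. prime q \<longrightarrow> q dvd n1 \<longrightarrow> P q"
      "\<forall>q. prime q \<longrightarrow> q dvd n2 \<longrightarrow> \<not> P q" using less.IH by blast
    have pd: "r = q \<or> r dvd k" if "prime r" "r dvd q * k" for r k
      using that q(1) by (metis prime_dvd_multD primes_dvd_imp_eq)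
    show ?thesis
    proof (cases "P q")
      case True
      then show ?thesis using n m pd by (intro exI[of _ "q * n1"] exI[of _ n2]) auto
    next
      case False
      then show ?thesis using n m pd by (intro exI[of _ n1] exI[of _ "q * n2"]) auto
    qed
  qed
qed

lemma (in group) pelt_decomp:
  assumes x: "x \<in> carrier G" "torsion G x"
  obtains y w where "y \<in> cyc G x" "w \<in> cyc G x" "x = y \<otimes> w" "pelt G P y" "pelt G (\<lambda>q. \<not> P q) w"
proof -
  obtain n where n: "n > 0" "x [^] (n::nat) = \<one>" using x by (auto simp: torsion_def)
  obtain n1 n2 where s: "n = n1 * n2" "\<And>q. prime q \<Longrightarrow> q dvd n1 \<Longrightarrow> P q"
    "\<And>q. prime q \<Longrightarrow> q dvd n2 \<Longrightarrow> \<not> P q" using prime_split[OF n(1)] by metis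
  have n12: "n1 > 0" "n2 > 0" using n s by (auto intro: gr0I)
  have "coprime n1 n2" by (rule coprime_of_primes[of n1 P]) (use s n12 in auto)
  then obtain u where u: "[n1 * u = 1] (mod n2)" using cong_solve_coprime_nat by (metis One_nat_def)
  obtain v where v: "[n2 * v = 1] (mod n1)"
    using cong_solve_coprime_nat \<open>coprime n1 n2\<close> coprime_commute by (metis One_nat_def)
  have "[n2 * v + n1 * u = 1] (mod n1)" using v by (metis add.right_neutral cong_add cong_mult_self_left mult.commute cong_mult_self_right)
  moreover have "[n2 * v + n1 * u = 1] (mod n2)" using u by (metis add_0 cong_add cong_mult_self_left mult.commute cong_mult_self_right)
  ultimately have "[n2 * v + n1 * u = 1] (mod n)"
    using \<open>coprime n1 n2\<close> s(1) coprime_cong_mult_nat by blast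
  then have "x [^] (n2 * v + n1 * u) = x [^] (1::nat)" using x n by (intro pow_cong[of x n]) auto
  then have e: "x = x [^] (n2 * v) \<otimes> x [^] (n1 * u)" using x by (simp add: nat_pow_mult)
  have "(x [^] (n2 * v)) [^] n1 = (x [^] n) [^] v" "(x [^] (n1 * u)) [^] n2 = (x [^] n) [^] u"
    using x s by (simp_all add: nat_pow_pow mult.commute mult.left_commute)
  then have "pelt G P (x [^] (n2 * v))" "pelt G (\<lambda>q. \<not> P q) (x [^] (n1 * u))"
    using n s n12 by (auto intro: peltI[of n1] peltI[of n2])
  then show ?thesis using that e pow_in_cyc by metis
qed

lemma (in group) part_subgroup:
  assumes A: "plc G A" shows "subgroup (part G P A) G"
proof (rule subgroupI)
  have sA: "subgroup A G" using A plc_subgroup by blast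
  show "part G P A \<subseteq> carrier G" using plc_closed[OF A] by (auto simp: part_def)
  show "part G P A \<noteq> {}" using subgroup.one_closed[OF sA] pelt_one by (auto simp: part_def)
  show "a \<otimes> b \<in> part G P A" if "a \<in> part G P A" "b \<in> part G P A" for a b
    using that plc_commute[OF A] plc_closed[OF A] subgroup.m_closed[OF sA] by (auto simp: part_def intro: pelt_mult)
  show "inv a \<in> part G P A" if a: "a \<in> part G P A" for a
  proof -
    have "inv a \<in> cyc G a" "a \<in> carrier G" using a inv_pow_in_cyc[of a 1] plc_closed[OF A] plc_torsion[OF A] by (auto simp: part_def)
    then show ?thesis using a pelt_cyc subgroup.m_inv_closed[OF sA] by (auto simp: part_def)
  qed
qed

lemma (in group) part_plc: "plc G A \<Longrightarrow> plc G (part G P A)"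
  using plc_subset[of A "part G P A"] part_subgroup by (auto simp: part_def)

lemma (in group_hom) pelt_image: "x \<in> carrier G \<Longrightarrow> pelt G P x \<Longrightarrow> pelt H P (h x)"
  unfolding pelt_def by (metis hom_nat_pow hom_one)

text \<open>The component of \<open>z\<close> at the primes outside \<open>P\<close> has an image
  that involves only primes in \<open>P\<close> and only primes outside \<open>P\<close>, so
  \<open>h\<close> kills it.\<close>

lemma (in group_hom) part_lift:
  assumes A: "plc G A" and z: "z \<in> A" "pelt H P (h z)"
  obtains y where "y \<in> part G P A" "h y = h z"
proof -
  have zc: "z \<in> carrier G" "torsion G z" using z A G.plc_closed G.plc_torsion by auto
  obtain y w where yw: "y \<in> cyc G z" "w \<in> cyc G z" "z = y \<otimes> w" "pelt G P y" "pelt G (\<lambda>q. \<not> P q) w"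
    using G.pelt_decomp[OF zc] by metis
  have wc: "w \<in> carrier G" "y \<in> carrier G" using yw zc G.cyc_closed by auto
  have "h w \<in> cyc H (h z)" using cyc_image[OF zc(1)] yw by blast
  then have "pelt H P (h w)" using H.pelt_cyc z zc by (metis hom_closed)
  then have "h w = \<one>\<^bsub>H\<^esub>" using H.pelt_disjoint[of "h w"] pelt_image[OF wc(1) yw(5)] wc by simp
  then have "h z = h y" using yw(3) wc by simp
  moreover have "y \<in> A" using yw(1) G.subgroup_cyc[OF G.plc_subgroup[OF A] z(1)] by blast
  ultimately show ?thesis using that yw by (simp add: part_def)
qed

text \<open>Local cyclicity is applied inside the product of \<open>cyc G x\<close> and
  \<open>cyc G y\<close>, so the common generator is itself a product of powers of \<open>x\<close>
  and \<open>y\<close>. In this form the relation survives in quotients.\<close>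

lemma (in group) plc_join:
  assumes A: "plc G A" and x: "x \<in> A" and y: "y \<in> A"
  obtains w u v where "w \<in> A" "x \<in> cyc G w" "y \<in> cyc G w" "w = x [^] (u::nat) \<otimes> y [^] (v::nat)"
proof -
  have xy: "x \<in> carrier G" "y \<in> carrier G" "torsion G x" "torsion G y" using A x y plc_closed plc_torsion by auto
  have sx: "subgroup (cyc G x) G" "subgroup (cyc G y) G" using cyc_subgroup xy by auto
  have com: "cyc G x <#> cyc G y = cyc G y <#> cyc G x"
  proof -
    have "a \<otimes> b = b \<otimes> a" if "a \<in> cyc G x" "b \<in> cyc G y" for a b
      using that subgroup_cyc[OF plc_subgroup[OF A]] x y plc_commute[OF A] by blast
    then show ?thesis unfolding set_mult_def by fastforce
  qed
  let ?K = "cyc G x <#> cyc G y"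
  have K: "subgroup ?K G" using subgroup_set_mult_commute[OF sx com] .
  have "cyc G x \<subseteq> A" "cyc G y \<subseteq> A" using subgroup_cyc[OF plc_subgroup[OF A]] x y by auto
  then have KA: "?K \<subseteq> A"
    using subgroup.m_closed[OF plc_subgroup[OF A]] by (auto elim!: set_multE)
  have "x \<in> ?K" using set_multI[OF cyc_self[OF xy(1)] one_in_cyc[of G y]] xy by simp
  moreover have "y \<in> ?K" using set_multI[OF one_in_cyc[of G x] cyc_self[OF xy(2)]] xy by simp
  ultimately obtain w where w: "w \<in> ?K" "x \<in> cyc G w" "y \<in> cyc G w"
    using plc_gen[OF plc_subset[OF A K KA]] by metis
  then obtain a b where "a \<in> cyc G x" "b \<in> cyc G y" "w = a \<otimes> b" by (elim set_multE)
  then show ?thesis using that[of w] w KA cycE by (metis subsetD)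
qed

text \<open>The automorphism group of a group of order \<open>q\<close> has order \<open>q - 1 < p\<close>.\<close>

lemma (in group) large_prime_centralises:
  assumes z: "z \<in> carrier G" "z [^] (q::nat) = \<one>" "prime q" and s: "s \<in> carrier G" "s \<otimes> z \<otimes> inv s \<in> cyc G z"
    and p: "pelt G (\<lambda>r. r = p) s" "prime p" "q \<le> p"
  shows "s \<otimes> z = z \<otimes> s"
proof (cases "z = \<one>")
  case True then show ?thesis using s by simp
next
  case False
  obtain c where c: "s \<otimes> z \<otimes> inv s = z [^] (c::nat)" using s cycE by metis
  have pw: "s [^] k \<otimes> z \<otimes> inv (s [^] k) = z [^] (c ^ k)" for k :: nat
  proof (induction k)
    case (Suc k)
    have "s [^] Suc k \<otimes> z \<otimes> inv (s [^] Suc k) = s [^] k \<otimes> (s \<otimes> z \<otimes> inv s) \<otimes> inv (s [^] k)"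
      using z s by (simp add: m_assoc inv_mult_group)
    also have "\<dots> = (s [^] k \<otimes> z \<otimes> inv (s [^] k)) [^] c" unfolding c using z s by (simp add: conj_pow)
    also have "\<dots> = z [^] (c ^ k * c)" unfolding Suc using z by (simp add: nat_pow_pow)
    finally show ?case by (simp add: mult.commute)
  qed (use z in simp)
  have "\<not> q dvd c"
  proof
    assume "q dvd c"
    then have "z [^] c = \<one>" using z by (metis dvdE nat_pow_one nat_pow_pow)
    then have "s \<otimes> z \<otimes> inv s \<otimes> s = s" using c s by simp
    then have "s \<otimes> z = s \<otimes> \<one>" using s z by (simp add: m_assoc)
    then show False using False s z by simp
  qed
  then have "[c ^ (q - 1) = 1] (mod q)" using fermat_theorem z(3) by blast
  then have "z [^] (c ^ (q - 1)) = z [^] (1::nat)" using z pow_cong by blast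
  then have 1: "s [^] (q - 1) \<otimes> z \<otimes> inv (s [^] (q - 1)) = z" using pw[of "q - 1"] z by simp
  obtain n where n: "n > 0" "s [^] (n::nat) = \<one>" "\<And>r. prime r \<Longrightarrow> r dvd n \<Longrightarrow> r = p"
    using peltE[OF p(1)] by metis
  \<comment> \<open>\<open>n\<close> involves only the prime \<open>p\<close>, and
    \<open>q - 1 < p\<close>.\<close>
  have "coprime n (q - 1)"
  proof (rule coprime_of_primes[of n "\<lambda>r. r = p"])
    show "r \<noteq> p" if r: "prime r" "r dvd q - 1" for r
    proof
      assume "r = p"
      then have "p \<le> q - 1" using r prime_gt_1_nat[OF z(3)] by (intro dvd_imp_le) auto
      then show False using p(3) prime_gt_1_nat[OF z(3)] by auto
    qed
  qed (use n in auto)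
  \<comment> \<open>\<open>s [^] (q - 1)\<close> centralises \<open>z\<close>, and by this identity
    \<open>s\<close> is the inverse of a power of it.\<close>
  then obtain u v where uv: "n * u = (q - 1) * v + 1" using bezout_nat[of n "q - 1"] n(1) by auto
  have 2: "s [^] ((q - 1) * v) \<otimes> z \<otimes> inv (s [^] ((q - 1) * v)) = z"
  proof (induction v)
    case (Suc v)
    have "s [^] ((q - 1) * Suc v) = s [^] ((q - 1) * v) \<otimes> s [^] (q - 1)"
      using s by (simp add: nat_pow_mult add.commute)
    then have "s [^] ((q - 1) * Suc v) \<otimes> z \<otimes> inv (s [^] ((q - 1) * Suc v)) =
      s [^] ((q - 1) * v) \<otimes> (s [^] (q - 1) \<otimes> z \<otimes> inv (s [^] (q - 1))) \<otimes> inv (s [^] ((q - 1) * v))"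
      using s z by (simp add: m_assoc inv_mult_group)
    then show ?case using Suc unfolding 1 by simp
  qed (use z in simp)
  have "s [^] ((q - 1) * v + 1) = \<one>" using uv n s by (metis nat_pow_one nat_pow_pow)
  then have "s [^] ((q - 1) * v) \<otimes> s = \<one>" by simp
  then have "s = inv (s [^] ((q - 1) * v))" using s by (metis inv_equality inv_inv nat_pow_closed)
  then have "inv s \<otimes> z \<otimes> s = z" using 2 s by (metis inv_inv nat_pow_closed)
  then have "s \<otimes> (inv s \<otimes> z \<otimes> s) = s \<otimes> z" by simp
  then show ?thesis using s z by (simp add: m_assoc)
qed

subsection \<open>Climbing through normal subgroups of a product\<close>

locale full_product = two_factors +
  assumes full: "carrier G = A <#> B"

lemma (in full_product) quotient_full:
  assumes N: "N \<lhd> G"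
  shows "full_product (G Mod N) ((\<lambda>x. N #> x) ` A) ((\<lambda>x. N #> x) ` B)"
proof -
  interpret h: group_hom G "G Mod N" "\<lambda>x. N #> x" using quotient_hom[OF N] .
  show ?thesis
  proof unfold_locales
    show "plc (G Mod N) ((\<lambda>x. N #> x) ` A)" "plc (G Mod N) ((\<lambda>x. N #> x) ` B)"
      using h.plc_image plcA plcB by auto
    fix a b assume "a \<in> (\<lambda>x. N #> x) ` A" "b \<in> (\<lambda>x. N #> x) ` B"
    then obtain x y where xy: "x \<in> A" "y \<in> B" "a = N #> x" "b = N #> y" by blast
    obtain a' b' where ab: "a' \<in> A" "b' \<in> B" "y \<otimes> x = a' \<otimes> b'" using perm xy by blast
    have "b \<otimes>\<^bsub>G Mod N\<^esub> a = N #> (y \<otimes> x)" using xy h.hom_mult[of y x] by simp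
    also have "\<dots> = (N #> a') \<otimes>\<^bsub>G Mod N\<^esub> (N #> b')" unfolding ab(3) using ab h.hom_mult[of a' b'] by simp
    finally show "\<exists>a'\<in>(\<lambda>x. N #> x) ` A. \<exists>b'\<in>(\<lambda>x. N #> x) ` B. b \<otimes>\<^bsub>G Mod N\<^esub> a = a' \<otimes>\<^bsub>G Mod N\<^esub> b'"
      using ab by blast
  next
    show "carrier (G Mod N) = (\<lambda>x. N #> x) ` A <#>\<^bsub>G Mod N\<^esub> (\<lambda>x. N #> x) ` B"
    proof (intro subset_antisym subsetI)
      fix x assume "x \<in> carrier (G Mod N)"
      then obtain g where "g \<in> carrier G" "x = N #> g" by (auto simp: carrier_FactGroup)
      then obtain a b where ab: "a \<in> A" "b \<in> B" "x = N #> (a \<otimes> b)" using full by (auto elim!: set_multE)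
      then have "x = (N #> a) \<otimes>\<^bsub>G Mod N\<^esub> (N #> b)" using h.hom_mult[of a b] by simp
      then show "x \<in> (\<lambda>x. N #> x) ` A <#>\<^bsub>G Mod N\<^esub> (\<lambda>x. N #> x) ` B"
        using h.H.set_multI[of "N #> a" _ "N #> b"] ab by simp
    next
      fix x assume "x \<in> (\<lambda>x. N #> x) ` A <#>\<^bsub>G Mod N\<^esub> (\<lambda>x. N #> x) ` B"
      then obtain a b where ab: "a \<in> A" "b \<in> B" "x = (N #> a) \<otimes>\<^bsub>G Mod N\<^esub> (N #> b)"
        by (auto elim!: h.H.set_multE)
      then show "x \<in> carrier (G Mod N)" using h.H.m_closed[OF h.hom_closed h.hom_closed, of a b] by simp
    qed
  qed
qed

lemma (in group) cyc_normalI: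
  assumes "z \<in> carrier G" "torsion G z" "\<And>g. g \<in> carrier G \<Longrightarrow> g \<otimes> z \<otimes> inv g \<in> cyc G z"
  shows "cyc G z \<lhd> G"
proof (rule normal_invI)
  show "subgroup (cyc G z) G" using cyc_subgroup assms by blast
  show "x \<otimes> h \<otimes> inv x \<in> cyc G z" if "x \<in> carrier G" "h \<in> cyc G z" for x h
    using conj_cyc[OF that(1) assms(1) assms(3)[OF that(1)] that(2)] cyc_trans[OF assms(1) that(2)] by blast
qed

lemma (in full_product) normal_cyc_exists:
  assumes "carrier G \<noteq> {\<one>}"
  obtains z p where "z \<in> A \<union> B" "z \<noteq> \<one>" "prime (p::nat)" "z [^] p = \<one>" "cyc G z \<lhd> G"
proof -
  have "A \<noteq> {\<one>} \<or> B \<noteq> {\<one>}"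
  proof (rule ccontr)
    assume "\<not> ?thesis"
    then have "A <#> B = {\<one>}" by (simp add: set_mult_def)
    then show False using assms full by simp
  qed
  then obtain z where z: "normal_prime z" using normal_prime_exists by blast
  then obtain p where p: "z \<in> A \<union> B" "z \<noteq> \<one>" "prime (p::nat)" "z [^] p = \<one>"
    and c: "\<And>g. g \<in> A \<union> B \<Longrightarrow> g \<otimes> z \<otimes> inv g \<in> cyc G z"
    unfolding normal_prime_def by blast
  have zc: "z \<in> carrier G" "torsion G z" using p prime_gt_0_nat by (auto simp: torsion_def)
  have "cyc G z \<lhd> G"
  proof (rule cyc_normalI[OF zc])
    fix g assume "g \<in> carrier G"
    then obtain a b where ab: "a \<in> A" "b \<in> B" "g = a \<otimes> b" using full by (auto elim!: set_multE)
    have "a \<otimes> (b \<otimes> z \<otimes> inv b) \<otimes> inv a \<in> cyc G (b \<otimes> z \<otimes> inv b)"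
      using conj_cyc[of a z "b \<otimes> z \<otimes> inv b"] c ab zc by simp
    then have "a \<otimes> (b \<otimes> z \<otimes> inv b) \<otimes> inv a \<in> cyc G z"
      using cyc_trans[OF zc(1) c[of b]] ab by blast
    then show "g \<otimes> z \<otimes> inv g \<in> cyc G z" using ab zc by (simp add: m_assoc inv_mult_group)
  qed
  then show ?thesis using that p by blast
qed

lemma (in group) normal_lift:
  assumes N: "N \<lhd> G" and z: "z \<in> carrier G" "z \<notin> N" and cyc: "cyc (G Mod N) (N #> z) \<lhd> G Mod N"
  obtains M where "M \<lhd> G" "N \<subseteq> M" "M \<noteq> N" "\<And>x. x \<in> carrier G \<Longrightarrow> x \<in> M \<longleftrightarrow> N #> x \<in> cyc (G Mod N) (N #> z)"
proof -
  interpret h: group_hom G "G Mod N" "\<lambda>x. N #> x" using quotient_hom[OF N] .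
  define M where "M = {x \<in> carrier G. N #> x \<in> cyc (G Mod N) (N #> z)}"
  have "M \<lhd> G" unfolding M_def using h.normal_vimage[OF cyc] .
  moreover have "N \<subseteq> M"
  proof
    fix x assume x: "x \<in> N"
    then have xc: "x \<in> carrier G" using N normal_imp_subgroup subgroup.mem_carrier by metis
    then have "N #> x = \<one>\<^bsub>G Mod N\<^esub>" using quotient_one[OF N] x by blast
    then show "x \<in> M" using xc one_in_cyc[of "G Mod N"] by (simp add: M_def)
  qed
  moreover have "z \<in> M" using z h.H.cyc_self[of "N #> z"] by (simp add: M_def)
  ultimately show ?thesis using that[of M] z(2) by (auto simp: M_def)
qed

text \<open>If an \<open>N\<close> maximal among the normal subgroups with \<open>Q\<close> were
  proper, the step above it would have \<open>Q\<close> too. \<open>D\<close> records where the new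
  generator is taken: in \<open>A \<union> B\<close> for two factors, where it matters that it lies
  in one of them, and anywhere for several.\<close>

lemma (in group) normal_climb:
  assumes up: "\<And>N. N \<lhd> G \<Longrightarrow> N \<noteq> carrier G \<Longrightarrow> \<exists>z\<in>D. \<exists>p. prime (p::nat) \<and> z \<notin> N \<and>
      (N #> z) [^]\<^bsub>G Mod N\<^esub> p = \<one>\<^bsub>G Mod N\<^esub> \<and> cyc (G Mod N) (N #> z) \<lhd> G Mod N"
    and D: "D \<subseteq> carrier G" and one: "Q {\<one>}"
    and chain: "\<And>C. C \<noteq> {} \<Longrightarrow> (\<And>N. N \<in> C \<Longrightarrow> N \<lhd> G \<and> Q N) \<Longrightarrow>
      (\<And>M N. M \<in> C \<Longrightarrow> N \<in> C \<Longrightarrow> M \<subseteq> N \<or> N \<subseteq> M) \<Longrightarrow> Q (\<Union>C)"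
    and step: "\<And>N M z p. N \<lhd> G \<Longrightarrow> Q N \<Longrightarrow> z \<in> D \<Longrightarrow> prime (p::nat) \<Longrightarrow> z \<notin> N \<Longrightarrow>
      (N #> z) [^]\<^bsub>G Mod N\<^esub> p = \<one>\<^bsub>G Mod N\<^esub> \<Longrightarrow> cyc (G Mod N) (N #> z) \<lhd> G Mod N \<Longrightarrow> M \<lhd> G \<Longrightarrow>
      (\<And>x. x \<in> carrier G \<Longrightarrow> x \<in> M \<longleftrightarrow> N #> x \<in> cyc (G Mod N) (N #> z)) \<Longrightarrow> Q M"
  shows "Q (carrier G)"
proof -
  obtain N where N: "N \<lhd> G" "Q N" "\<And>M. M \<lhd> G \<Longrightarrow> N \<subseteq> M \<Longrightarrow> Q M \<Longrightarrow> M = N"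
    by (rule maximal_normal[of Q, OF one chain]) blast+
  have "N = carrier G"
  proof (rule ccontr)
    assume "N \<noteq> carrier G"
    then obtain z p where z: "z \<in> D" "prime (p::nat)" "z \<notin> N" "(N #> z) [^]\<^bsub>G Mod N\<^esub> p = \<one>\<^bsub>G Mod N\<^esub>"
      "cyc (G Mod N) (N #> z) \<lhd> G Mod N"
      using up[OF N(1)] by metis
    obtain M where M: "M \<lhd> G" "N \<subseteq> M" "M \<noteq> N" "\<And>x. x \<in> carrier G \<Longrightarrow> x \<in> M \<longleftrightarrow> N #> x \<in> cyc (G Mod N) (N #> z)"
      using normal_lift[OF N(1) _ z(3,5)] D z(1) by (metis subsetD)
    have "Q M" by (rule step[OF N(1,2) z M(1,4)])
    then show False using N(3) M by blast
  qed
  then show ?thesis using N by simp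
qed

lemma (in full_product) climb:
  assumes N: "N \<lhd> G" "N \<noteq> carrier G"
  obtains z p M where "z \<in> A \<union> B" "prime (p::nat)" "z \<notin> N" "(N #> z) [^]\<^bsub>G Mod N\<^esub> p = \<one>\<^bsub>G Mod N\<^esub>"
    "cyc (G Mod N) (N #> z) \<lhd> G Mod N"
    "M \<lhd> G" "N \<subseteq> M" "M \<noteq> N" "\<And>x. x \<in> carrier G \<Longrightarrow> x \<in> M \<longleftrightarrow> N #> x \<in> cyc (G Mod N) (N #> z)"
proof -
  interpret h: group_hom G "G Mod N" "\<lambda>x. N #> x" using quotient_hom[OF N(1)] .
  interpret Q: full_product "G Mod N" "(\<lambda>x. N #> x) ` A" "(\<lambda>x. N #> x) ` B" using quotient_full[OF N(1)] .
  have "carrier (G Mod N) \<noteq> {\<one>\<^bsub>G Mod N\<^esub>}"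
  proof
    assume *: "carrier (G Mod N) = {\<one>\<^bsub>G Mod N\<^esub>}"
    have "x \<in> N" if "x \<in> carrier G" for x
      using h.hom_closed[OF that] * quotient_one[OF N(1) that] by blast
    then show False using N normal_imp_subgroup subgroup.subset by blast
  qed
  then obtain y p where y: "y \<in> (\<lambda>x. N #> x) ` A \<union> (\<lambda>x. N #> x) ` B" "y \<noteq> \<one>\<^bsub>G Mod N\<^esub>"
    "prime (p::nat)" "y [^]\<^bsub>G Mod N\<^esub> p = \<one>\<^bsub>G Mod N\<^esub>" "cyc (G Mod N) y \<lhd> G Mod N"
    using Q.normal_cyc_exists by metis
  then obtain z where z: "z \<in> A \<union> B" "y = N #> z" by blast
  have zc: "z \<in> carrier G" using z by auto
  have zN: "z \<notin> N" using y(2) z(2) quotient_one[OF N(1) zc] by blast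
  obtain M where "M \<lhd> G" "N \<subseteq> M" "M \<noteq> N" "\<And>x. x \<in> carrier G \<Longrightarrow> x \<in> M \<longleftrightarrow> N #> x \<in> cyc (G Mod N) (N #> z)"
    using normal_lift[OF N(1) zc zN] y(5) z(2) by metis
  then show ?thesis using that[of z p M] y z zN by metis
qed

lemma (in full_product) climb_induct:
  assumes one: "Q {\<one>}"
    and chain: "\<And>C. C \<noteq> {} \<Longrightarrow> (\<And>N. N \<in> C \<Longrightarrow> N \<lhd> G \<and> Q N) \<Longrightarrow>
      (\<And>M N. M \<in> C \<Longrightarrow> N \<in> C \<Longrightarrow> M \<subseteq> N \<or> N \<subseteq> M) \<Longrightarrow> Q (\<Union>C)"
    and step: "\<And>N M z p. N \<lhd> G \<Longrightarrow> Q N \<Longrightarrow> z \<in> A \<union> B \<Longrightarrow> prime (p::nat) \<Longrightarrow> z \<notin> N \<Longrightarrow>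
      (N #> z) [^]\<^bsub>G Mod N\<^esub> p = \<one>\<^bsub>G Mod N\<^esub> \<Longrightarrow> cyc (G Mod N) (N #> z) \<lhd> G Mod N \<Longrightarrow> M \<lhd> G \<Longrightarrow>
      (\<And>x. x \<in> carrier G \<Longrightarrow> x \<in> M \<longleftrightarrow> N #> x \<in> cyc (G Mod N) (N #> z)) \<Longrightarrow> Q M"
  shows "Q (carrier G)"
proof (rule normal_climb[of "A \<union> B" Q, OF _ _ one chain step])
  show "A \<union> B \<subseteq> carrier G" by auto
  fix N assume "N \<lhd> G" "N \<noteq> carrier G"
  then obtain z p where "z \<in> A \<union> B" "prime (p::nat)" "z \<notin> N" "(N #> z) [^]\<^bsub>G Mod N\<^esub> p = \<one>\<^bsub>G Mod N\<^esub>"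
    "cyc (G Mod N) (N #> z) \<lhd> G Mod N"
    using climb by metis
  then show "\<exists>z\<in>A \<union> B. \<exists>p. prime (p::nat) \<and> z \<notin> N \<and>
    (N #> z) [^]\<^bsub>G Mod N\<^esub> p = \<one>\<^bsub>G Mod N\<^esub> \<and> cyc (G Mod N) (N #> z) \<lhd> G Mod N" by blast
qed

subsection \<open>Permutability modulo a normal subgroup\<close>

text \<open>The cyclic groups of \<open>a\<close> and \<open>b\<close> permute modulo that of \<open>z\<close>, respectively modulo \<open>N\<close>.\<close>

definition permz :: "('a, 'b) monoid_scheme \<Rightarrow> 'a \<Rightarrow> 'a \<Rightarrow> 'a \<Rightarrow> bool"
  where "permz G z a b \<longleftrightarrow> (\<forall>(i::nat) (j::nat). \<exists>(k::nat) (l::nat) (s::nat).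
    b [^]\<^bsub>G\<^esub> i \<otimes>\<^bsub>G\<^esub> a [^]\<^bsub>G\<^esub> j = z [^]\<^bsub>G\<^esub> s \<otimes>\<^bsub>G\<^esub> (a [^]\<^bsub>G\<^esub> k \<otimes>\<^bsub>G\<^esub> b [^]\<^bsub>G\<^esub> l))"

definition pmod :: "('a, 'b) monoid_scheme \<Rightarrow> 'a set \<Rightarrow> 'a \<Rightarrow> 'a \<Rightarrow> bool"
  where "pmod G N a b \<longleftrightarrow> (\<forall>(i::nat) (j::nat). \<exists>(k::nat) (l::nat). \<exists>n\<in>N.
    b [^]\<^bsub>G\<^esub> i \<otimes>\<^bsub>G\<^esub> a [^]\<^bsub>G\<^esub> j = n \<otimes>\<^bsub>G\<^esub> (a [^]\<^bsub>G\<^esub> k \<otimes>\<^bsub>G\<^esub> b [^]\<^bsub>G\<^esub> l))"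

abbreviation permutes_cyc :: "('a, 'b) monoid_scheme \<Rightarrow> 'a \<Rightarrow> 'a \<Rightarrow> bool"
  where "permutes_cyc G a b \<equiv> permz G \<one>\<^bsub>G\<^esub> a b"

lemma permzD:
  fixes i j :: nat
  assumes "permz G z a b"
  obtains k l s :: nat where "b [^]\<^bsub>G\<^esub> i \<otimes>\<^bsub>G\<^esub> a [^]\<^bsub>G\<^esub> j = z [^]\<^bsub>G\<^esub> s \<otimes>\<^bsub>G\<^esub> (a [^]\<^bsub>G\<^esub> k \<otimes>\<^bsub>G\<^esub> b [^]\<^bsub>G\<^esub> l)"
  using assms unfolding permz_def by metis

lemma (in group) permutes_cycI:
  assumes "a \<in> carrier G" "b \<in> carrier G"
    "\<And>(i::nat) (j::nat). \<exists>(k::nat) (l::nat). b [^] i \<otimes> a [^] j = a [^] k \<otimes> b [^] l"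
  shows "permutes_cyc G a b"
  unfolding permz_def using assms by simp

lemma (in group) permutes_cycD:
  fixes i j :: nat
  assumes "a \<in> carrier G" "b \<in> carrier G" "permutes_cyc G a b"
  obtains k l :: nat where "b [^] i \<otimes> a [^] j = a [^] k \<otimes> b [^] l"
  using permzD[OF assms(3), of i j] assms by auto

lemma (in group) pmod_one:
  assumes "a \<in> carrier G" "b \<in> carrier G"
  shows "pmod G {\<one>} a b \<longleftrightarrow> permutes_cyc G a b"
  using assms by (simp add: permz_def pmod_def)

lemma (in group) pmod_quotient:
  assumes N: "N \<lhd> G" and ab: "a \<in> carrier G" "b \<in> carrier G"
  shows "pmod G N a b \<longleftrightarrow> permutes_cyc (G Mod N) (N #> a) (N #> b)"
proof -
  interpret h: group_hom G "G Mod N" "\<lambda>x. N #> x" using quotient_hom[OF N] .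
  have e: "(\<exists>n\<in>N. b [^] i \<otimes> a [^] j = n \<otimes> (a [^] k \<otimes> b [^] l)) \<longleftrightarrow>
    (N #> b) [^]\<^bsub>G Mod N\<^esub> i \<otimes>\<^bsub>G Mod N\<^esub> (N #> a) [^]\<^bsub>G Mod N\<^esub> j =
    (N #> a) [^]\<^bsub>G Mod N\<^esub> k \<otimes>\<^bsub>G Mod N\<^esub> (N #> b) [^]\<^bsub>G Mod N\<^esub> l" for i j k l :: nat
  proof -
    have "(\<exists>n\<in>N. b [^] i \<otimes> a [^] j = n \<otimes> (a [^] k \<otimes> b [^] l)) \<longleftrightarrow>
      N #> (b [^] i \<otimes> a [^] j) = N #> (a [^] k \<otimes> b [^] l)"
      by (rule quotient_eq[OF N, symmetric]) (use ab in simp_all)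
    then show ?thesis
      using ab by (simp only: h.hom_mult h.hom_nat_pow nat_pow_closed)
  qed
  have "permutes_cyc (G Mod N) (N #> a) (N #> b) \<longleftrightarrow> (\<forall>(i::nat) (j::nat). \<exists>(k::nat) (l::nat).
    (N #> b) [^]\<^bsub>G Mod N\<^esub> i \<otimes>\<^bsub>G Mod N\<^esub> (N #> a) [^]\<^bsub>G Mod N\<^esub> j =
    (N #> a) [^]\<^bsub>G Mod N\<^esub> k \<otimes>\<^bsub>G Mod N\<^esub> (N #> b) [^]\<^bsub>G Mod N\<^esub> l)"
    unfolding permz_def
    using h.H.l_one[OF h.H.m_closed[OF h.H.nat_pow_closed h.H.nat_pow_closed]] h.hom_closed ab
    by (simp only: h.H.nat_pow_one) metis
  then show ?thesis unfolding pmod_def e by simp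
qed

lemma (in group) pmod_lift:
  assumes N: "N \<lhd> G" and M: "\<And>x. x \<in> carrier G \<Longrightarrow> x \<in> M \<longleftrightarrow> N #> x \<in> cyc (G Mod N) z" "M \<subseteq> carrier G"
    and ab: "a \<in> carrier G" "b \<in> carrier G" and p: "pmod G M a b"
  shows "permz (G Mod N) z (N #> a) (N #> b)"
  unfolding permz_def
proof (intro allI)
  interpret h: group_hom G "G Mod N" "\<lambda>x. N #> x" using quotient_hom[OF N] .
  fix i j :: nat
  obtain k l m where m: "m \<in> M" "b [^] i \<otimes> a [^] j = m \<otimes> (a [^] (k::nat) \<otimes> b [^] (l::nat))"
    using p unfolding pmod_def by metis
  have mc: "m \<in> carrier G" using m M by blast
  then obtain s where s: "N #> m = z [^]\<^bsub>G Mod N\<^esub> (s::nat)" using m M cycE by metis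
  have "N #> (b [^] i \<otimes> a [^] j) = N #> (m \<otimes> (a [^] k \<otimes> b [^] l))" using m by simp
  then have "(N #> b) [^]\<^bsub>G Mod N\<^esub> i \<otimes>\<^bsub>G Mod N\<^esub> (N #> a) [^]\<^bsub>G Mod N\<^esub> j =
    z [^]\<^bsub>G Mod N\<^esub> s \<otimes>\<^bsub>G Mod N\<^esub> ((N #> a) [^]\<^bsub>G Mod N\<^esub> k \<otimes>\<^bsub>G Mod N\<^esub> (N #> b) [^]\<^bsub>G Mod N\<^esub> l)"
    using ab mc by (simp only: h.hom_mult h.hom_nat_pow nat_pow_closed m_closed s)
  then show "\<exists>(k::nat) (l::nat) (s::nat). (N #> b) [^]\<^bsub>G Mod N\<^esub> i \<otimes>\<^bsub>G Mod N\<^esub> (N #> a) [^]\<^bsub>G Mod N\<^esub> j =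
    z [^]\<^bsub>G Mod N\<^esub> s \<otimes>\<^bsub>G Mod N\<^esub> ((N #> a) [^]\<^bsub>G Mod N\<^esub> k \<otimes>\<^bsub>G Mod N\<^esub> (N #> b) [^]\<^bsub>G Mod N\<^esub> l)" by blast
qed

lemma finite_chain_subset:
  assumes "finite F" "C \<noteq> {}" "\<And>M N. M \<in> C \<Longrightarrow> N \<in> C \<Longrightarrow> M \<subseteq> N \<or> N \<subseteq> M" "F \<subseteq> \<Union>C"
  obtains N where "N \<in> C" "F \<subseteq> N"
proof -
  have "subset.chain C C" unfolding subset_chain_def using assms(3) by blast
  then show ?thesis using finite_subset_Union_chain[OF assms(1,4,2)] that by metis
qed

text \<open>The orders of \<open>a\<close> and \<open>b\<close> leave only finitely many pairs of
  exponents, so finitely many elements of the union witness the relation, and one member of the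
  chain contains them all.\<close>

lemma (in group) pmod_chain:
  assumes C: "C \<noteq> {}" "\<And>M N. M \<in> C \<Longrightarrow> N \<in> C \<Longrightarrow> M \<subseteq> N \<or> N \<subseteq> M"
    and ab: "a \<in> carrier G" "b \<in> carrier G" "torsion G a" "torsion G b" and p: "pmod G (\<Union>C) a b"
  obtains N where "N \<in> C" "pmod G N a b"
proof -
  obtain na where na: "na > 0" "a [^] (na::nat) = \<one>" using ab by (auto simp: torsion_def)
  obtain nb where nb: "nb > 0" "b [^] (nb::nat) = \<one>" using ab by (auto simp: torsion_def)
  define R where "R i j n \<longleftrightarrow> n \<in> \<Union>C \<and> (\<exists>(k::nat) (l::nat). b [^] i \<otimes> a [^] j = n \<otimes> (a [^] k \<otimes> b [^] l))" for i j :: nat and n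
  have ex: "\<exists>n. R i j n" for i j using p unfolding pmod_def R_def by blast
  define f where "f i j = (SOME n. R i j n)" for i j
  have f: "R i j (f i j)" for i j unfolding f_def using ex someI_ex by metis
  define F where "F = (\<lambda>(i, j). f i j) ` ({..<nb} \<times> {..<na})"
  have "F \<subseteq> \<Union>C" using f unfolding F_def R_def by auto
  moreover have "finite F" by (simp add: F_def)
  ultimately obtain N where N: "N \<in> C" "F \<subseteq> N" using finite_chain_subset[of F C] C by metis
  have "pmod G N a b" unfolding pmod_def
  proof (intro allI)
    fix i j :: nat
    have i: "b [^] i = b [^] (i mod nb)" using ab nb by (intro pow_cong[of b nb]) auto
    have j: "a [^] j = a [^] (j mod na)" using ab na by (intro pow_cong[of a na]) auto
    have "f (i mod nb) (j mod na) \<in> F" using na nb by (auto simp: F_def)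
    then have "f (i mod nb) (j mod na) \<in> N" using N by blast
    then show "\<exists>(k::nat) (l::nat). \<exists>n\<in>N. b [^] i \<otimes> a [^] j = n \<otimes> (a [^] k \<otimes> b [^] l)"
      using f[of "i mod nb" "j mod na"] unfolding R_def i j by blast
  qed
  then show ?thesis using that N by blast
qed

lemma (in group) normal_swap:
  assumes "N \<lhd> G" "h \<in> N" "x \<in> carrier G"
  obtains h' where "h' \<in> N" "h \<otimes> x = x \<otimes> h'"
proof -
  have hc: "h \<in> carrier G" using assms normal_imp_subgroup subgroup.mem_carrier by metis
  have "inv x \<otimes> h \<otimes> x \<in> N" using normal.inv_op_closed1[OF assms(1,3,2)] .
  moreover have "h \<otimes> x = x \<otimes> (inv x \<otimes> h \<otimes> x)" using assms hc by (simp add: m_assoc)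
  ultimately show ?thesis using that by blast
qed

lemma (in group) normal_swap':
  assumes "N \<lhd> G" "h \<in> N" "x \<in> carrier G"
  obtains h' where "h' \<in> N" "x \<otimes> h = h' \<otimes> x"
proof -
  have hc: "h \<in> carrier G" using assms normal_imp_subgroup subgroup.mem_carrier by metis
  have "x \<otimes> h \<otimes> inv x \<in> N" using normal.inv_op_closed2[OF assms(1,3,2)] .
  moreover have "x \<otimes> h = (x \<otimes> h \<otimes> inv x) \<otimes> x" using assms hc by (simp add: m_assoc)
  ultimately show ?thesis using that by blast
qed

lemma (in group) permz_absorb_left:
  assumes c: "a \<in> carrier G" "b \<in> carrier G" "z \<in> cyc G a" and p: "permz G z a b"
  shows "permutes_cyc G a b"
proof (rule permutes_cycI[OF c(1,2)])
  fix i j :: nat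
  obtain k l s :: nat where e: "b [^] i \<otimes> a [^] j = z [^] s \<otimes> (a [^] k \<otimes> b [^] l)" using permzD[OF p] .
  obtain t where "z = a [^] (t::nat)" using c cycE by metis
  then have "b [^] i \<otimes> a [^] j = a [^] (t * s + k) \<otimes> b [^] l"
    unfolding e using c by (simp add: nat_pow_pow m_assoc flip: nat_pow_mult)
  then show "\<exists>(k::nat) (l::nat). b [^] i \<otimes> a [^] j = a [^] k \<otimes> b [^] l" by blast
qed

lemma (in group) permz_absorb_right:
  assumes c: "a \<in> carrier G" "b \<in> carrier G" "z \<in> cyc G b" "cyc G z \<lhd> G" and p: "permz G z a b"
  shows "permutes_cyc G a b"
proof (rule permutes_cycI[OF c(1,2)])
  fix i j :: nat
  obtain k l s :: nat where e: "b [^] i \<otimes> a [^] j = z [^] s \<otimes> (a [^] k \<otimes> b [^] l)" using permzD[OF p] .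
  have zc: "z \<in> carrier G" using c cyc_closed by blast
  obtain h where h: "h \<in> cyc G z" "z [^] s \<otimes> a [^] k = a [^] k \<otimes> h"
    using normal_swap[OF c(4) pow_in_cyc nat_pow_closed[OF c(1)]] by metis
  have "h \<in> cyc G b" using h cyc_trans[OF c(2,3)] by blast
  then obtain t where t: "h = b [^] (t::nat)" using cycE by metis
  have "b [^] i \<otimes> a [^] j = (z [^] s \<otimes> a [^] k) \<otimes> b [^] l" unfolding e using c zc by (simp add: m_assoc)
  also have "\<dots> = a [^] k \<otimes> b [^] (t + l)" unfolding h t using c by (simp add: m_assoc flip: nat_pow_mult)
  finally show "\<exists>(k::nat) (l::nat). b [^] i \<otimes> a [^] j = a [^] k \<otimes> b [^] l" by blast
qed

text \<open>Take inverses on both sides; normality of \<open>cyc G z\<close> brings the power of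
  \<open>z\<close> back to the front.\<close>

lemma (in group) permz_sym:
  assumes c: "a \<in> carrier G" "b \<in> carrier G" "z \<in> carrier G" "cyc G z \<lhd> G" "torsion G a" "torsion G b" "torsion G z"
    and p: "permz G z a b"
  shows "permz G z b a"
  unfolding permz_def
proof (intro allI)
  fix i j :: nat
  obtain j' i' where ji: "inv (b [^] j) = b [^] (j'::nat)" "inv (a [^] i) = a [^] (i'::nat)"
    using inv_pow_in_cyc[of b j] inv_pow_in_cyc[of a i] c cycE by metis
  obtain k l s :: nat where e: "b [^] j' \<otimes> a [^] i' = z [^] s \<otimes> (a [^] k \<otimes> b [^] l)" using permzD[OF p] .
  obtain k' l' where kl: "inv (a [^] k) = a [^] (k'::nat)" "inv (b [^] l) = b [^] (l'::nat)"
    using inv_pow_in_cyc[of a k] inv_pow_in_cyc[of b l] c cycE by metis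
  have zs: "inv (z [^] s) \<in> cyc G z" using inv_pow_in_cyc c by blast
  have "a [^] i \<otimes> b [^] j = inv (b [^] j' \<otimes> a [^] i')"
    using c by (simp add: inv_mult_group flip: ji)
  also have "\<dots> = (b [^] l' \<otimes> a [^] k') \<otimes> inv (z [^] s)"
    unfolding e using c by (simp add: inv_mult_group kl m_assoc)
  finally have e': "a [^] i \<otimes> b [^] j = (b [^] l' \<otimes> a [^] k') \<otimes> inv (z [^] s)" .
  obtain h where h: "h \<in> cyc G z" "(b [^] l' \<otimes> a [^] k') \<otimes> inv (z [^] s) = h \<otimes> (b [^] l' \<otimes> a [^] k')"
    using normal_swap'[OF c(4) zs, of "b [^] l' \<otimes> a [^] k'"] c by auto
  obtain t where "h = z [^] (t::nat)" using h cycE by metis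
  then show "\<exists>(k::nat) (l::nat) (s::nat). a [^] i \<otimes> b [^] j = z [^] s \<otimes> (b [^] k \<otimes> a [^] l)"
    using e' h by metis
qed

lemma (in group) permutes_cyc_sym:
  assumes "a \<in> carrier G" "b \<in> carrier G" "torsion G a" "torsion G b" "permutes_cyc G a b"
  shows "permutes_cyc G b a"
proof (rule permz_sym)
  have "cyc G \<one> = {\<one>}" by (auto simp: cyc_def)
  then show "cyc G \<one> \<lhd> G" using one_is_normal by simp
  show "torsion G \<one>" unfolding torsion_def by (intro exI[of _ 1]) simp
qed (use assms in auto)

text \<open>\<open>a\<close> has a power of order \<open>p\<close>, and \<open>A\<close> has only
  one subgroup of that order.\<close>

lemma (in group) plc_p_mem:
  assumes A: "plc G A" "a \<in> A" "z \<in> A" "a \<noteq> \<one>" and p: "pelt G (\<lambda>r. r = p) a" "pelt G (\<lambda>r. r = p) z"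
    and q: "z [^] (q::nat) = \<one>" "prime q"
  shows "z \<in> cyc G a"
proof (cases "z = \<one>")
  case True then show ?thesis by (simp add: one_in_cyc)
next
  case False
  have c: "a \<in> carrier G" "z \<in> carrier G" "torsion G a" using A plc_closed plc_torsion by auto
  have qp: "q = p" using pelt_prime_coprime[OF c(2) p(2) q] False by blast
  obtain r y where y: "prime (r::nat)" "y \<in> cyc G a" "y \<noteq> \<one>" "y [^] r = \<one>"
    using exists_prime_power[OF c(1,3) A(4)] by metis
  have yc: "y \<in> carrier G" using y c cyc_closed by blast
  have "r = p" using pelt_prime_coprime[OF yc pelt_cyc[OF c(1) p(1) y(2)] y(4,1)] y by blast
  moreover have "y \<in> A" using subgroup_cyc[OF plc_subgroup[OF A(1)] A(2)] y by blast
  ultimately have "z \<in> cyc G y" using plc_prime_mem[OF A(1) _ A(3) y(1,3,4)] q qp by simp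
  then show ?thesis using cyc_trans[OF c(1) y(2)] by blast
qed

lemma (in group) pmod_carrier:
  assumes "a \<in> carrier G" "b \<in> carrier G" shows "pmod G (carrier G) a b"
  unfolding pmod_def
proof (intro allI)
  fix i j :: nat
  have "b [^] i \<otimes> a [^] j = (b [^] i \<otimes> a [^] j) \<otimes> (a [^] (0::nat) \<otimes> b [^] (0::nat))" using assms by simp
  then show "\<exists>(k::nat) (l::nat). \<exists>n\<in>carrier G. b [^] i \<otimes> a [^] j = n \<otimes> (a [^] k \<otimes> b [^] l)"
    using assms by (meson m_closed nat_pow_closed)
qed

lemma (in group) permutes_cyc_one:
  assumes "b \<in> carrier G" shows "permutes_cyc G \<one> b" "permutes_cyc G b \<one>"
proof -
  show "permutes_cyc G \<one> b"
    by (rule permutes_cycI) (use assms in \<open>auto intro: exI[of _ "0::nat"]\<close>)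
  show "permutes_cyc G b \<one>"
    by (rule permutes_cycI) (use assms in \<open>auto intro: exI[of _ "0::nat"]\<close>)
qed

lemma (in group) normal_carrier: "N \<lhd> G \<Longrightarrow> N \<subseteq> carrier G"
  using normal_imp_subgroup subgroup.subset by metis

text \<open>In the step from \<open>N\<close> to \<open>M\<close> the generator \<open>z\<close>
  lies in one factor. Modulo \<open>N\<close> it is then a power of \<open>a\<close> or of
  \<open>b\<close>, these being \<open>p\<close>-elements of the same locally cyclic group, unless
  that element has become trivial. So \<open>z\<close> is absorbed, and permutability modulo
  \<open>M\<close> descends to \<open>N\<close>.\<close>

lemma (in full_product) permutes_p_elements:
  assumes p: "\<And>x. x \<in> A \<union> B \<Longrightarrow> pelt G (\<lambda>r. r = p) x" and ab: "a \<in> A" "b \<in> B"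
  shows "permutes_cyc G a b"
proof -
  have c: "a \<in> carrier G" "b \<in> carrier G" "torsion G a" "torsion G b"
    using ab A_torsion B_torsion by (auto simp: torsion_def)
  \<comment> \<open>The climb carries the whole implication; at the top its premise holds by
    \<open>pmod_carrier\<close>.\<close>
  have "pmod G (carrier G) a b \<longrightarrow> permutes_cyc G a b"
  proof (rule climb_induct[where Q="\<lambda>N. pmod G N a b \<longrightarrow> permutes_cyc G a b"])
    show "pmod G {\<one>} a b \<longrightarrow> permutes_cyc G a b" using pmod_one c by blast
  next
    fix C :: "'a set set"
    assume C: "C \<noteq> {}" "\<And>N. N \<in> C \<Longrightarrow> N \<lhd> G \<and> (pmod G N a b \<longrightarrow> permutes_cyc G a b)"
      "\<And>M N. M \<in> C \<Longrightarrow> N \<in> C \<Longrightarrow> M \<subseteq> N \<or> N \<subseteq> M"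
    show "pmod G (\<Union>C) a b \<longrightarrow> permutes_cyc G a b"
    proof
      assume "pmod G (\<Union>C) a b"
      then obtain N where "N \<in> C" "pmod G N a b" using pmod_chain[OF C(1,3) c] by metis
      then show "permutes_cyc G a b" using C(2) by blast
    qed
  next
    fix N M z q
    assume N: "N \<lhd> G" "pmod G N a b \<longrightarrow> permutes_cyc G a b" and z: "z \<in> A \<union> B" "prime (q::nat)" "z \<notin> N"
      "(N #> z) [^]\<^bsub>G Mod N\<^esub> q = \<one>\<^bsub>G Mod N\<^esub>" "cyc (G Mod N) (N #> z) \<lhd> G Mod N"
      and M: "M \<lhd> G" "\<And>x. x \<in> carrier G \<Longrightarrow> x \<in> M \<longleftrightarrow> N #> x \<in> cyc (G Mod N) (N #> z)"
    interpret h: group_hom G "G Mod N" "\<lambda>x. N #> x" using quotient_hom[OF N(1)] .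
    interpret Q: full_product "G Mod N" "(\<lambda>x. N #> x) ` A" "(\<lambda>x. N #> x) ` B" using quotient_full[OF N(1)] .
    show "pmod G M a b \<longrightarrow> permutes_cyc G a b"
    proof
      assume "pmod G M a b"
      then have pz: "permz (G Mod N) (N #> z) (N #> a) (N #> b)"
        using pmod_lift[OF N(1) M(2) normal_carrier[OF M(1)] c(1,2)] by blast
      have hc: "N #> a \<in> carrier (G Mod N)" "N #> b \<in> carrier (G Mod N)" using c by auto
      have pe: "pelt (G Mod N) (\<lambda>r. r = p) (N #> x)" if "x \<in> A \<union> B" for x
        using h.pelt_image[of x] p[OF that] that by auto
      have "permutes_cyc (G Mod N) (N #> a) (N #> b)"
      proof (cases "z \<in> A")
        case True
        show ?thesis
        proof (cases "N #> a = \<one>\<^bsub>G Mod N\<^esub>")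
          case True then show ?thesis using h.H.permutes_cyc_one(1)[OF hc(2)] by simp
        next
          case False
          then have "N #> z \<in> cyc (G Mod N) (N #> a)"
            using h.H.plc_p_mem[OF Q.plcA _ _ False pe pe z(4,2)] True ab by blast
          then show ?thesis using h.H.permz_absorb_left[OF hc _ pz] by blast
        qed
      next
        case F: False
        then have zB: "z \<in> B" using z by blast
        show ?thesis
        proof (cases "N #> b = \<one>\<^bsub>G Mod N\<^esub>")
          case True then show ?thesis using h.H.permutes_cyc_one(2)[OF hc(1)] by simp
        next
          case False
          then have "N #> z \<in> cyc (G Mod N) (N #> b)"
            using h.H.plc_p_mem[OF Q.plcB _ _ False pe pe z(4,2)] zB ab by blast
          then show ?thesis using h.H.permz_absorb_right[OF hc _ z(5) pz] by blast
        qed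
      qed
      then show "permutes_cyc G a b" using N pmod_quotient[OF N(1) c(1,2)] by blast
    qed
  qed
  then show ?thesis using pmod_carrier c by blast
qed

text \<open>In the step from \<open>N\<close> to \<open>M\<close> the new prime \<open>q\<close>
  satisfies \<open>P\<close> because \<open>z\<close> lies in a factor, and \<open>x [^] q\<close>
  falls into \<open>N\<close> for every \<open>x\<close> in \<open>M\<close>.\<close>

lemma (in full_product) product_pelt:
  assumes P: "\<And>x. x \<in> A \<union> B \<Longrightarrow> pelt G P x" and x: "x \<in> carrier G"
  shows "pelt G P x"
proof -
  have "\<forall>x\<in>carrier G. pelt G P x"
  proof (rule climb_induct[where Q="\<lambda>N. \<forall>x\<in>N. pelt G P x"])
    show "\<forall>x\<in>{\<one>}. pelt G P x" using pelt_one by simp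
  next
    fix C :: "'a set set"
    assume "\<And>N. N \<in> C \<Longrightarrow> N \<lhd> G \<and> (\<forall>x\<in>N. pelt G P x)"
    then show "\<forall>x\<in>\<Union>C. pelt G P x" by blast
  next
    fix N M z q
    assume N: "N \<lhd> G" "\<forall>x\<in>N. pelt G P x" and z: "z \<in> A \<union> B" "prime (q::nat)" "z \<notin> N"
      "(N #> z) [^]\<^bsub>G Mod N\<^esub> q = \<one>\<^bsub>G Mod N\<^esub>"
      and M: "M \<lhd> G" "\<And>x. x \<in> carrier G \<Longrightarrow> x \<in> M \<longleftrightarrow> N #> x \<in> cyc (G Mod N) (N #> z)"
    interpret h: group_hom G "G Mod N" "\<lambda>x. N #> x" using quotient_hom[OF N(1)] .
    have zc: "z \<in> carrier G" using z(1) by auto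
    have "P q"
    proof (rule ccontr)
      assume "\<not> P q"
      then have "N #> z = \<one>\<^bsub>G Mod N\<^esub>"
        using h.H.pelt_prime_coprime[OF h.hom_closed[OF zc] h.pelt_image[OF zc P[OF z(1)]] z(4,2)] by blast
      then show False using quotient_one[OF N(1) zc] z by blast
    qed
    show "\<forall>x\<in>M. pelt G P x"
    proof
      fix x assume "x \<in> M"
      then have xc: "x \<in> carrier G" and "N #> x \<in> cyc (G Mod N) (N #> z)"
        using normal_carrier[OF M(1)] M(2) by auto
      then obtain i where "N #> x = (N #> z) [^]\<^bsub>G Mod N\<^esub> (i::nat)" using cycE by metis
      then have "(N #> x) [^]\<^bsub>G Mod N\<^esub> q = ((N #> z) [^]\<^bsub>G Mod N\<^esub> q) [^]\<^bsub>G Mod N\<^esub> i"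
        using h.H.nat_pow_pow[OF h.hom_closed[OF zc]] mult.commute by metis
      then have "N #> (x [^] q) = \<one>\<^bsub>G Mod N\<^esub>"
        unfolding h.hom_nat_pow[OF xc] z(4) using h.H.nat_pow_one by metis
      then have "x [^] q \<in> N" using quotient_one[OF N(1)] xc by simp
      then have "pelt G P (x [^] q)" using N by blast
      then obtain n where n: "n > 0" "(x [^] q) [^] (n::nat) = \<one>" "\<And>r. prime r \<Longrightarrow> r dvd n \<Longrightarrow> P r"
        using peltE by metis
      show "pelt G P x"
      proof (rule peltI[of "q * n"])
        show "P r" if "prime r" "r dvd q * n" for r
          using prime_dvd_multD[OF that] primes_dvd_imp_eq[OF that(1) z(2)] n(3)[OF that(1)] \<open>P q\<close> by auto
        show "q * n > 0" using n(1) prime_gt_0_nat[OF z(2)] by simp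
        show "x [^] (q * n) = \<one>" using n(2) nat_pow_pow[OF xc] by metis
      qed
    qed
  qed
  then show ?thesis using x by blast
qed

section \<open>Passage to subgroups\<close>

lemma (in group) restricted_cyc: "cyc (G\<lparr>carrier := L\<rparr>) x = cyc G x"
  by (simp add: cyc_def flip: nat_pow_consistent)

lemma (in group) restricted_torsion: "torsion (G\<lparr>carrier := L\<rparr>) x = torsion G x"
  by (simp add: torsion_def flip: nat_pow_consistent)

lemma (in group) restricted_pelt: "pelt (G\<lparr>carrier := L\<rparr>) P x = pelt G P x"
  by (simp add: pelt_def flip: nat_pow_consistent)

lemma (in group) restricted_permz: "permz (G\<lparr>carrier := L\<rparr>) z a b = permz G z a b"
  by (simp add: permz_def flip: nat_pow_consistent)

lemma (in group) restricted_plc: "subgroup L G \<Longrightarrow> plc G A \<Longrightarrow> A \<subseteq> L \<Longrightarrow> plc (G\<lparr>carrier := L\<rparr>) A"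
  unfolding plc_def restricted_cyc restricted_torsion using subgroup_incl by metis

lemma (in group) quotient_mult_left:
  assumes "N \<lhd> G" "n \<in> N" "y \<in> carrier G" shows "N #> (n \<otimes> y) = N #> y"
proof -
  have "n \<in> carrier G" using assms normal_imp_subgroup subgroup.mem_carrier by metis
  then show ?thesis using quotient_eq[OF assms(1), of "n \<otimes> y" y] assms by blast
qed

lemma (in group) full_productI:
  assumes "plc G A" "plc G B" "carrier G = A <#> B" shows "full_product G A B"
proof unfold_locales
  fix a b assume "a \<in> A" "b \<in> B"
  then have "b \<otimes> a \<in> A <#> B" using assms plc_closed by (metis m_closed)
  then show "\<exists>a'\<in>A. \<exists>b'\<in>B. b \<otimes> a = a' \<otimes> b'" by (auto elim!: set_multE)
qed (use assms in auto)

lemma (in two_factors) AB_commute: "A <#> B = B <#> A"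
proof (intro subset_antisym subsetI)
  fix x assume "x \<in> A <#> B"
  then obtain a b where ab: "a \<in> A" "b \<in> B" "x = a \<otimes> b" by (rule set_multE)
  then show "x \<in> B <#> A" using perm' set_multI[of _ B _ A] by metis
next
  fix x assume "x \<in> B <#> A"
  then obtain a b where ab: "a \<in> A" "b \<in> B" "x = b \<otimes> a" by (elim set_multE) blast
  then show "x \<in> A <#> B" using perm set_multI[of _ A _ B] by metis
qed

lemma (in two_factors) AB_subgroup: "subgroup (A <#> B) G"
  using subgroup_set_mult_commute[OF sA sB AB_commute] .

lemma (in two_factors) AB_incl: "A \<subseteq> A <#> B" "B \<subseteq> A <#> B"
proof -
  show "A \<subseteq> A <#> B" using set_multI[of _ A \<one> B] by fastforce
  show "B \<subseteq> A <#> B" using set_multI[of \<one> A _ B] by fastforce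
qed

lemma (in two_factors) restrict_full: "full_product (G\<lparr>carrier := A <#> B\<rparr>) A B"
proof (rule group.full_productI)
  show "Group.group (G\<lparr>carrier := A <#> B\<rparr>)" using subgroup.subgroup_is_group[OF AB_subgroup is_group] .
  show "plc (G\<lparr>carrier := A <#> B\<rparr>) A" "plc (G\<lparr>carrier := A <#> B\<rparr>) B"
    using restricted_plc[OF AB_subgroup] plcA plcB AB_incl by auto
qed (simp add: set_mult_def)

lemma (in group) two_factorsI:
  assumes "plc G A" "plc G B" "\<And>a b. a \<in> A \<Longrightarrow> b \<in> B \<Longrightarrow> b \<otimes> a \<in> A <#> B"
  shows "two_factors G A B"
proof unfold_locales
  fix a b assume "a \<in> A" "b \<in> B"
  then show "\<exists>a'\<in>A. \<exists>b'\<in>B. b \<otimes> a = a' \<otimes> b'" using assms(3) set_multE by metis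
qed (use assms in auto)

lemma (in group) plc_cyc:
  assumes "x \<in> carrier G" "torsion G x" shows "plc G (cyc G x)"
  unfolding plc_def
proof (intro conjI ballI)
  show "subgroup (cyc G x) G" using cyc_subgroup assms by blast
  show "torsion G y" if "y \<in> cyc G x" for y using that torsion_pow assms cycE by metis
  show "\<exists>z\<in>cyc G x. y \<in> cyc G z \<and> w \<in> cyc G z" if "y \<in> cyc G x" "w \<in> cyc G x" for y w
    using that cyc_self assms by blast
qed

section \<open>Removing a normal subgroup whose order is a prime outside the given ones\<close>

lemma (in group) coprime_product:
  assumes c: "z \<in> carrier G" "a \<in> carrier G" "z \<otimes> a = a \<otimes> z"
    and "z [^] (q::nat) = \<one>" "a [^] (n::nat) = \<one>" "coprime q n"
  shows "z \<in> cyc G (z \<otimes> a)" "a \<in> cyc G (z \<otimes> a)"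
proof -
  obtain v where v: "[n * v = 1] (mod q)"
    using cong_solve_coprime_nat[of n q] assms coprime_commute by (metis One_nat_def)
  obtain w where w: "[q * w = 1] (mod n)"
    using cong_solve_coprime_nat[of q n] assms by (metis One_nat_def)
  have "z [^] (n * v) = z [^] (1::nat)" using pow_cong[OF c(1) assms(4) v] .
  moreover have "a [^] (n * v) = \<one>" using assms c by (simp flip: nat_pow_pow)
  ultimately have "(z \<otimes> a) [^] (n * v) = z" using pow_mult_distrib[OF c(3,1,2)] c by simp
  then show "z \<in> cyc G (z \<otimes> a)" using pow_in_cyc by metis
  have "a [^] (q * w) = a [^] (1::nat)" using pow_cong[OF c(2) assms(5) w] .
  moreover have "z [^] (q * w) = \<one>" using assms c by (simp flip: nat_pow_pow)
  ultimately have "(z \<otimes> a) [^] (q * w) = a" using pow_mult_distrib[OF c(3,1,2)] c by simp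
  then show "a \<in> cyc G (z \<otimes> a)" using pow_in_cyc by metis
qed

lemma (in group) commute_pow:
  assumes "x \<in> carrier G" "y \<in> carrier G" "x \<otimes> y = y \<otimes> x"
  shows "x [^] (k::nat) \<otimes> y = y \<otimes> x [^] k"
proof (induction k)
  case (Suc k)
  have "x [^] Suc k \<otimes> y = x [^] k \<otimes> (y \<otimes> x)" using assms by (simp add: m_assoc)
  also have "\<dots> = y \<otimes> x [^] Suc k" using assms Suc by (simp flip: m_assoc)
  finally show ?case .
qed (use assms in simp)

lemma (in group) commute_cyc:
  assumes "x \<in> carrier G" "y \<in> carrier G" "x \<otimes> y = y \<otimes> x" "w \<in> cyc G x"
  shows "w \<otimes> y = y \<otimes> w"
  using commute_pow[OF assms(1-3)] assms(4) cycE by metis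

lemma (in group) conj_iter:
  assumes c: "x \<in> carrier G" "w \<in> carrier G" "n \<in> carrier G" "x \<otimes> n = n \<otimes> x"
    and e: "x \<otimes> w \<otimes> inv x = n \<otimes> w"
  shows "x [^] (k::nat) \<otimes> w \<otimes> inv (x [^] k) = n [^] k \<otimes> w"
proof (induction k)
  case (Suc k)
  have "x [^] Suc k \<otimes> w \<otimes> inv (x [^] Suc k) = x [^] k \<otimes> (x \<otimes> w \<otimes> inv x) \<otimes> inv (x [^] k)"
    using c by (simp add: m_assoc inv_mult_group)
  also have "\<dots> = n \<otimes> (x [^] k \<otimes> w \<otimes> inv (x [^] k))"
    unfolding e using c commute_pow[OF c(1,3,4), of k] by (simp flip: m_assoc)
  also have "\<dots> = n [^] Suc k \<otimes> w" unfolding Suc using c commute_pow[of n n k] by (simp flip: m_assoc)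
  finally show ?case .
qed (use c in simp)

text \<open>Take a minimal normal subgroup
  above the normal subgroup of order \<open>q\<close> generated by \<open>z\<close>, generated modulo \<open>z\<close> by some \<open>w\<close>.
  If \<open>w\<close> commutes with \<open>z\<close>, it generates a normal subgroup; otherwise \<open>a\<close> and \<open>b\<close> centralise \<open>w\<close>,
  which \<open>z\<close> does not.\<close>

lemma (in group) complement_step:
  assumes c: "a \<in> carrier G" "b \<in> carrier G" "z \<in> carrier G"
    and z: "z \<noteq> \<one>" "prime q" "z [^] (q::nat) = \<one>" "\<not> P q" "cyc G z \<lhd> G" "a \<otimes> z = z \<otimes> a"
    and P: "pelt G P a" "pelt G P b"
    and full: "carrier G = cyc G (z \<otimes> a) <#> cyc G b"
    and pz: "permz G z a b"
  shows "permutes_cyc G a b \<or>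
    (\<exists>w r. (w \<in> cyc G a \<or> w \<in> cyc G b) \<and> prime (r::nat) \<and> w \<noteq> \<one> \<and> w [^] r = \<one> \<and> r \<noteq> q \<and> cyc G w \<lhd> G)"
proof -
  obtain m0 where n: "m0 > 0" "a [^] (m0::nat) = \<one>" "\<And>q. prime q \<Longrightarrow> q dvd m0 \<Longrightarrow> P q"
    using peltE[OF P(1)] by metis
  have qn: "coprime m0 q" by (rule coprime_of_primes[of m0 P]) (use n z primes_dvd_imp_eq in auto)
  have q0: "q > 0" using z(2) prime_gt_0_nat by blast
  \<comment> \<open>\<open>z\<close> and \<open>a\<close> commute and have coprime exponents, so
    \<open>z \<otimes> a\<close> generates both. This makes the group a product of two cyclic
    groups, to which \<open>climb\<close> applies.\<close>
  have za: "z \<in> cyc G (z \<otimes> a)" "a \<in> cyc G (z \<otimes> a)"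
    using coprime_product[of z a q m0] c z n(2) qn coprime_commute by metis+
  have zat: "torsion G (z \<otimes> a)"
  proof -
    have "(z \<otimes> a) [^] (q * m0) = (z [^] q) [^] m0 \<otimes> (a [^] m0) [^] q"
      using pow_mult_distrib[of z a] c z(6) by (simp add: nat_pow_pow mult.commute)
    then have "(z \<otimes> a) [^] (q * m0) = \<one>" using z(3) n(2) by simp
    then show ?thesis using q0 n(1) unfolding torsion_def by (metis nat_0_less_mult_iff)
  qed
  interpret F: full_product G "cyc G (z \<otimes> a)" "cyc G b"
    by (rule full_productI[OF plc_cyc plc_cyc full]) (use c zat pelt_torsion[OF P(2)] in auto)
  have zt: "torsion G z" using q0 z(3) by (auto simp: torsion_def)
  have zcyc: "x \<otimes> y = y \<otimes> x" if "x \<in> cyc G z" "y \<in> cyc G z" for x y using that cyc_commute c by blast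
  have azc: "a \<otimes> x = x \<otimes> a" if "x \<in> cyc G z" for x
    using commute_cyc[OF c(3,1) z(6)[symmetric] that] by simp
  show ?thesis
  proof (cases "cyc G z = carrier G")
    case True
    have "x = \<one>" if "x \<in> carrier G" "pelt G P x" for x
    proof -
      have "x \<in> cyc G z" using True that by simp
      then have "x [^] q = \<one>" using z(3) c(3) cycE by (metis mult.commute nat_pow_one nat_pow_pow)
      then show ?thesis using pelt_prime_coprime that z by blast
    qed
    then have "a = \<one>" using c P by blast
    then show ?thesis using permutes_cyc_one(1)[OF c(2)] by simp
  next
    case False
    let ?H = "G Mod cyc G z"
    let ?f = "\<lambda>x. cyc G z #> x"
    interpret h: group_hom G ?H ?f using quotient_hom[OF z(5)] .
    obtain v r where v: "v \<in> cyc G (z \<otimes> a) \<union> cyc G b" "prime (r::nat)" "v \<notin> cyc G z"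
      "?f v [^]\<^bsub>?H\<^esub> r = \<one>\<^bsub>?H\<^esub>" "cyc ?H (?f v) \<lhd> ?H"
      using F.climb[OF z(5) False] by metis
    \<comment> \<open>Modulo \<open>z\<close>, a generator taken from
      \<open>cyc G (z \<otimes> a)\<close> can be replaced by a power of \<open>a\<close>, whose
      order involves only primes in \<open>P\<close>.\<close>
    have "\<exists>w. (w \<in> cyc G a \<or> w \<in> cyc G b) \<and> ?f w = ?f v"
    proof (cases "v \<in> cyc G b")
      case False
      then have "v \<in> cyc G (z \<otimes> a)" using v(1) by simp
      then obtain k where "v = (z \<otimes> a) [^] (k::nat)" by (rule cycE)
      then have veq: "v = z [^] k \<otimes> a [^] k" using pow_mult_distrib[of z a] c z(6) by simp
      have "?f v = ?f (a [^] k)"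
        unfolding veq by (rule quotient_mult_left[OF z(5) pow_in_cyc nat_pow_closed[OF c(1)]])
      then show ?thesis using pow_in_cyc by metis
    qed blast
    then obtain w where w: "w \<in> cyc G a \<or> w \<in> cyc G b" "?f w = ?f v" by blast
    have vc: "v \<in> carrier G" using v(1) cyc_closed c by auto
    have wc: "w \<in> carrier G" using w cyc_closed c by blast
    have wP: "pelt G P w" using w pelt_cyc c P by blast
    have wz: "w \<notin> cyc G z"
      using v(3) w(2) quotient_one[OF z(5) vc] quotient_one[OF z(5) wc] by simp
    have w1: "w \<noteq> \<one>" using wz one_in_cyc[of G z] by blast
    have powq: "x [^] q = \<one>" if "x \<in> cyc G z" for x
      using that z(3) c(3) cycE by (metis mult.commute nat_pow_one nat_pow_pow)
    have "?f (w [^] r) = \<one>\<^bsub>?H\<^esub>" using h.hom_nat_pow[OF wc] w(2) v(4) by metis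
    then have "w [^] r \<in> cyc G z" using quotient_one[OF z(5)] wc by simp
    \<comment> \<open>\<open>w [^] r\<close> lies in \<open>cyc G z\<close> and so has exponent
      \<open>q\<close>, but only primes in \<open>P\<close> are involved in its order.\<close>
    then have wr: "w [^] r = \<one>"
      using pelt_prime_coprime[OF nat_pow_closed[OF wc] pelt_pow[OF wc wP] _ z(2,4)] powq by blast
    have rq: "r \<noteq> q" using pelt_prime_coprime[OF wc wP _ z(2,4)] wr w1 by blast
    have cop: "x = \<one>" if "x \<in> cyc G z" "x [^] r = \<one>" for x
      using prime_pow_one[of x r q] that powq cyc_closed[OF c(3)] primes_coprime[OF v(2) z(2) rq] by blast
    have conj: "\<exists>n\<in>cyc G z. \<exists>k::nat. g \<otimes> w \<otimes> inv g = n \<otimes> w [^] k" if g: "g \<in> carrier G" for g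
    proof -
      have "?f (g \<otimes> w \<otimes> inv g) = ?f g \<otimes>\<^bsub>?H\<^esub> ?f w \<otimes>\<^bsub>?H\<^esub> inv\<^bsub>?H\<^esub> (?f g)"
        by (simp only: h.hom_mult h.hom_inv g wc m_closed inv_closed)
      also have "\<dots> \<in> cyc ?H (?f w)"
        using h.H.normal_invE(2)[OF v(5) h.hom_closed[OF g]] h.H.cyc_self[OF h.hom_closed[OF wc]] w(2) by simp
      finally obtain k where "?f (g \<otimes> w \<otimes> inv g) = ?f w [^]\<^bsub>?H\<^esub> (k::nat)" using cycE by metis
      then have "?f (g \<otimes> w \<otimes> inv g) = ?f (w [^] k)" using h.hom_nat_pow[OF wc] by simp
      then show ?thesis using quotient_eq[OF z(5), of "g \<otimes> w \<otimes> inv g" "w [^] k"] g wc by blast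
    qed
    show ?thesis
    proof (cases "w \<otimes> z = z \<otimes> w")
      case True
      have "g \<otimes> w \<otimes> inv g \<in> cyc G w" if g: "g \<in> carrier G" for g
      proof -
        obtain n k where nk: "n \<in> cyc G z" "g \<otimes> w \<otimes> inv g = n \<otimes> w [^] (k::nat)" using conj[OF g] by blast
        have nc: "n \<in> carrier G" using nk cyc_closed c by blast
        have "w [^] k \<otimes> n = n \<otimes> w [^] k"
          using commute_cyc[OF wc nc _ pow_in_cyc] commute_cyc[OF c(3) wc True[symmetric] nk(1)] by simp
        then have "(n \<otimes> w [^] k) [^] r = n [^] r \<otimes> (w [^] k) [^] r"
          using pow_mult_distrib[of n "w [^] k"] nc wc by simp
        also have "(w [^] k) [^] r = (w [^] r) [^] k" using wc by (simp add: nat_pow_pow mult.commute)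
        finally have "(n \<otimes> w [^] k) [^] r = n [^] r" using wr nc by simp
        moreover have "(g \<otimes> w \<otimes> inv g) [^] r = \<one>" using conj_pow[OF g wc, of r] wr g by simp
        ultimately have "n = \<one>" using cop nk by simp
        then show ?thesis using nk wc pow_in_cyc[of G w k] by simp
      qed
      then have "cyc G w \<lhd> G"
        using cyc_normalI[OF wc] wr prime_gt_0_nat[OF v(2)] by (auto simp: torsion_def)
      then show ?thesis using w v wr w1 rq by blast
    next
      case nc: False
      have wb: "w \<in> cyc G b" using w(1) nc commute_cyc[OF c(1,3) z(6)] by blast
      have noncomm: "x = \<one>" if "x \<in> cyc G z" "w \<otimes> x = x \<otimes> w" for x
        using cyc_prime_gen[OF c(3) z(2,3) that(1)] commute_cyc[OF cyc_closed[OF c(3) that(1)] wc that(2)[symmetric]]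
          nc by metis
      obtain n k0 where nk0: "n \<in> cyc G z" "a \<otimes> w \<otimes> inv a = n \<otimes> w [^] (k0::nat)" using conj[OF c(1)] by blast
      \<comment> \<open>Adding \<open>r\<close> before subtracting 1 keeps the exponent natural even
        for \<open>k0 = 0\<close>, so that \<open>Suc k\<close> can replace \<open>k0\<close> modulo
        \<open>r\<close>.\<close>
      define k where "k = k0 + r - 1"
      have k: "Suc k = k0 + r" using prime_gt_0_nat[OF v(2)] by (simp add: k_def)
      have "w [^] (Suc k) = w [^] k0" unfolding k using wr wc by (simp flip: nat_pow_mult)
      then have nk: "a \<otimes> w \<otimes> inv a = n \<otimes> w [^] (Suc k)" using nk0 by simp
      have ncar: "n \<in> carrier G" using nk0 cyc_closed c by blast
      define y where "y = w \<otimes> z \<otimes> inv w"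
      have y: "y \<in> cyc G z" unfolding y_def using normal_invE(2)[OF z(5) wc cyc_self[OF c(3)]] .
      define w' where "w' = w [^] Suc k \<otimes> z \<otimes> inv (w [^] Suc k)"
      have w': "w' \<in> cyc G z" unfolding w'_def
        using normal_invE(2)[OF z(5) nat_pow_closed[OF wc] cyc_self[OF c(3)]] .
      have yc: "y \<in> carrier G" "w' \<in> carrier G" using y w' cyc_closed c by auto
      \<comment> \<open>\<open>a\<close> centralises \<open>cyc G z\<close>, so \<open>w\<close> and
        its conjugate under \<open>a\<close> act alike on \<open>z\<close>. The factor
        \<open>n\<close> acts trivially, hence \<open>w [^] k\<close> does so too.\<close>
      have "y = a \<otimes> y \<otimes> inv a" using azc[OF y] c yc by (simp add: m_assoc)
      also have "\<dots> = (a \<otimes> w \<otimes> inv a) \<otimes> (a \<otimes> z \<otimes> inv a) \<otimes> inv (a \<otimes> w \<otimes> inv a)"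
        using c wc by (simp add: y_def m_assoc inv_mult_group)
      also have "a \<otimes> z \<otimes> inv a = z" using z(6) c by (simp add: m_assoc)
      also have "(a \<otimes> w \<otimes> inv a) \<otimes> z \<otimes> inv (a \<otimes> w \<otimes> inv a) = n \<otimes> w' \<otimes> inv n"
        unfolding nk using c wc ncar by (simp add: w'_def m_assoc inv_mult_group del: nat_pow_Suc)
      also have "\<dots> = w'" using zcyc[OF nk0(1) w'] ncar yc by (simp add: m_assoc)
      finally have "w \<otimes> z \<otimes> inv w = w [^] Suc k \<otimes> z \<otimes> inv (w [^] Suc k)" by (simp only: y_def w'_def)
      also have "\<dots> = w \<otimes> (w [^] k \<otimes> z \<otimes> inv (w [^] k)) \<otimes> inv w"
        unfolding nat_pow_Suc2[OF wc] using wc c by (simp add: m_assoc inv_mult_group)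
      finally have "w [^] k \<otimes> z \<otimes> inv (w [^] k) = z" using wc c by simp
      then have wk: "w [^] k \<otimes> z = z \<otimes> w [^] k" using wc c
        by (metis inv_closed inv_solve_right m_closed nat_pow_closed)
      have "w [^] k = \<one>"
      proof (rule ccontr)
        assume "w [^] k \<noteq> \<one>"
        then have "w \<in> cyc G (w [^] k)" using cyc_prime_gen[OF wc v(2) wr pow_in_cyc] by blast
        then show False using commute_cyc[OF nat_pow_closed[OF wc] c(3) wk] nc by blast
      qed
      then have aw: "a \<otimes> w \<otimes> inv a = n \<otimes> w" using nk wc by simp
      \<comment> \<open>Every exponent that kills \<open>a\<close> kills \<open>n\<close>, so the
        order of \<open>n\<close> involves only primes in \<open>P\<close>; lying in
        \<open>cyc G z\<close>, it is trivial.\<close>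
      have "n [^] m \<otimes> w = w" if "a [^] m = \<one>" for m :: nat
        using conj_iter[OF c(1) wc ncar azc[OF nk0(1)] aw, of m] that wc by simp
      then have "n [^] m = \<one>" if "a [^] m = \<one>" for m :: nat
        using that wc ncar by (metis l_cancel_one nat_pow_closed r_cancel_one)
      then have "n [^] m0 = \<one>" using n by blast
      then have nP: "pelt G P n" using n by (intro peltI[of m0]) blast+
      have "n = \<one>" using pelt_prime_coprime[OF ncar nP powq[OF nk0(1)] z(2,4)] .
      then have "a \<otimes> w = w \<otimes> a" using aw wc c by (metis inv_solve_right l_one m_closed)
      then have aw: "w \<otimes> a [^] j = a [^] j \<otimes> w" for j :: nat
        using commute_pow[OF c(1) wc] by simp
      have bw: "w \<otimes> b [^] i = b [^] i \<otimes> w" for i :: nat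
        using cyc_commute[OF c(2) wb pow_in_cyc] .
      have "permutes_cyc G a b"
      proof (rule permutes_cycI[OF c(1,2)])
        fix i j :: nat
        obtain k l s :: nat where e: "b [^] i \<otimes> a [^] j = z [^] s \<otimes> (a [^] k \<otimes> b [^] l)" using permzD[OF pz] .
        have "w \<otimes> (b [^] i \<otimes> a [^] j) = (b [^] i \<otimes> a [^] j) \<otimes> w"
          using aw bw c wc by (metis m_assoc nat_pow_closed)
        moreover have wab: "w \<otimes> (a [^] k \<otimes> b [^] l) = (a [^] k \<otimes> b [^] l) \<otimes> w"
          using aw bw c wc by (metis m_assoc nat_pow_closed)
        \<comment> \<open>\<open>w\<close> commutes with \<open>a\<close> and \<open>b\<close>,
          hence with \<open>z [^] s\<close>. No nontrivial element of \<open>cyc G z\<close>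
          commutes with \<open>w\<close>, so the disturbing factor disappears.\<close>
        ultimately have "w \<otimes> (z [^] s \<otimes> (a [^] k \<otimes> b [^] l)) = z [^] s \<otimes> (w \<otimes> (a [^] k \<otimes> b [^] l))"
          unfolding e wab using c wc by (simp add: m_assoc)
        then have "(w \<otimes> z [^] s) \<otimes> (a [^] k \<otimes> b [^] l) = (z [^] s \<otimes> w) \<otimes> (a [^] k \<otimes> b [^] l)"
          using c wc by (simp add: m_assoc)
        then have "w \<otimes> z [^] s = z [^] s \<otimes> w" using c wc by (metis m_closed nat_pow_closed r_cancel)
        then have "z [^] s = \<one>" using noncomm[OF pow_in_cyc] by blast
        then show "\<exists>(k::nat) (l::nat). b [^] i \<otimes> a [^] j = a [^] k \<otimes> b [^] l" using e c by auto
      qed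
      then show ?thesis by blast
    qed
  qed
qed

lemma (in group_hom) permz_image:
  assumes "a \<in> carrier G" "b \<in> carrier G" "z \<in> carrier G" "permz G z a b"
  shows "permz H (h z) (h a) (h b)"
  unfolding permz_def
proof (intro allI)
  fix i j :: nat
  obtain k l s :: nat where e: "b [^] i \<otimes> a [^] j = z [^] s \<otimes> (a [^] k \<otimes> b [^] l)" using permzD[OF assms(4)] .
  have "h b [^]\<^bsub>H\<^esub> i \<otimes>\<^bsub>H\<^esub> h a [^]\<^bsub>H\<^esub> j = h (b [^] i \<otimes> a [^] j)"
    using assms by (simp add: hom_nat_pow)
  also have "\<dots> = h z [^]\<^bsub>H\<^esub> s \<otimes>\<^bsub>H\<^esub> (h a [^]\<^bsub>H\<^esub> k \<otimes>\<^bsub>H\<^esub> h b [^]\<^bsub>H\<^esub> l)"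
    unfolding e using assms by (simp add: hom_nat_pow)
  finally show "\<exists>(k::nat) (l::nat) (s::nat). h b [^]\<^bsub>H\<^esub> i \<otimes>\<^bsub>H\<^esub> h a [^]\<^bsub>H\<^esub> j =
    h z [^]\<^bsub>H\<^esub> s \<otimes>\<^bsub>H\<^esub> (h a [^]\<^bsub>H\<^esub> k \<otimes>\<^bsub>H\<^esub> h b [^]\<^bsub>H\<^esub> l)" by blast
qed

lemma (in group_hom) set_mult_image:
  assumes "A \<subseteq> carrier G" "B \<subseteq> carrier G" shows "h ` (A <#> B) = h ` A <#>\<^bsub>H\<^esub> h ` B"
proof (intro subset_antisym subsetI)
  fix x assume "x \<in> h ` (A <#> B)"
  then obtain a b where ab: "a \<in> A" "b \<in> B" "x = h (a \<otimes> b)" by (auto elim!: G.set_multE)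
  then have "x = h a \<otimes>\<^bsub>H\<^esub> h b" using assms hom_mult[of a b] by (simp add: subset_eq)
  then show "x \<in> h ` A <#>\<^bsub>H\<^esub> h ` B" using H.set_multI[of "h a" "h ` A" "h b" "h ` B"] ab by simp
next
  fix x assume "x \<in> h ` A <#>\<^bsub>H\<^esub> h ` B"
  then obtain a b where ab: "a \<in> A" "b \<in> B" "x = h a \<otimes>\<^bsub>H\<^esub> h b" by (auto elim!: H.set_multE)
  then have "x = h (a \<otimes> b)" using assms hom_mult[of a b] by (simp add: subset_eq)
  then show "x \<in> h ` (A <#> B)" using G.set_multI[OF ab(1,2)] by blast
qed

text \<open>Take \<open>N\<close> maximal among the normal subgroups that avoid \<open>z\<close> and
  modulo which permutability would suffice. If it failed modulo \<open>N\<close>,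
  \<open>complement_step\<close> would yield a normal subgroup of order \<open>r \<noteq> q\<close>
  generated by a power of \<open>a\<close> or of \<open>b\<close>. Its preimage still avoids
  \<open>z\<close>, and its generator can be absorbed, against maximality.\<close>

lemma (in group) complement_full:
  assumes c: "a \<in> carrier G" "b \<in> carrier G" "z \<in> carrier G"
    and z: "z \<noteq> \<one>" "prime q" "z [^] (q::nat) = \<one>" "\<not> P q" "cyc G z \<lhd> G" "a \<otimes> z = z \<otimes> a"
    and P: "pelt G P a" "pelt G P b"
    and full: "carrier G = cyc G (z \<otimes> a) <#> cyc G b"
    and pz: "permz G z a b"
  shows "permutes_cyc G a b"
proof -
  have t: "torsion G a" "torsion G b" using pelt_torsion[OF P(1)] pelt_torsion[OF P(2)] by auto
  have "\<exists>N. N \<lhd> G \<and> (z \<notin> N \<and> (pmod G N a b \<longrightarrow> permutes_cyc G a b)) \<and>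
    (\<forall>M. M \<lhd> G \<longrightarrow> N \<subseteq> M \<longrightarrow> (z \<notin> M \<and> (pmod G M a b \<longrightarrow> permutes_cyc G a b)) \<longrightarrow> M = N)"
  proof (rule maximal_normal[of "\<lambda>N. z \<notin> N \<and> (pmod G N a b \<longrightarrow> permutes_cyc G a b)"])
    show "z \<notin> {\<one>} \<and> (pmod G {\<one>} a b \<longrightarrow> permutes_cyc G a b)" using z pmod_one c by blast
  next
    fix C :: "'a set set"
    assume C: "C \<noteq> {}" "\<And>N. N \<in> C \<Longrightarrow> N \<lhd> G \<and> (z \<notin> N \<and> (pmod G N a b \<longrightarrow> permutes_cyc G a b))"
      "\<And>M N. M \<in> C \<Longrightarrow> N \<in> C \<Longrightarrow> M \<subseteq> N \<or> N \<subseteq> M"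
    show "z \<notin> \<Union>C \<and> (pmod G (\<Union>C) a b \<longrightarrow> permutes_cyc G a b)"
    proof (intro conjI impI)
      show "z \<notin> \<Union>C" using C(2) by blast
      assume "pmod G (\<Union>C) a b"
      then obtain N where "N \<in> C" "pmod G N a b" using pmod_chain[OF C(1,3) c(1,2) t] by metis
      then show "permutes_cyc G a b" using C(2) by blast
    qed
  next
    fix N assume "N \<lhd> G" "z \<notin> N \<and> (pmod G N a b \<longrightarrow> permutes_cyc G a b)"
      "\<And>M. M \<lhd> G \<Longrightarrow> N \<subseteq> M \<Longrightarrow> z \<notin> M \<and> (pmod G M a b \<longrightarrow> permutes_cyc G a b) \<Longrightarrow> M = N"
    then show "\<exists>N. N \<lhd> G \<and> (z \<notin> N \<and> (pmod G N a b \<longrightarrow> permutes_cyc G a b)) \<and>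
      (\<forall>M. M \<lhd> G \<longrightarrow> N \<subseteq> M \<longrightarrow> (z \<notin> M \<and> (pmod G M a b \<longrightarrow> permutes_cyc G a b)) \<longrightarrow> M = N)" by blast
  qed
  then obtain N where N: "N \<lhd> G" "z \<notin> N" "pmod G N a b \<Longrightarrow> permutes_cyc G a b"
    "\<And>M. M \<lhd> G \<Longrightarrow> N \<subseteq> M \<Longrightarrow> z \<notin> M \<Longrightarrow> (pmod G M a b \<Longrightarrow> permutes_cyc G a b) \<Longrightarrow> M = N" by blast
  let ?H = "G Mod N"
  let ?f = "\<lambda>x. N #> x"
  interpret h: group_hom G ?H ?f using quotient_hom[OF N(1)] .
  have hc: "?f a \<in> carrier ?H" "?f b \<in> carrier ?H" "?f z \<in> carrier ?H" using c h.hom_closed by blast+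
  have surj: "?f ` carrier G = carrier ?H" by (simp add: carrier_FactGroup)
  have fz1: "?f z \<noteq> \<one>\<^bsub>?H\<^esub>" using quotient_one[OF N(1) c(3)] N(2) by blast
  have fzq: "?f z [^]\<^bsub>?H\<^esub> q = \<one>\<^bsub>?H\<^esub>" using h.hom_nat_pow[OF c(3), of q] z(3) h.hom_one by metis
  have fzn: "cyc ?H (?f z) \<lhd> ?H"
    using normal.surj_hom_normal_subgroup[OF z(5) quotient_hom[OF N(1)] surj] h.cyc_image[OF c(3)] by simp
  have com: "?f a \<otimes>\<^bsub>?H\<^esub> ?f z = ?f z \<otimes>\<^bsub>?H\<^esub> ?f a"
    using h.hom_mult[OF c(1,3)] h.hom_mult[OF c(3,1)] z(6) by metis
  have fza: "?f (z \<otimes> a) = ?f z \<otimes>\<^bsub>?H\<^esub> ?f a" using h.hom_mult[OF c(3,1)] .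
  have zac: "z \<otimes> a \<in> carrier G" using c by simp
  have fullH: "carrier ?H = cyc ?H (?f z \<otimes>\<^bsub>?H\<^esub> ?f a) <#>\<^bsub>?H\<^esub> cyc ?H (?f b)"
  proof -
    have "cyc G (z \<otimes> a) \<subseteq> carrier G" "cyc G b \<subseteq> carrier G" using cyc_closed zac c by blast+
    then have "?f ` (cyc G (z \<otimes> a) <#> cyc G b) = cyc ?H (?f (z \<otimes> a)) <#>\<^bsub>?H\<^esub> cyc ?H (?f b)"
      using h.set_mult_image h.cyc_image[OF zac] h.cyc_image[OF c(2)] by simp
    then show ?thesis using surj fza full by metis
  qed
  have "permutes_cyc ?H (?f a) (?f b)"
  proof (rule ccontr)
    assume np: "\<not> ?thesis"
    obtain w r where w: "w \<in> cyc ?H (?f a) \<or> w \<in> cyc ?H (?f b)" "prime (r::nat)" "w \<noteq> \<one>\<^bsub>?H\<^esub>"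
      "w [^]\<^bsub>?H\<^esub> r = \<one>\<^bsub>?H\<^esub>" "r \<noteq> q" "cyc ?H w \<lhd> ?H"
      using h.H.complement_step[OF hc fz1 z(2) fzq z(4) fzn com h.pelt_image[OF c(1) P(1)]
          h.pelt_image[OF c(2) P(2)] fullH h.permz_image[OF c pz]] np by blast
    obtain x where x: "x \<in> carrier G" "w = ?f x"
      using w(1) h.H.cyc_closed hc surj by blast
    have xN: "x \<notin> N" using quotient_one[OF N(1) x(1)] w(3) x(2) by blast
    obtain M where M: "M \<lhd> G" "N \<subseteq> M" "M \<noteq> N" "\<And>y. y \<in> carrier G \<Longrightarrow> y \<in> M \<longleftrightarrow> ?f y \<in> cyc ?H (?f x)"
      using normal_lift[OF N(1) x(1) xN] w(6) x(2) by metis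
    have "z \<notin> M"
    proof
      assume "z \<in> M"
      then have "?f z \<in> cyc ?H w" using M(4) c x by blast
      then obtain i where i: "?f z = w [^]\<^bsub>?H\<^esub> (i::nat)" using cycE by metis
      have wH: "w \<in> carrier ?H" using x h.hom_closed by blast
      have "?f z [^]\<^bsub>?H\<^esub> r = (w [^]\<^bsub>?H\<^esub> r) [^]\<^bsub>?H\<^esub> i"
        unfolding i using h.H.nat_pow_pow[OF wH] by (metis mult.commute)
      then have "?f z [^]\<^bsub>?H\<^esub> r = \<one>\<^bsub>?H\<^esub>" using w(4) h.H.nat_pow_one by metis
      then show False
        using h.H.prime_pow_one[OF hc(3) _ fzq] primes_coprime[OF w(2) z(2) w(5)] fz1 by blast
    qed
    moreover have "permutes_cyc G a b" if pM: "pmod G M a b"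
    proof -
      have "permz ?H w (?f a) (?f b)"
        using pmod_lift[OF N(1) M(4) normal_carrier[OF M(1)] c(1,2) pM] x(2) by blast
      then have "permutes_cyc ?H (?f a) (?f b)"
        using w(1) h.H.permz_absorb_left[OF hc(1,2)] h.H.permz_absorb_right[OF hc(1,2) _ w(6)] by blast
      then show ?thesis using np by blast
    qed
    ultimately show False using N(4)[OF M(1,2)] M(3) by blast
  qed
  then have "pmod G N a b" using pmod_quotient[OF N(1) c(1,2)] by blast
  then show ?thesis by (rule N(3))
qed

lemma (in group) subgroups_commute:
  assumes A: "subgroup A G" and B: "subgroup B G" and le: "\<And>a b. a \<in> A \<Longrightarrow> b \<in> B \<Longrightarrow> b \<otimes> a \<in> A <#> B"
  shows "A <#> B = B <#> A"
proof (intro subset_antisym subsetI)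
  fix x assume "x \<in> B <#> A"
  then show "x \<in> A <#> B" using le by (auto elim!: set_multE)
next
  fix x assume "x \<in> A <#> B"
  then obtain a b where ab: "a \<in> A" "b \<in> B" "x = a \<otimes> b" by (rule set_multE)
  have c: "a \<in> carrier G" "b \<in> carrier G" using ab A B subgroup.mem_carrier by metis+
  obtain a' b' where ab': "a' \<in> A" "b' \<in> B" "inv b \<otimes> inv a = a' \<otimes> b'"
    using le[OF subgroup.m_inv_closed[OF A ab(1)] subgroup.m_inv_closed[OF B ab(2)]] by (rule set_multE)
  have c': "a' \<in> carrier G" "b' \<in> carrier G" using ab' A B subgroup.mem_carrier by metis+
  have "x = inv (inv b \<otimes> inv a)" using ab c by (simp add: inv_mult_group)
  also have "\<dots> = inv b' \<otimes> inv a'" unfolding ab'(3) using c' by (simp add: inv_mult_group)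
  finally show "x \<in> B <#> A"
    using set_multI[OF subgroup.m_inv_closed[OF B ab'(2)] subgroup.m_inv_closed[OF A ab'(1)]] by simp
qed

text \<open>The product of \<open>cyc G (z \<otimes> a)\<close> and \<open>cyc G b\<close> is a
  subgroup, because \<open>cyc G z\<close> is normal and \<open>a\<close>, \<open>b\<close> permute
  modulo it. Inside this subgroup \<open>complement_full\<close> applies.\<close>

lemma (in group) complement:
  assumes c: "a \<in> carrier G" "b \<in> carrier G" "z \<in> carrier G"
    and z: "z \<noteq> \<one>" "prime q" "z [^] (q::nat) = \<one>" "\<not> P q" "cyc G z \<lhd> G" "a \<otimes> z = z \<otimes> a"
    and P: "pelt G P a" "pelt G P b" and pz: "permz G z a b"
  shows "permutes_cyc G a b"
proof -
  let ?A = "cyc G (z \<otimes> a)" and ?B = "cyc G b"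
  let ?L = "?A <#> ?B"
  let ?G = "G\<lparr>carrier := ?L\<rparr>"
  have zac: "z \<otimes> a \<in> carrier G" using c by simp
  obtain n where n: "n > 0" "a [^] (n::nat) = \<one>" "\<And>q. prime q \<Longrightarrow> q dvd n \<Longrightarrow> P q"
    using peltE[OF P(1)] by metis
  have "coprime n q" by (rule coprime_of_primes[of n P]) (use n z primes_dvd_imp_eq in auto)
  then have za: "z \<in> ?A" "a \<in> ?A"
    using coprime_product[of z a q n] c z n(2) coprime_commute by metis+
  have "torsion G z" using z prime_gt_0_nat by (auto simp: torsion_def)
  then have zat: "torsion G (z \<otimes> a)"
    using pelt_torsion[OF pelt_mult[OF c(3,1) z(6)[symmetric], of "\<lambda>_. True"]]
      torsion_pelt pelt_torsion[OF P(1)] by blast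
  have sA: "subgroup ?A G" and sB: "subgroup ?B G"
    using cyc_subgroup zac zat c pelt_torsion[OF P(2)] by blast+
  have "y \<otimes> x \<in> ?L" if "x \<in> ?A" "y \<in> ?B" for x y
  proof -
    obtain i where i: "y = b [^] (i::nat)" using \<open>y \<in> ?B\<close> by (rule cycE)
    obtain j where j: "x = (z \<otimes> a) [^] (j::nat)" using \<open>x \<in> ?A\<close> by (rule cycE)
    note ij = i j
    obtain k l s :: nat where e: "b [^] i \<otimes> a [^] j = z [^] s \<otimes> (a [^] k \<otimes> b [^] l)" using permzD[OF pz] .
    obtain h where h: "h \<in> cyc G z" "b [^] i \<otimes> z [^] j = h \<otimes> b [^] i"
      using normal_swap'[OF z(5) pow_in_cyc nat_pow_closed[OF c(2)]] by metis
    have hA: "h \<in> ?A" using h cyc_trans[OF zac za(1)] by blast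
    have hc: "h \<in> carrier G" using h cyc_closed c by blast
    have "y \<otimes> x = b [^] i \<otimes> z [^] j \<otimes> a [^] j"
      using ij pow_mult_distrib[OF z(6)[symmetric] c(3,1)] c by (simp add: m_assoc)
    also have "\<dots> = h \<otimes> (b [^] i \<otimes> a [^] j)" unfolding h(2) using hc c by (simp add: m_assoc)
    also have "\<dots> = (h \<otimes> (z [^] s \<otimes> a [^] k)) \<otimes> b [^] l" unfolding e using hc c by (simp add: m_assoc)
    finally show ?thesis
      using set_multI[OF _ pow_in_cyc[of G b l]] hA subgroup.m_closed[OF sA] subgroup_pow[OF sA] za by metis
  qed
  then have "?A <#> ?B = ?B <#> ?A" using subgroups_commute[OF sA sB] by blast
  then have sL: "subgroup ?L G" using subgroup_set_mult_commute[OF sA sB] by blast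
  have zL: "z \<otimes> \<one> \<in> ?L" "a \<otimes> \<one> \<in> ?L" "\<one> \<otimes> b \<in> ?L"
    using set_multI za one_in_cyc cyc_self[OF c(2)] by metis+
  interpret L: group ?G using subgroup.subgroup_is_group[OF sL is_group] .
  have zn: "cyc ?G z \<lhd> ?G"
    unfolding restricted_cyc
  proof (rule L.normal_invI)
    have "cyc G z \<subseteq> ?L" using subgroup_cyc[OF sL] zL c by simp
    then show "subgroup (cyc G z) ?G" using subgroup_incl[OF normal_imp_subgroup[OF z(5)] sL] by blast
    fix x h assume xh: "x \<in> carrier ?G" "h \<in> cyc G z"
    then have "x \<in> carrier G" using subgroup.mem_carrier[OF sL] by simp
    then have "x \<otimes> h \<otimes> inv x \<in> cyc G z" using normal_invE(2)[OF z(5)] xh by blast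
    then show "x \<otimes>\<^bsub>?G\<^esub> h \<otimes>\<^bsub>?G\<^esub> inv\<^bsub>?G\<^esub> x \<in> cyc G z"
      using m_inv_consistent[OF sL, of x] xh by simp
  qed
  have "permutes_cyc ?G a b"
  proof (rule L.complement_full[of a b z q P])
    show "a \<in> carrier ?G" "b \<in> carrier ?G" "z \<in> carrier ?G" using zL c by auto
    show "z [^]\<^bsub>?G\<^esub> q = \<one>\<^bsub>?G\<^esub>" using z(3) by (simp flip: nat_pow_consistent)
    show "pelt ?G P a" "pelt ?G P b" using P restricted_pelt by auto
    show "carrier ?G = cyc ?G (z \<otimes>\<^bsub>?G\<^esub> a) <#>\<^bsub>?G\<^esub> cyc ?G b"
      by (simp add: restricted_cyc set_mult_def)
    show "permz ?G z a b" using pz restricted_permz by blast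
  qed (use z zn in auto)
  then show ?thesis using restricted_permz[of ?L "\<one>" a b] by simp
qed

text \<open>\<open>w\<close> generates the product of \<open>cyc G a\<close> and
  \<open>cyc G z\<close>, so enlarging \<open>a\<close> to \<open>w\<close> absorbs the factor in
  \<open>z\<close>.\<close>

lemma (in group) permz_join:
  assumes c: "a \<in> carrier G" "b \<in> carrier G" "z \<in> carrier G" "w \<in> carrier G" "cyc G z \<lhd> G" "torsion G w"
    and w: "a \<in> cyc G w" "z \<in> cyc G w" "w = a [^] (u::nat) \<otimes> z [^] (v::nat)" and p: "permz G z a b"
  shows "permutes_cyc G w b"
proof (rule permutes_cycI[OF c(4,2)])
  fix i j :: nat
  have sW: "subgroup (cyc G w) G" using cyc_subgroup c by blast
  have az: "a \<otimes> z = z \<otimes> a" using cyc_commute[OF c(4) w(1,2)] .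
  have "a [^] u \<otimes> z [^] v = z [^] v \<otimes> a [^] u"
    using commute_pow[OF c(1) nat_pow_closed[OF c(3)]] commute_pow[OF c(3,1) az[symmetric]] by metis
  then have "w [^] j = a [^] (u * j) \<otimes> z [^] (v * j)"
    unfolding w(3) using pow_mult_distrib c by (simp add: nat_pow_pow)
  moreover obtain k l s :: nat where e: "b [^] i \<otimes> a [^] (u * j) = z [^] s \<otimes> (a [^] k \<otimes> b [^] l)"
    using permzD[OF p] .
  moreover obtain h where h: "h \<in> cyc G z" "b [^] l \<otimes> z [^] (v * j) = h \<otimes> b [^] l"
    using normal_swap'[OF c(5) pow_in_cyc nat_pow_closed[OF c(2)]] by metis
  moreover have hc: "h \<in> carrier G" using h cyc_closed c by blast
  ultimately have e': "b [^] i \<otimes> w [^] j = (z [^] s \<otimes> (a [^] k \<otimes> h)) \<otimes> b [^] l"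
  proof -
    have "b [^] i \<otimes> w [^] j = (b [^] i \<otimes> a [^] (u * j)) \<otimes> z [^] (v * j)"
      using c \<open>w [^] j = _\<close> by (simp add: m_assoc)
    also have "\<dots> = z [^] s \<otimes> (a [^] k \<otimes> (b [^] l \<otimes> z [^] (v * j)))"
      unfolding e using c by (simp add: m_assoc)
    finally show ?thesis unfolding h(2) using c hc by (simp add: m_assoc)
  qed
  have "h \<in> cyc G w" using h cyc_trans[OF c(4) w(2)] by blast
  then have "z [^] s \<otimes> (a [^] k \<otimes> h) \<in> cyc G w"
    using subgroup.m_closed[OF sW] subgroup_pow[OF sW] w(1,2) by blast
  then obtain t where "z [^] s \<otimes> (a [^] k \<otimes> h) = w [^] (t::nat)" by (rule cycE)
  then show "\<exists>(k::nat) (l::nat). b [^] i \<otimes> w [^] j = w [^] k \<otimes> b [^] l" using e' by metis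
qed

text \<open>In a step at a prime \<open>q\<close> with \<open>P q\<close>, the generator
  \<open>z\<close> is lifted to the part and joined to \<open>a\<close> or \<open>b\<close>; this is
  why larger \<open>a'\<close> and \<open>b'\<close> are allowed in the conclusion. If
  \<open>P q\<close> fails, \<open>complement\<close> removes \<open>z\<close>.\<close>

lemma (in full_product) part_permutes:
  assumes a: "a \<in> part G P A" and b: "b \<in> part G P B"
  shows "\<exists>a'\<in>part G P A. \<exists>b'\<in>part G P B. a \<in> cyc G a' \<and> b \<in> cyc G b' \<and> permutes_cyc G a' b'"
proof -
  define R where "R a b \<longleftrightarrow> (\<exists>a'\<in>part G P A. \<exists>b'\<in>part G P B. a \<in> cyc G a' \<and> b \<in> cyc G b' \<and> permutes_cyc G a' b')" for a b
  have pA: "plc G (part G P A)" "plc G (part G P B)" using part_plc plcA plcB by auto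
  have c: "a \<in> carrier G" "torsion G a" if "a \<in> part G P A \<union> part G P B" for a
    using that pA plc_closed plc_torsion by blast+
  have "\<forall>a\<in>part G P A. \<forall>b\<in>part G P B. pmod G (carrier G) a b \<longrightarrow> R a b"
  proof (rule climb_induct[where Q="\<lambda>N. \<forall>a\<in>part G P A. \<forall>b\<in>part G P B. pmod G N a b \<longrightarrow> R a b"])
    show "\<forall>a\<in>part G P A. \<forall>b\<in>part G P B. pmod G {\<one>} a b \<longrightarrow> R a b"
    proof (intro ballI impI)
      fix a b assume *: "a \<in> part G P A" "b \<in> part G P B" "pmod G {\<one>} a b"
      then have "permutes_cyc G a b" "a \<in> cyc G a" "b \<in> cyc G b" using pmod_one c cyc_self by auto
      then show "R a b" using * unfolding R_def by blast
    qed
  next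
    fix C :: "'a set set"
    assume C: "C \<noteq> {}" "\<And>N. N \<in> C \<Longrightarrow> N \<lhd> G \<and> (\<forall>a\<in>part G P A. \<forall>b\<in>part G P B. pmod G N a b \<longrightarrow> R a b)"
      "\<And>M N. M \<in> C \<Longrightarrow> N \<in> C \<Longrightarrow> M \<subseteq> N \<or> N \<subseteq> M"
    show "\<forall>a\<in>part G P A. \<forall>b\<in>part G P B. pmod G (\<Union>C) a b \<longrightarrow> R a b"
    proof (intro ballI impI)
      fix a b assume *: "a \<in> part G P A" "b \<in> part G P B" "pmod G (\<Union>C) a b"
      then obtain N where "N \<in> C" "pmod G N a b" using pmod_chain[OF C(1,3)] c by (metis UnI1 UnI2)
      then show "R a b" using C(2) * by blast
    qed
  next
    fix N M z q
    assume N: "N \<lhd> G" and IH: "\<forall>a\<in>part G P A. \<forall>b\<in>part G P B. pmod G N a b \<longrightarrow> R a b"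
      and z: "z \<in> A \<union> B" "prime (q::nat)" "z \<notin> N"
      "(N #> z) [^]\<^bsub>G Mod N\<^esub> q = \<one>\<^bsub>G Mod N\<^esub>" "cyc (G Mod N) (N #> z) \<lhd> G Mod N"
      and M: "M \<lhd> G" "\<And>x. x \<in> carrier G \<Longrightarrow> x \<in> M \<longleftrightarrow> N #> x \<in> cyc (G Mod N) (N #> z)"
    let ?H = "G Mod N"
    let ?f = "\<lambda>x. N #> x"
    interpret h: group_hom G ?H ?f using quotient_hom[OF N] .
    interpret Q: full_product ?H "?f ` A" "?f ` B" using quotient_full[OF N] .
    have zc: "z \<in> carrier G" using z(1) by auto
    have fzc: "?f z \<in> carrier ?H" using h.hom_closed[OF zc] .
    have zt: "torsion ?H (?f z)" unfolding torsion_def using z(4) prime_gt_0_nat[OF z(2)] by blast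
    have z1: "?f z \<noteq> \<one>\<^bsub>?H\<^esub>" using quotient_one[OF N zc] z(3) by blast
    show "\<forall>a\<in>part G P A. \<forall>b\<in>part G P B. pmod G M a b \<longrightarrow> R a b"
    proof (intro ballI impI)
      fix a b assume a: "a \<in> part G P A" and b: "b \<in> part G P B" and pM: "pmod G M a b"
      have ac: "a \<in> carrier G" "torsion G a" and bc: "b \<in> carrier G" "torsion G b" using c a b by auto
      have aA: "a \<in> A" "pelt G P a" and bB: "b \<in> B" "pelt G P b" using a b by (auto simp: part_def)
      have fac: "?f a \<in> carrier ?H" "torsion ?H (?f a)" and fbc: "?f b \<in> carrier ?H" "torsion ?H (?f b)"
        using ac bc h.hom_closed h.torsion_image by blast+
      have pz: "permz ?H (?f z) (?f a) (?f b)"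
        using pmod_lift[OF N M(2) normal_carrier[OF M(1)] ac(1) bc(1) pM] .
      have pz': "permz ?H (?f z) (?f b) (?f a)"
        using h.H.permz_sym[OF fac(1) fbc(1) fzc z(5) fac(2) fbc(2) zt pz] .
      show "R a b"
      proof (cases "P q")
        case True
        have pe: "pelt ?H P (?f z)"
          by (rule peltI[OF prime_gt_0_nat[OF z(2)] z(4)]) (use True primes_dvd_imp_eq z(2) in blast)
        show ?thesis
        proof (cases "z \<in> A")
          case zA: True
          obtain y where y: "y \<in> part G P A" "?f y = ?f z" using h.part_lift[OF plcA zA pe] by metis
          obtain w u v where w: "w \<in> part G P A" "a \<in> cyc G w" "y \<in> cyc G w" "w = a [^] (u::nat) \<otimes> y [^] (v::nat)"
            using plc_join[OF pA(1) a y(1)] by metis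
          have wc: "w \<in> carrier G" "torsion G w" using w c by auto
          have yc: "y \<in> carrier G" using y c by blast
          have 1: "?f a \<in> cyc ?H (?f w)" "?f z \<in> cyc ?H (?f w)"
            using h.cyc_image[OF wc(1)] w(2,3) y(2) by blast+
          have 2: "?f w = ?f a [^]\<^bsub>?H\<^esub> u \<otimes>\<^bsub>?H\<^esub> ?f z [^]\<^bsub>?H\<^esub> v"
            unfolding w(4) h.hom_mult[OF nat_pow_closed[OF ac(1)] nat_pow_closed[OF yc]]
              h.hom_nat_pow[OF ac(1)] h.hom_nat_pow[OF yc] y(2) ..
          have "permutes_cyc ?H (?f w) (?f b)"
            using h.H.permz_join[OF fac(1) fbc(1) fzc h.hom_closed[OF wc(1)] z(5) h.torsion_image[OF wc] 1 2 pz] .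
          then have "pmod G N w b" using pmod_quotient[OF N wc(1) bc(1)] by blast
          then have "R w b" using IH w(1) b by blast
          then obtain a' b' where ab': "a' \<in> part G P A" "b' \<in> part G P B" "w \<in> cyc G a'" "b \<in> cyc G b'" "permutes_cyc G a' b'"
            unfolding R_def by blast
          have "a \<in> cyc G a'" using cyc_trans[of a' w] c[of a'] ab' w(2) by blast
          then show ?thesis unfolding R_def using ab' by blast
        next
          case False
          then have zB: "z \<in> B" using z(1) by blast
          obtain y where y: "y \<in> part G P B" "?f y = ?f z" using h.part_lift[OF plcB zB pe] by metis
          obtain w u v where w: "w \<in> part G P B" "b \<in> cyc G w" "y \<in> cyc G w" "w = b [^] (u::nat) \<otimes> y [^] (v::nat)"
            using plc_join[OF pA(2) b y(1)] by metis
          have wc: "w \<in> carrier G" "torsion G w" using w c by auto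
          have yc: "y \<in> carrier G" using y c by blast
          have 1: "?f b \<in> cyc ?H (?f w)" "?f z \<in> cyc ?H (?f w)"
            using h.cyc_image[OF wc(1)] w(2,3) y(2) by blast+
          have 2: "?f w = ?f b [^]\<^bsub>?H\<^esub> u \<otimes>\<^bsub>?H\<^esub> ?f z [^]\<^bsub>?H\<^esub> v"
            unfolding w(4) h.hom_mult[OF nat_pow_closed[OF bc(1)] nat_pow_closed[OF yc]]
              h.hom_nat_pow[OF bc(1)] h.hom_nat_pow[OF yc] y(2) ..
          have "permutes_cyc ?H (?f w) (?f a)"
            using h.H.permz_join[OF fbc(1) fac(1) fzc h.hom_closed[OF wc(1)] z(5) h.torsion_image[OF wc] 1 2 pz'] .
          then have "permutes_cyc ?H (?f a) (?f w)"
            using h.H.permutes_cyc_sym[OF h.hom_closed[OF wc(1)] fac(1) h.torsion_image[OF wc] fac(2)] by blast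
          then have "pmod G N a w" using pmod_quotient[OF N ac(1) wc(1)] by blast
          then have "R a w" using IH w(1) a by blast
          then obtain a' b' where ab': "a' \<in> part G P A" "b' \<in> part G P B" "a \<in> cyc G a'" "w \<in> cyc G b'" "permutes_cyc G a' b'"
            unfolding R_def by blast
          have "b \<in> cyc G b'" using cyc_trans[of b' w] c[of b'] ab' w(2) by blast
          then show ?thesis unfolding R_def using ab' by blast
        qed
      next
        case False
        have pe: "pelt ?H P (?f a)" "pelt ?H P (?f b)" using h.pelt_image ac bc aA bB by blast+
        have "permutes_cyc ?H (?f a) (?f b)"
        proof (cases "z \<in> A")
          case True
          have "?f a \<otimes>\<^bsub>?H\<^esub> ?f z = ?f z \<otimes>\<^bsub>?H\<^esub> ?f a" using Q.A_comm[of "?f a" "?f z"] True aA by blast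
          then show ?thesis using h.H.complement[OF fac(1) fbc(1) fzc z1 z(2,4) False z(5) _ pe pz] by blast
        next
          case zA: False
          then have zB: "z \<in> B" using z(1) by blast
          have "?f b \<otimes>\<^bsub>?H\<^esub> ?f z = ?f z \<otimes>\<^bsub>?H\<^esub> ?f b" using Q.B_comm[of "?f b" "?f z"] zB bB by blast
          then have "permutes_cyc ?H (?f b) (?f a)"
            using h.H.complement[OF fbc(1) fac(1) fzc z1 z(2,4) False z(5) _ pe(2,1) pz'] by blast
          then show ?thesis using h.H.permutes_cyc_sym[OF fbc(1) fac(1) fbc(2) fac(2)] by blast
        qed
        then have "pmod G N a b" using pmod_quotient[OF N ac(1) bc(1)] by blast
        then show ?thesis using IH a b by blast
      qed
    qed
  qed
  then have "R a b" using a b c pmod_carrier by (metis UnI1 UnI2)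
  then show ?thesis unfolding R_def .
qed

lemma (in two_factors) part_two_factors: "two_factors G (part G P A) (part G P B)"
proof (rule two_factorsI)
  interpret F: full_product "G\<lparr>carrier := A <#> B\<rparr>" A B using restrict_full .
  show pA: "plc G (part G P A)" "plc G (part G P B)" using part_plc plcA plcB by auto
  fix a b assume ab: "a \<in> part G P A" "b \<in> part G P B"
  have "part (G\<lparr>carrier := A <#> B\<rparr>) P S = part G P S" for S by (simp add: part_def restricted_pelt)
  then obtain a' b' where ab': "a' \<in> part G P A" "b' \<in> part G P B" "a \<in> cyc G a'" "b \<in> cyc G b'" "permutes_cyc G a' b'"
    using F.part_permutes[of a P b] ab restricted_cyc restricted_permz[of "A <#> B" "\<one>"] by auto
  obtain i where i: "b = b' [^] (i::nat)" using ab'(4) by (rule cycE)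
  obtain j where j: "a = a' [^] (j::nat)" using ab'(3) by (rule cycE)
  have c: "a' \<in> carrier G" "b' \<in> carrier G" using ab' pA plc_closed by blast+
  obtain k l :: nat where "b' [^] i \<otimes> a' [^] j = a' [^] k \<otimes> b' [^] l" using permutes_cycD[OF c ab'(5)] .
  then show "b \<otimes> a \<in> part G P A <#> part G P B"
    unfolding i j using set_multI subgroup_pow[OF part_subgroup] plcA plcB ab'(1,2) by metis
qed

section \<open>Primes in a product of two factors, and the elements belonging to the largest
  one\<close>

lemma (in two_factors) product_elements_pelt:
  assumes P: "\<And>x. x \<in> A \<union> B \<Longrightarrow> pelt G P x" and x: "x \<in> A <#> B"
  shows "pelt G P x"
proof -
  interpret F: full_product "G\<lparr>carrier := A <#> B\<rparr>" A B using restrict_full .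
  show ?thesis using F.product_pelt[of P x] P x by (simp add: restricted_pelt)
qed

lemma (in two_factors) p_groups_permute:
  assumes p: "\<And>x. x \<in> A \<union> B \<Longrightarrow> pelt G (\<lambda>r. r = p) x" and ab: "a \<in> A" "b \<in> B"
  shows "permutes_cyc G a b"
proof -
  interpret F: full_product "G\<lparr>carrier := A <#> B\<rparr>" A B using restrict_full .
  have "permutes_cyc (G\<lparr>carrier := A <#> B\<rparr>) a b"
    by (rule F.permutes_p_elements[of p]) (use p ab restricted_pelt in auto)
  then show ?thesis using restricted_permz[of "A <#> B" "\<one>"] by simp
qed

text \<open>The climb carries: if \<open>x\<close> lies in \<open>N\<close> times \<open>?S\<close>,
  it lies in \<open>?S\<close>. For \<open>q = p\<close> the generator lifts to the parts. For
  \<open>q < p\<close> the \<open>p\<close>-element \<open>s\<close> centralises \<open>z\<close>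
  modulo \<open>N\<close>; there \<open>z [^] i\<close> is then a quotient of two commuting
  \<open>p\<close>-elements and has exponent \<open>q\<close>, so it vanishes.\<close>

lemma (in full_product) p_element_in_parts:
  assumes p: "prime p" "\<And>x. x \<in> A \<union> B \<Longrightarrow> pelt G (\<lambda>r. r \<le> p) x"
    and x: "x \<in> carrier G" "pelt G (\<lambda>r. r = p) x"
  shows "x \<in> part G (\<lambda>r. r = p) A <#> part G (\<lambda>r. r = p) B"
proof -
  let ?S = "part G (\<lambda>r. r = p) A <#> part G (\<lambda>r. r = p) B"
  interpret S: two_factors G "part G (\<lambda>r. r = p) A" "part G (\<lambda>r. r = p) B" using part_two_factors .
  have Sp: "pelt G (\<lambda>r. r = p) s" if "s \<in> ?S" for s
    by (rule S.product_elements_pelt[OF _ that]) (auto simp: part_def)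
  have Sc: "s \<in> carrier G" if "s \<in> ?S" for s using subgroup.mem_carrier[OF S.AB_subgroup that] .
  have "(\<exists>n\<in>carrier G. \<exists>s\<in>?S. x = n \<otimes> s) \<longrightarrow> x \<in> ?S"
  proof (rule climb_induct[where Q="\<lambda>N. (\<exists>n\<in>N. \<exists>s\<in>?S. x = n \<otimes> s) \<longrightarrow> x \<in> ?S"])
    show "(\<exists>n\<in>{\<one>}. \<exists>s\<in>?S. x = n \<otimes> s) \<longrightarrow> x \<in> ?S" using Sc by auto
  next
    fix C :: "'a set set"
    assume "\<And>N. N \<in> C \<Longrightarrow> N \<lhd> G \<and> ((\<exists>n\<in>N. \<exists>s\<in>?S. x = n \<otimes> s) \<longrightarrow> x \<in> ?S)"
    then show "(\<exists>n\<in>\<Union>C. \<exists>s\<in>?S. x = n \<otimes> s) \<longrightarrow> x \<in> ?S" by blast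
  next
    fix N M z q
    assume N: "N \<lhd> G" and IH: "(\<exists>n\<in>N. \<exists>s\<in>?S. x = n \<otimes> s) \<longrightarrow> x \<in> ?S"
      and z: "z \<in> A \<union> B" "prime (q::nat)" "z \<notin> N"
      "(N #> z) [^]\<^bsub>G Mod N\<^esub> q = \<one>\<^bsub>G Mod N\<^esub>" "cyc (G Mod N) (N #> z) \<lhd> G Mod N"
      and M: "M \<lhd> G" "\<And>x. x \<in> carrier G \<Longrightarrow> x \<in> M \<longleftrightarrow> N #> x \<in> cyc (G Mod N) (N #> z)"
    let ?H = "G Mod N"
    let ?f = "\<lambda>x. N #> x"
    interpret h: group_hom G ?H ?f using quotient_hom[OF N] .
    have zc: "z \<in> carrier G" using z(1) by auto
    have fzc: "?f z \<in> carrier ?H" using h.hom_closed[OF zc] .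
    have z1: "?f z \<noteq> \<one>\<^bsub>?H\<^esub>" using quotient_one[OF N zc] z(3) by blast
    have qp: "q \<le> p"
      using h.H.pelt_prime_coprime[OF fzc h.pelt_image[OF zc p(2)[OF z(1)]] z(4,2)] z1 by blast
    show "(\<exists>n\<in>M. \<exists>s\<in>?S. x = n \<otimes> s) \<longrightarrow> x \<in> ?S"
    proof
      assume "\<exists>n\<in>M. \<exists>s\<in>?S. x = n \<otimes> s"
      then obtain m s where ms: "m \<in> M" "s \<in> ?S" "x = m \<otimes> s" by blast
      have mc: "m \<in> carrier G" using ms normal_carrier[OF M(1)] by blast
      have sc: "s \<in> carrier G" using ms Sc by blast
      obtain i where i: "?f m = ?f z [^]\<^bsub>?H\<^esub> (i::nat)" using ms(1) M(2)[OF mc] cycE by metis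
      have fx: "?f x = ?f z [^]\<^bsub>?H\<^esub> i \<otimes>\<^bsub>?H\<^esub> ?f s"
        unfolding ms(3) h.hom_mult[OF mc sc] i ..
      have "\<exists>s'\<in>?S. ?f x = ?f s'"
      proof (cases "q = p")
        case True
        have pe: "pelt ?H (\<lambda>r. r = p) (?f z)"
          by (rule peltI[OF prime_gt_0_nat[OF z(2)] z(4)]) (use True primes_dvd_imp_eq z(2) in blast)
        obtain y where y: "y \<in> part G (\<lambda>r. r = p) A \<or> y \<in> part G (\<lambda>r. r = p) B" "?f y = ?f z"
          using h.part_lift[OF plcA _ pe] h.part_lift[OF plcB _ pe] z(1) by (metis UnE)
        have yS: "y \<in> ?S" using y S.AB_incl by blast
        have "?f x = ?f (y [^] i \<otimes> s)"
          unfolding fx h.hom_mult[OF nat_pow_closed[OF Sc[OF yS]] sc] h.hom_nat_pow[OF Sc[OF yS]] y(2) ..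
        moreover have "y [^] i \<otimes> s \<in> ?S"
          using subgroup.m_closed[OF S.AB_subgroup subgroup_pow[OF S.AB_subgroup yS] ms(2)] .
        ultimately show ?thesis by blast
      next
        case False
        have fsc: "?f s \<in> carrier ?H" "pelt ?H (\<lambda>r. r = p) (?f s)"
          using h.hom_closed[OF sc] h.pelt_image[OF sc Sp[OF ms(2)]] by auto
        have "?f s \<otimes>\<^bsub>?H\<^esub> ?f z \<otimes>\<^bsub>?H\<^esub> inv\<^bsub>?H\<^esub> ?f s \<in> cyc ?H (?f z)"
          using h.H.normal_invE(2)[OF z(5) fsc(1) h.H.cyc_self[OF fzc]] .
        then have com: "?f s \<otimes>\<^bsub>?H\<^esub> ?f z = ?f z \<otimes>\<^bsub>?H\<^esub> ?f s"
          using h.H.large_prime_centralises[OF fzc z(4,2) fsc(1) _ fsc(2) p(1) qp] by blast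
        let ?y = "?f z [^]\<^bsub>?H\<^esub> i"
        have yc: "?y \<in> carrier ?H" using fzc by (rule h.H.nat_pow_closed)
        have ys: "?y \<otimes>\<^bsub>?H\<^esub> ?f s = ?f s \<otimes>\<^bsub>?H\<^esub> ?y"
          using h.H.commute_pow[OF fzc fsc(1) com[symmetric]] .
        have fxc: "?f x \<in> carrier ?H" "pelt ?H (\<lambda>r. r = p) (?f x)"
          using h.hom_closed[OF x(1)] h.pelt_image[OF x] by auto
        obtain m1 where m1: "m1 > 0" "?f s [^]\<^bsub>?H\<^esub> (m1::nat) = \<one>\<^bsub>?H\<^esub>" "\<And>r. prime r \<Longrightarrow> r dvd m1 \<Longrightarrow> r = p"
          using peltE[OF fsc(2)] by metis
        obtain m2 where m2: "m2 > 0" "?f x [^]\<^bsub>?H\<^esub> (m2::nat) = \<one>\<^bsub>?H\<^esub>" "\<And>r. prime r \<Longrightarrow> r dvd m2 \<Longrightarrow> r = p"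
          using peltE[OF fxc(2)] by metis
        have 1: "?f s [^]\<^bsub>?H\<^esub> (m1 * m2) = \<one>\<^bsub>?H\<^esub>"
          using m1(2) h.H.nat_pow_pow[OF fsc(1), of m1 m2] h.H.nat_pow_one by metis
        have 2: "?f x [^]\<^bsub>?H\<^esub> (m1 * m2) = \<one>\<^bsub>?H\<^esub>"
          using m2(2) h.H.nat_pow_pow[OF fxc(1), of m2 m1] h.H.nat_pow_one mult.commute by metis
        have "?y [^]\<^bsub>?H\<^esub> (m1 * m2) = \<one>\<^bsub>?H\<^esub>"
          using 2 h.H.pow_mult_distrib[OF ys yc fsc(1), of "m1 * m2"] h.H.r_one[OF h.H.nat_pow_closed[OF yc]]
          unfolding fx 1 by metis
        moreover have "?y [^]\<^bsub>?H\<^esub> q = \<one>\<^bsub>?H\<^esub>"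
          using z(4) h.H.nat_pow_pow[OF fzc] h.H.nat_pow_one mult.commute by metis
        moreover have "coprime (m1 * m2) q"
        proof (rule coprime_of_primes[of _ "\<lambda>r. r = p"])
          show "m1 * m2 > 0" using m1(1) m2(1) by simp
          show "r = p" if "prime r" "r dvd m1 * m2" for r
            using prime_dvd_multD[OF that] m1(3)[OF that(1)] m2(3)[OF that(1)] by blast
          show "r \<noteq> p" if "prime r" "r dvd q" for r
            using primes_dvd_imp_eq[OF that(1) z(2) that(2)] False by blast
        qed
        ultimately have "?y = \<one>\<^bsub>?H\<^esub>" using h.H.prime_pow_one[OF yc] by blast
        then have "?f x = ?f s" using fx h.H.l_one[OF fsc(1)] by metis
        then show ?thesis using ms(2) by blast
      qed
      then obtain s' where s': "s' \<in> ?S" "?f x = ?f s'" by blast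
      then obtain n where "n \<in> N" "x = n \<otimes> s'" using quotient_eq[OF N x(1) Sc[OF s'(1)]] by blast
      then show "x \<in> ?S" using IH s'(1) by blast
    qed
  qed
  moreover have "x = x \<otimes> \<one>" "\<one> \<in> ?S" using x subgroup.one_closed[OF S.AB_subgroup] by auto
  ultimately show ?thesis using x(1) by blast
qed

lemma (in two_factors) large_prime_part:
  assumes p: "prime p" "\<And>x. x \<in> A \<union> B \<Longrightarrow> pelt G (\<lambda>r. r \<le> p) x"
    and x: "x \<in> A <#> B" "pelt G (\<lambda>r. r = p) x"
  shows "x \<in> part G (\<lambda>r. r = p) A <#> part G (\<lambda>r. r = p) B"
proof -
  interpret F: full_product "G\<lparr>carrier := A <#> B\<rparr>" A B using restrict_full .
  have "part (G\<lparr>carrier := A <#> B\<rparr>) (\<lambda>r. r = p) S = part G (\<lambda>r. r = p) S" for S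
    by (simp add: part_def restricted_pelt)
  then show ?thesis using F.p_element_in_parts[OF p(1), of x] p(2) x
    by (simp add: restricted_pelt set_mult_def)
qed

subsection \<open>The largest prime\<close>

lemma prime_power_of_primes:
  assumes "n > 0" "\<And>q. prime q \<Longrightarrow> q dvd n \<Longrightarrow> q = (p::nat)" shows "\<exists>k. n = p ^ k"
  using assms
proof (induction n rule: less_induct)
  case (less n)
  show ?case
  proof (cases "n = 1")
    case True then show ?thesis by (intro exI[of _ 0]) simp
  next
    case False
    then obtain q where q: "prime q" "q dvd n" using prime_factor_nat by blast
    then obtain m where m: "n = p * m" using less.prems(2) by blast
    have "prime p" using q less.prems(2) by blast
    then have "m < n" "m > 0" using m less.prems(1) prime_gt_1_nat by auto
    moreover have "\<And>q. prime q \<Longrightarrow> q dvd m \<Longrightarrow> q = p" using less.prems(2) m by simp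
    ultimately obtain k where "m = p ^ k" using less.IH by blast
    then show ?thesis using m by (intro exI[of _ "Suc k"]) simp
  qed
qed

lemma (in group) ord_p_element:
  assumes "x \<in> carrier G" "pelt G (\<lambda>r. r = p) x" shows "\<exists>k. ord x = p ^ k"
proof -
  obtain n where n: "n > 0" "x [^] (n::nat) = \<one>" "\<And>q. prime q \<Longrightarrow> q dvd n \<Longrightarrow> q = p"
    using peltE[OF assms(2)] by metis
  have "ord x dvd n" using n(2) pow_eq_id assms by blast
  then have "ord x > 0" "\<And>q. prime q \<Longrightarrow> q dvd ord x \<Longrightarrow> q = p"
    using n by (auto intro: gr0I dvd_trans)
  then show ?thesis using prime_power_of_primes by blast
qed

lemma (in group) cyc_ord_range:
  assumes "x \<in> carrier G" "ord x > 0" shows "cyc G x = (\<lambda>k. x [^] k) ` {..<ord x}"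
proof -
  have "x [^] k = x [^] (k mod ord x)" for k :: nat
    using assms by (intro pow_cong[of x "ord x"]) auto
  then have "y \<in> (\<lambda>k. x [^] k) ` {..<ord x}" if y: "y \<in> cyc G x" for y
  proof -
    obtain k :: nat where "y = x [^] k" using y by (rule cycE)
    then have "y = x [^] (k mod ord x)" using \<open>\<And>k. x [^] k = x [^] (k mod ord x)\<close> by metis
    then show ?thesis using assms by auto
  qed
  then show ?thesis using pow_in_cyc[of G x] by blast
qed

lemma (in group) ord_pos: "x \<in> carrier G \<Longrightarrow> torsion G x \<Longrightarrow> ord x > 0"
  using ord_eq_0 unfolding torsion_def by (metis gr0I not_gr_zero)

text \<open>Induction carries the two-element condition in \<open>plc\<close> to finite
  sets.\<close>

lemma (in group) plc_finite_common:
  assumes "plc G A" "finite F" "F \<subseteq> A" obtains c where "c \<in> A" "F \<subseteq> cyc G c"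
proof -
  have "\<exists>c\<in>A. F \<subseteq> cyc G c" using assms(2,3)
  proof (induction F rule: finite_induct)
    case empty then show ?case using subgroup.one_closed[OF plc_subgroup[OF assms(1)]] by blast
  next
    case (insert x F)
    then obtain c where c: "c \<in> A" "F \<subseteq> cyc G c" by blast
    obtain d where d: "d \<in> A" "c \<in> cyc G d" "x \<in> cyc G d" using plc_gen[OF assms(1) c(1)] insert.prems by blast
    have "cyc G c \<subseteq> cyc G d" using cyc_trans[OF plc_closed[OF assms(1) d(1)] d(2)] .
    then show ?case using c d by blast
  qed
  then show ?thesis using that by blast
qed

lemma (in group) pow_diff_neq_one:
  assumes "x \<in> carrier G" "i < j" "j < ord x" shows "x [^] (j - i) \<noteq> \<one>"
proof
  assume "x [^] (j - i) = \<one>"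
  then have "ord x dvd j - i" using pow_eq_id assms by blast
  then have "ord x \<le> j - i" using dvd_imp_le assms(2) by simp
  then show False using assms by simp
qed

lemma (in group) pow_diff: "x \<in> carrier G \<Longrightarrow> i \<le> j \<Longrightarrow> x [^] (j - i) = x [^] j \<otimes> inv (x [^] (i::nat))"
  by (simp add: inv_solve_right nat_pow_mult)

context two_factors
begin

context
  fixes p :: nat
  assumes p: "prime p" and bound: "\<And>x. x \<in> A \<union> B \<Longrightarrow> pelt G (\<lambda>r. r \<le> p) x"
begin

abbreviation "PA \<equiv> part G (\<lambda>r. r = p) A"
abbreviation "PB \<equiv> part G (\<lambda>r. r = p) B"

lemma plc_PA: "plc G PA" and plc_PB: "plc G PB"
  using part_plc plcA plcB by auto

text \<open>Conjugation produces a \<open>p\<close>-element of \<open>A <#> B\<close> again, and for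
  the largest prime such elements lie in the product of the parts.\<close>

lemma conj_in_parts:
  assumes x: "x \<in> PA \<union> PB" and g: "g \<in> A \<union> B"
  shows "g \<otimes> x \<otimes> inv g \<in> PA <#> PB"
proof (rule large_prime_part[OF p bound])
  have xg: "x \<in> A <#> B" "g \<in> A <#> B" using x g AB_incl by (auto simp: part_def)
  then show "g \<otimes> x \<otimes> inv g \<in> A <#> B"
    using AB_subgroup subgroup.m_closed subgroup.m_inv_closed by metis
  show "pelt G (\<lambda>r. r = p) (g \<otimes> x \<otimes> inv g)"
    using pelt_conj[of g x] x g by (auto simp: part_def)
qed

text \<open>Pigeonhole: write the conjugates of the powers \<open>x [^] s\<close> as
  \<open>a s \<otimes> b s\<close>. The \<open>b s\<close> lie in a cyclic group with fewer than
  \<open>ord x\<close> elements. Where two of them agree, the quotient of the two conjugates lies in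
  \<open>PA\<close>, and \<open>plc_conj\<close> applies.\<close>

lemma normalises_small:
  assumes x: "x \<in> PA" and small: "\<And>y. y \<in> PB \<Longrightarrow> ord y < ord x" and g: "g \<in> B"
  shows "\<exists>y\<in>cyc G x. y \<noteq> \<one> \<and> g \<otimes> y \<otimes> inv g \<in> cyc G y"
proof -
  have xc: "x \<in> carrier G" and gc: "g \<in> carrier G"
    using x g by (auto simp: part_def)
  have "\<exists>a\<in>PA. \<exists>b\<in>PB. g \<otimes> x [^] s \<otimes> inv g = a \<otimes> b" for s :: nat
    using conj_in_parts[of "x [^] s" g] subgroup_pow[OF plc_subgroup[OF plc_PA] x] g
    by (auto elim!: set_multE)
  then obtain a b where ab: "\<And>s::nat. a s \<in> PA" "\<And>s. b s \<in> PB" "\<And>s. g \<otimes> x [^] s \<otimes> inv g = a s \<otimes> b s"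
    by metis
  let ?n = "ord x"
  obtain c where c: "c \<in> PB" "b ` {..<?n} \<subseteq> cyc G c"
    using plc_finite_common[OF plc_PB, of "b ` {..<?n}"] ab(2) by auto
  have cc: "c \<in> carrier G" "torsion G c" using c plc_PB plc_closed plc_torsion by blast+
  have "card (cyc G c) \<le> ord c"
    unfolding cyc_ord_range[OF cc(1) ord_pos[OF cc]] by (metis card_image_le card_lessThan finite_lessThan)
  moreover have "ord c < ?n" using small c by blast
  moreover have "card (b ` {..<?n}) \<le> card (cyc G c)" using card_mono[OF finite_cyc[OF cc] c(2)] .
  ultimately have "card (b ` {..<?n}) < card {..<?n}" by simp
  then have "\<not> inj_on b {..<?n}" using card_image[of b "{..<?n}"] by auto
  then obtain i j where ij: "i < ?n" "j < ?n" "i \<noteq> j" "b i = b j" unfolding inj_on_def by auto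
  have main: ?thesis if "i < j" "j < ?n" "b i = b j" for i j
  proof -
    let ?y = "x [^] (j - i)"
    have abc: "a s \<in> carrier G" "b s \<in> carrier G" for s
      using ab plc_PA plc_PB plc_closed by blast+
    have xe: "x [^] (j - i) = x [^] j \<otimes> inv (x [^] i)" using pow_diff[OF xc] that by simp
    have "g \<otimes> ?y \<otimes> inv g = (g \<otimes> x [^] j \<otimes> inv g) \<otimes> inv (g \<otimes> x [^] i \<otimes> inv g)"
      using xe gc xc by (simp add: m_assoc inv_mult_group)
    also have "\<dots> = a j \<otimes> inv (a i)" unfolding ab(3) using that(3) abc by (simp add: m_assoc inv_mult_group)
    also have "\<dots> \<in> PA"
      using ab(1) subgroup.m_closed[OF plc_subgroup[OF plc_PA]] subgroup.m_inv_closed[OF plc_subgroup[OF plc_PA]] by blast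
    finally have "g \<otimes> ?y \<otimes> inv g \<in> PA" .
    then have "g \<otimes> ?y \<otimes> inv g \<in> cyc G ?y"
      using plc_conj[OF plc_PA _ gc] subgroup_pow[OF plc_subgroup[OF plc_PA] x] by blast
    moreover have "?y \<noteq> \<one>" using pow_diff_neq_one[OF xc that(1,2)] .
    ultimately show ?thesis using pow_in_cyc by metis
  qed
  show ?thesis using main[of i j] main[of j i] ij by (metis linorder_neqE_nat)
qed

text \<open>Take \<open>x\<close> in \<open>PA\<close> of the same order as \<open>y\<close> and
  write \<open>y \<otimes> x [^] s = x [^] k s \<otimes> y [^] l s\<close>. If \<open>l\<close>
  repeats a value, \<open>y\<close> preserves a nontrivial subgroup of \<open>cyc G x\<close>; it
  contains \<open>z\<close>, and a \<open>p\<close>-element normalising a group of order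
  \<open>p\<close> centralises it. If not, \<open>l\<close> takes the value 0, which puts
  \<open>y\<close> into \<open>PA\<close>, against the trivial intersection.\<close>

lemma centralises_socle:
  assumes z: "z \<in> PA" "z \<noteq> \<one>" "z [^] p = \<one>" and y: "y \<in> PB"
    and le: "\<And>y. y \<in> PB \<Longrightarrow> \<exists>x\<in>PA. ord x = ord y"
  shows "y \<otimes> z = z \<otimes> y"
proof -
  have zc: "z \<in> carrier G" "pelt G (\<lambda>r. r = p) z" and yc: "y \<in> carrier G" "pelt G (\<lambda>r. r = p) y"
    using z y by (auto simp: part_def)
  show ?thesis
  proof (cases "PA \<inter> PB = {\<one>}")
    case False
    then obtain u where u: "u \<in> PA" "u \<in> PB" "u \<noteq> \<one>"
      using subgroup.one_closed[OF plc_subgroup[OF plc_PA]] subgroup.one_closed[OF plc_subgroup[OF plc_PB]] by blast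
    then have "z \<in> cyc G u" using plc_p_mem[OF plc_PA u(1) z(1) u(3)] zc z p by (auto simp: part_def)
    then have "z \<in> PB" using subgroup_cyc[OF plc_subgroup[OF plc_PB] u(2)] by blast
    then show ?thesis using plc_commute[OF plc_PB y] by blast
  next
    case int: True
    show ?thesis
    proof (cases "y = \<one>")
      case True then show ?thesis using zc by simp
    next
      case False
      obtain x where x: "x \<in> PA" "ord x = ord y" using le[OF y] by blast
      have xc: "x \<in> carrier G" using x by (auto simp: part_def)
      have yt: "torsion G y" using pelt_torsion[OF yc(2)] .
      interpret S: two_factors G PA PB using part_two_factors .
      have "permutes_cyc G x y" by (rule S.p_groups_permute[of p]) (use x y in \<open>auto simp: part_def\<close>)
      let ?n = "ord y"
      have n0: "?n > 0" using ord_pos yc yt by blast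
      have "\<exists>(k::nat) l. l < ?n \<and> y \<otimes> x [^] s = x [^] k \<otimes> y [^] l" for s :: nat
      proof -
        obtain k l :: nat where kl: "y [^] (1::nat) \<otimes> x [^] s = x [^] k \<otimes> y [^] l"
          using permutes_cycD[OF xc yc(1) \<open>permutes_cyc G x y\<close>] .
        have "y [^] l = y [^] (l mod ?n)" using yc by (intro pow_cong[of y ?n]) auto
        moreover have "y \<otimes> x [^] s = x [^] k \<otimes> y [^] l" using kl yc by simp
        ultimately have "y \<otimes> x [^] s = x [^] k \<otimes> y [^] (l mod ?n)" by metis
        then show ?thesis using mod_less_divisor[OF n0, of l] by blast
      qed
      then obtain k l where kl: "\<And>s. l s < ?n" "\<And>s::nat. y \<otimes> x [^] s = x [^] (k s :: nat) \<otimes> y [^] (l s :: nat)" by metis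
      have main: "y \<otimes> z = z \<otimes> y" if ij: "i < j" "j < ?n" "l i = l j" for i j
      proof -
        let ?w = "x [^] (j - i)"
        have "?w = x [^] j \<otimes> inv (x [^] i)" using pow_diff[OF xc] ij by simp
        then have "y \<otimes> ?w \<otimes> inv y = (y \<otimes> x [^] j) \<otimes> inv (y \<otimes> x [^] i)"
          using xc yc by (simp add: m_assoc inv_mult_group)
        also have "\<dots> = x [^] k j \<otimes> inv (x [^] k i)"
          unfolding kl(2) using ij(3) xc yc by (simp add: m_assoc inv_mult_group)
        also have "\<dots> \<in> PA" using x(1) S.A_pow S.A_closed by blast
        finally have "y \<otimes> ?w \<otimes> inv y \<in> cyc G ?w"
          using plc_conj[OF plc_PA _ yc(1)] S.A_pow[OF x(1)] by blast
        moreover have "?w \<noteq> \<one>" using pow_diff_neq_one[OF xc] ij x(2) by simp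
        then have "z \<in> cyc G ?w"
          using plc_p_mem[OF plc_PA S.A_pow[OF x(1)] z(1) _ _ _ z(3) p] zc S.A_pow[OF x(1)] by (auto simp: part_def)
        ultimately have "y \<otimes> z \<otimes> inv y \<in> cyc G z" using conj_cyc[OF yc(1) _ _ ] xc by blast
        then show ?thesis using large_prime_centralises[OF zc(1) z(3) p yc(1) _ yc(2) p] by simp
      qed
      show ?thesis
      proof (cases "inj_on l {..<?n}")
        case True
        have "l ` {..<?n} \<subseteq> {..<?n}" using kl(1) by auto
        then have "l ` {..<?n} = {..<?n}" using True by (simp add: endo_inj_surj)
        then obtain s where "l s = 0" using n0 by (metis imageE lessThan_iff)
        then have "y \<otimes> x [^] s = x [^] k s" using kl(2)[of s] xc by simp
        then have "y = x [^] k s \<otimes> inv (x [^] s)" using xc yc by (simp add: inv_solve_right)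
        moreover have "x [^] k s \<otimes> inv (x [^] s) \<in> PA" using x(1) S.A_pow S.A_closed by blast
        ultimately have "y \<in> PA" by simp
        then show ?thesis using False int y by blast
      next
        case False
        then obtain i j where "i < ?n" "j < ?n" "i \<noteq> j" "l i = l j" unfolding inj_on_def by auto
        then show ?thesis using main[of i j] main[of j i] by (metis linorder_neqE_nat)
      qed
    qed
  qed
qed

text \<open>Write \<open>g \<otimes> z \<otimes> inv g = x \<otimes> y\<close> by parts. As
  \<open>z\<close> centralises \<open>PA <#> PB\<close>, and with it
  \<open>inv g \<otimes> x \<otimes> g\<close>, the conjugate commutes with \<open>x\<close>. So
  \<open>x\<close> and \<open>y\<close> commute. If the parts meet trivially, both have exponent
  \<open>p\<close> and lie in the subgroups of order \<open>p\<close>; otherwise \<open>z\<close>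
  lies in \<open>B\<close> and is fixed.\<close>

lemma socle_invariant:
  assumes z: "z \<in> PA" "z \<noteq> \<one>" "z [^] p = \<one>" and w: "w \<in> PB" "w \<noteq> \<one>" "w [^] p = \<one>"
    and cen: "\<And>y. y \<in> PB \<Longrightarrow> y \<otimes> z = z \<otimes> y" and g: "g \<in> B"
  shows "g \<otimes> z \<otimes> inv g \<in> cyc G z <#> cyc G w"
proof -
  have zc: "z \<in> carrier G" "pelt G (\<lambda>r. r = p) z" and wc: "w \<in> carrier G" "pelt G (\<lambda>r. r = p) w"
    and gc: "g \<in> carrier G" using z w g by (auto simp: part_def)
  interpret S: two_factors G PA PB using part_two_factors .
  show ?thesis
  proof (cases "PA \<inter> PB = {\<one>}")
    case False
    then obtain u where u: "u \<in> PA" "u \<in> PB" "u \<noteq> \<one>" using S.A_closed(1) S.B_closed(1) by blast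
    then have "z \<in> cyc G u" using plc_p_mem[OF plc_PA u(1) z(1) u(3)] zc z p by (auto simp: part_def)
    then have "z \<in> PB" using subgroup_cyc[OF plc_subgroup[OF plc_PB] u(2)] by blast
    then have "z \<in> B" by (simp add: part_def)
    then have "g \<otimes> z \<otimes> inv g = z \<otimes> \<one>" using B_comm[OF g, of z] zc gc by (simp add: m_assoc)
    then show ?thesis using set_multI[OF cyc_self[OF zc(1)] one_in_cyc[of G w]] by simp
  next
    case int: True
    define u where "u = g \<otimes> z \<otimes> inv g"
    obtain x y where xy: "x \<in> PA" "y \<in> PB" "u = x \<otimes> y"
      using conj_in_parts[of z g] z g by (auto elim!: set_multE simp: u_def)
    have xyc: "x \<in> carrier G" "y \<in> carrier G" using xy by auto
    have zS: "z \<otimes> s = s \<otimes> z" if "s \<in> PA <#> PB" for s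
    proof -
      obtain a b where ab: "a \<in> PA" "b \<in> PB" "s = a \<otimes> b" using \<open>s \<in> PA <#> PB\<close> by (rule set_multE)
      have abc: "a \<in> carrier G" "b \<in> carrier G" using ab by auto
      have "z \<otimes> s = a \<otimes> (z \<otimes> b)" unfolding ab(3) using S.A_lcomm[OF z(1) ab(1)] abc by simp
      also have "\<dots> = s \<otimes> z" unfolding ab(3) using cen[OF ab(2)] abc zc by (simp add: m_assoc)
      finally show ?thesis .
    qed
    have "inv g \<otimes> x \<otimes> inv (inv g) \<in> PA <#> PB" using conj_in_parts[of x "inv g"] xy g by simp
    then have "z \<otimes> (inv g \<otimes> x \<otimes> g) = (inv g \<otimes> x \<otimes> g) \<otimes> z" using zS gc by simp
    then have "g \<otimes> (z \<otimes> (inv g \<otimes> x \<otimes> g)) \<otimes> inv g = g \<otimes> ((inv g \<otimes> x \<otimes> g) \<otimes> z) \<otimes> inv g" by simp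
    then have "u \<otimes> x = x \<otimes> u" using gc xyc zc by (simp add: u_def m_assoc)
    then have "x \<otimes> (y \<otimes> x) = x \<otimes> (x \<otimes> y)" unfolding xy(3) using xyc by (simp add: m_assoc)
    then have com: "x \<otimes> y = y \<otimes> x" using xyc by simp
    have "u [^] p = \<one>" unfolding u_def using conj_pow[OF gc zc(1), of p] z(3) gc by simp
    then have e: "x [^] p \<otimes> y [^] p = \<one>" unfolding xy(3) using pow_mult_distrib[OF com xyc] by simp
    then have "x [^] p = inv (y [^] p)" using xyc by (simp add: inv_equality)
    then have "x [^] p \<in> PB" using S.B_pow[OF xy(2)] S.B_closed(2) by metis
    then have xp: "x [^] p = \<one>" using int S.A_pow[OF xy(1)] by blast
    then have yp: "y [^] p = \<one>" using e xyc by simp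
    have "x \<in> cyc G z" using plc_prime_mem[OF plc_PA z(1) xy(1) p z(2,3) xp] .
    moreover have "y \<in> cyc G w" using plc_prime_mem[OF plc_PB w(1) xy(2) p w(2,3) yp] .
    ultimately show ?thesis using set_multI xy(3) u_def by metis
  qed
qed

text \<open>The exponent \<open>m\<close> kills the component of \<open>c\<close> prime to
  \<open>p\<close>. Wherever the parts act trivially, \<open>c\<close> thus acts with order prime to
  \<open>p\<close>.\<close>

lemma coprime_power_in_parts:
  assumes c: "c \<in> A <#> B"
  obtains m d where "coprime m p" "m > 0" "d \<in> PA <#> PB" "c [^] (m::nat) = d"
proof -
  have cc: "c \<in> carrier G" using subgroup.mem_carrier[OF AB_subgroup c] .
  have "pelt G (\<lambda>r. r \<le> p) c" using product_elements_pelt[OF bound c] .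
  then have t: "torsion G c" by (rule pelt_torsion)
  obtain y w where yw: "y \<in> cyc G c" "w \<in> cyc G c" "c = y \<otimes> w" "pelt G (\<lambda>r. r = p) y" "pelt G (\<lambda>r. r \<noteq> p) w"
    using pelt_decomp[OF cc t] by metis
  have ywc: "y \<in> carrier G" "w \<in> carrier G" using yw cyc_closed[OF cc] by auto
  have "y \<in> A <#> B" using yw(1) subgroup_cyc[OF AB_subgroup c] by blast
  then have y: "y \<in> PA <#> PB" using large_prime_part[OF p bound _ yw(4)] by blast
  obtain m where m: "m > 0" "w [^] (m::nat) = \<one>" "\<And>q. prime q \<Longrightarrow> q dvd m \<Longrightarrow> q \<noteq> p"
    using peltE[OF yw(5)] by metis
  have "coprime m p" by (rule coprime_of_primes[of m "\<lambda>q. q \<noteq> p"]) (use m p primes_dvd_imp_eq in auto)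
  moreover have "c [^] m = y [^] m"
    unfolding yw(3) using pow_mult_distrib[OF cyc_commute[OF cc yw(1,2)] ywc, of m] m(2) ywc by simp
  moreover have "y [^] m \<in> PA <#> PB"
    using subgroup_pow[OF two_factors.AB_subgroup[OF part_two_factors] y] .
  ultimately show ?thesis using that m by blast
qed

end

end

subsection \<open>Commutators acting on elementary abelian groups\<close>

context group
begin

text \<open>If \<open>g\<close> and \<open>h\<close> act by scalars on \<open>v\<close> modulo \<open>W\<close> and their commutator acts trivially on \<open>W\<close>,
  then it acts unipotently; as its order is prime to \<open>p\<close>, it acts trivially.\<close>

lemma commutator_centralises:
  assumes c: "g \<in> carrier G" "h \<in> carrier G" "v \<in> carrier G"
    and W: "subgroup W G" "\<And>n. n \<in> W \<Longrightarrow> n [^] (p::nat) = \<one>" "\<And>n. n \<in> W \<Longrightarrow> v \<otimes> n = n \<otimes> v"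
    and nW: "\<And>n. n \<in> W \<Longrightarrow> cj g n \<in> W" "\<And>n. n \<in> W \<Longrightarrow> cj h n \<in> W"
      "\<And>n. n \<in> W \<Longrightarrow> cj (inv g) n \<in> W" "\<And>n. n \<in> W \<Longrightarrow> cj (inv h) n \<in> W"
    and k: "k = inv (h \<otimes> g) \<otimes> (g \<otimes> h)" and kW: "\<And>n. n \<in> W \<Longrightarrow> k \<otimes> n = n \<otimes> k"
    and gv: "w1 \<in> W" "cj g v = v [^] (i::nat) \<otimes> w1" and hv: "w2 \<in> W" "cj h v = v [^] (j::nat) \<otimes> w2"
    and m: "k [^] (m::nat) \<otimes> v = v \<otimes> k [^] m" "coprime m p"
  shows "k \<otimes> v = v \<otimes> k"
proof -
  have Wc: "n \<in> carrier G" if "n \<in> W" for n using subgroup.mem_carrier[OF W(1) that] .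
  have kc: "k \<in> carrier G" using c k by simp
  have vnW: "v [^] r \<otimes> n = n \<otimes> v [^] r" if "n \<in> W" for n and r :: nat
    using commute_pow[OF c(3) Wc[OF that] W(3)[OF that]] .
  have step: "\<exists>n\<in>W. cj x (v [^] s \<otimes> w) = v [^] (r * s) \<otimes> n"
    if x: "x \<in> carrier G" "cj x v = v [^] r \<otimes> w'" "w' \<in> W" "w \<in> W" "cj x w \<in> W" for x w w' and r s :: nat
  proof -
    have "cj x (v [^] s \<otimes> w) = (v [^] r \<otimes> w') [^] s \<otimes> cj x w"
      using x c Wc by (simp add: cj_mult cj_pow)
    also have "(v [^] r \<otimes> w') [^] s = v [^] (r * s) \<otimes> w' [^] s"
      using pow_mult_distrib[OF vnW[OF x(3)], of r s] c Wc[OF x(3)] by (simp add: nat_pow_pow)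
    finally have "cj x (v [^] s \<otimes> w) = v [^] (r * s) \<otimes> (w' [^] s \<otimes> cj x w)"
      using c Wc x by (simp add: m_assoc)
    moreover have "w' [^] s \<otimes> cj x w \<in> W"
      using subgroup.m_closed[OF W(1) subgroup_pow[OF W(1) x(3)] x(5)] .
    ultimately show ?thesis by blast
  qed
  obtain n1 where n1: "n1 \<in> W" "cj (g \<otimes> h) v = v [^] (i * j) \<otimes> n1"
    using step[OF c(1) gv(2,1) hv(1) nW(1)[OF hv(1)], of j] cj_comp[OF c] hv(2) by metis
  obtain n2 where n2: "n2 \<in> W" "cj (h \<otimes> g) v = v [^] (j * i) \<otimes> n2"
    using step[OF c(2) hv(2,1) gv(1) nW(2)[OF gv(1)], of i] cj_comp[OF c(2,1,3)] gv(2) by metis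
  define n3 where "n3 = inv n2 \<otimes> n1"
  have n3: "n3 \<in> W" unfolding n3_def using subgroup.m_closed[OF W(1) subgroup.m_inv_closed[OF W(1) n2(1)] n1(1)] .
  \<comment> \<open>Both products multiply the scalar of \<open>v\<close> to \<open>i * j\<close>,
    so their effects differ only by an element of \<open>W\<close>.\<close>
  have e: "cj (g \<otimes> h) v = cj (h \<otimes> g) v \<otimes> n3"
    unfolding n1(2) n2(2) n3_def using c Wc[OF n1(1)] Wc[OF n2(1)] by (simp add: m_assoc mult.commute)
  define n4 where "n4 = cj (inv (h \<otimes> g)) n3"
  have n4: "n4 \<in> W"
    unfolding n4_def using c Wc[OF n3] nW(3)[OF nW(4)[OF n3]] by (simp add: inv_mult_group cj_comp)
  have "cj k v = cj (inv (h \<otimes> g)) (cj (g \<otimes> h) v)" unfolding k using c by (simp add: cj_comp)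
  also have "\<dots> = cj (inv (h \<otimes> g)) (cj (h \<otimes> g) v) \<otimes> n4"
    unfolding e n4_def using c Wc[OF n3] by (simp add: cj_mult)
  also have "\<dots> = v \<otimes> n4" using c by (simp add: cj_inv_cancel)
  also have "\<dots> = n4 \<otimes> v" using W(3)[OF n4] .
  finally have kv: "k \<otimes> v \<otimes> inv k = n4 \<otimes> v" by (simp add: cj_def)
  have n4c: "n4 \<in> carrier G" using Wc[OF n4] .
  \<comment> \<open>\<open>k\<close> fixes \<open>n4\<close>, so its \<open>m\<close>-th power
    multiplies \<open>v\<close> by \<open>n4 [^] m\<close>. With \<open>m\<close> prime to
    \<open>p\<close> this forces \<open>n4 = \<one>\<close>.\<close>
  have "k [^] m \<otimes> v \<otimes> inv (k [^] m) = n4 [^] m \<otimes> v"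
    using conj_iter[OF kc c(3) n4c kW[OF n4] kv] .
  moreover have "k [^] m \<otimes> v \<otimes> inv (k [^] m) = v" unfolding m(1) using kc c by (simp add: m_assoc)
  ultimately have "n4 [^] m = \<one>" using c n4c by (metis l_cancel_one nat_pow_closed r_cancel_one)
  then have "n4 = \<one>" using prime_pow_one[OF n4c _ W(2)[OF n4] m(2)] by blast
  then have "cj k v = v" using kv c by (simp add: cj_def)
  then show ?thesis using cj_eq_iff kc c by blast
qed

lemma commutator_centralises_cyc:
  assumes c: "g \<in> carrier G" "h \<in> carrier G" "v \<in> carrier G"
    and gv: "cj g v \<in> cyc G v" and hv: "cj h v \<in> cyc G v"
    and k: "k = inv (h \<otimes> g) \<otimes> (g \<otimes> h)"
    and m: "k [^] (m::nat) \<otimes> v = v \<otimes> k [^] m"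
  shows "k \<otimes> v = v \<otimes> k"
proof -
  obtain i where i: "cj g v = v [^] (i::nat)" using gv by (rule cycE)
  obtain j where j: "cj h v = v [^] (j::nat)" using hv by (rule cycE)
  have kc: "k \<in> carrier G" using c k by simp
  \<comment> \<open>With \<open>W\<close> trivial and \<open>p = 1\<close> the exponent condition is
    immediate and every \<open>m\<close> is coprime to \<open>p\<close>.\<close>
  show ?thesis
    by (rule commutator_centralises[OF c triv_subgroup, where p=1 and m=m and i=i and j=j and ?w1.0=\<one> and ?w2.0=\<one>])
      (use c i j m k kc in auto)
qed

text \<open>The two generators may coincide or be trivial, so pairs in which some
  \<open>Zo k\<close> is trivial are covered as well.\<close>

lemma elementary_pair:
  assumes c: "x \<in> carrier G" "y \<in> carrier G" "x \<otimes> y = y \<otimes> x" "x [^] (p::nat) = \<one>" "y [^] p = \<one>" "p > 0"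
  shows "subgroup (cyc G x <#> cyc G y) G"
    and "\<And>n. n \<in> cyc G x <#> cyc G y \<Longrightarrow> n [^] p = \<one>"
    and "\<And>n v. n \<in> cyc G x <#> cyc G y \<Longrightarrow> v \<in> carrier G \<Longrightarrow> v \<otimes> x = x \<otimes> v \<Longrightarrow> v \<otimes> y = y \<otimes> v \<Longrightarrow> v \<otimes> n = n \<otimes> v"
    and "x \<in> cyc G x <#> cyc G y" "y \<in> cyc G x <#> cyc G y"
    and "\<And>n g. n \<in> cyc G x <#> cyc G y \<Longrightarrow> g \<in> carrier G \<Longrightarrow> cj g x \<in> cyc G x <#> cyc G y \<Longrightarrow>
      cj g y \<in> cyc G x <#> cyc G y \<Longrightarrow> cj g n \<in> cyc G x <#> cyc G y"
proof -
  let ?T = "cyc G x <#> cyc G y"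
  have t: "torsion G x" "torsion G y" using c unfolding torsion_def by auto
  have s: "subgroup (cyc G x) G" "subgroup (cyc G y) G" using cyc_subgroup c t by auto
  have com: "a \<otimes> b = b \<otimes> a" if "a \<in> cyc G x" "b \<in> cyc G y" for a b
  proof -
    have bc: "b \<in> carrier G" using cyc_closed[OF c(2) that(2)] .
    have "b \<otimes> x = x \<otimes> b" using commute_cyc[OF c(2,1) c(3)[symmetric] that(2)] .
    then show ?thesis using commute_cyc[OF c(1) bc _ that(1)] by simp
  qed
  have "cyc G x <#> cyc G y = cyc G y <#> cyc G x"
  proof (rule subgroups_commute[OF s])
    fix a b assume ab: "a \<in> cyc G x" "b \<in> cyc G y"
    show "b \<otimes> a \<in> ?T" using set_multI[OF ab] unfolding com[OF ab] .
  qed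
  then show sub: "subgroup ?T G" using subgroup_set_mult_commute[OF s] by blast
  show "n [^] p = \<one>" if "n \<in> ?T" for n
  proof -
    obtain a b where ab: "a \<in> cyc G x" "b \<in> cyc G y" "n = a \<otimes> b" using \<open>n \<in> ?T\<close> by (rule set_multE)
    obtain i where i: "a = x [^] (i::nat)" using ab(1) by (rule cycE)
    obtain j where j: "b = y [^] (j::nat)" using ab(2) by (rule cycE)
    have "a [^] p = (x [^] p) [^] i" "b [^] p = (y [^] p) [^] j"
      unfolding i j using nat_pow_pow[OF c(1)] nat_pow_pow[OF c(2)] mult.commute by metis+
    then have "a [^] p = \<one>" "b [^] p = \<one>" using c(4,5) by auto
    then show ?thesis unfolding ab(3)
      using pow_mult_distrib[OF com[OF ab(1,2)]] cyc_closed[OF c(1) ab(1)] cyc_closed[OF c(2) ab(2)] by simp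
  qed
  show "v \<otimes> n = n \<otimes> v" if "n \<in> ?T" "v \<in> carrier G" "v \<otimes> x = x \<otimes> v" "v \<otimes> y = y \<otimes> v" for n v
  proof -
    obtain a b where ab: "a \<in> cyc G x" "b \<in> cyc G y" "n = a \<otimes> b" using \<open>n \<in> ?T\<close> by (rule set_multE)
    have abc: "a \<in> carrier G" "b \<in> carrier G" using ab cyc_closed c by blast+
    have va: "a \<otimes> v = v \<otimes> a" using commute_cyc[OF c(1) that(2) _ ab(1)] that(3) by simp
    have vb: "b \<otimes> v = v \<otimes> b" using commute_cyc[OF c(2) that(2) _ ab(2)] that(4) by simp
    have "n \<otimes> v = a \<otimes> (v \<otimes> b)" unfolding ab(3) using abc that(2) vb by (simp add: m_assoc)
    also have "\<dots> = (a \<otimes> v) \<otimes> b" using abc that(2) by (simp add: m_assoc)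
    also have "\<dots> = v \<otimes> n" unfolding va ab(3) using abc that(2) by (simp add: m_assoc)
    finally show ?thesis ..
  qed
  show "x \<in> ?T" using set_multI[OF cyc_self[OF c(1)] one_in_cyc[of G y]] c by simp
  show "y \<in> ?T" using set_multI[OF one_in_cyc[of G x] cyc_self[OF c(2)]] c by simp
  show "cj g n \<in> ?T" if "n \<in> ?T" "g \<in> carrier G" "cj g x \<in> ?T" "cj g y \<in> ?T" for n g
  proof -
    obtain a b where ab: "a \<in> cyc G x" "b \<in> cyc G y" "n = a \<otimes> b" using \<open>n \<in> ?T\<close> by (rule set_multE)
    obtain i where i: "a = x [^] (i::nat)" using ab(1) by (rule cycE)
    obtain j where j: "b = y [^] (j::nat)" using ab(2) by (rule cycE)
    have "cj g n = cj g x [^] i \<otimes> cj g y [^] j" unfolding ab(3) i j using that(2) c by (simp add: cj_mult cj_pow)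
    then show ?thesis using subgroup.m_closed[OF sub subgroup_pow[OF sub that(3)] subgroup_pow[OF sub that(4)]] by simp
  qed
qed

end

text \<open>\<open>A\<close> fixes \<open>u\<close> and \<open>B\<close> fixes \<open>w\<close>. As \<open>B\<close> is locally cyclic, the elements \<open>b u b\<^sup>-\<^sup>1 u\<^sup>-\<^sup>1\<close> lie on one line,
  which is invariant under \<open>A\<close> and \<open>B\<close>.\<close>

lemma (in two_factors) commutator_fixes:
  fixes p :: nat
  assumes uw: "u \<in> carrier G" "w \<in> carrier G" "u \<otimes> w = w \<otimes> u" "u [^] p = \<one>" "w [^] p = \<one>" and p: "prime p"
    and au: "\<And>a. a \<in> A \<Longrightarrow> a \<otimes> u = u \<otimes> a" and bw: "\<And>b. b \<in> B \<Longrightarrow> b \<otimes> w = w \<otimes> b"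
    and bu: "\<And>b. b \<in> B \<Longrightarrow> cj b u \<in> cyc G u <#> cyc G w"
    and cop: "\<And>c. c \<in> A <#> B \<Longrightarrow> \<exists>m::nat. coprime m p \<and> c [^] m \<otimes> u = u \<otimes> c [^] m \<and> c [^] m \<otimes> w = w \<otimes> c [^] m"
    and gh: "g \<in> A" "h \<in> B" and k: "k = inv (h \<otimes> g) \<otimes> (g \<otimes> h)"
  shows "k \<otimes> u = u \<otimes> k"
proof -
  let ?T = "cyc G u <#> cyc G w"
  note T = elementary_pair[OF uw prime_gt_0_nat[OF p]]
  have gc: "g \<in> carrier G" "h \<in> carrier G" using gh by auto
  have ghAB: "g \<in> A <#> B" "h \<in> A <#> B" using gh AB_incl by auto
  have kAB: "k \<in> A <#> B"
    unfolding k using ghAB AB_subgroup subgroup.m_closed subgroup.m_inv_closed by metis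
  have kc: "k \<in> carrier G" using k gc by simp
  obtain m where m: "coprime m p" "k [^] (m::nat) \<otimes> u = u \<otimes> k [^] m" "k [^] m \<otimes> w = w \<otimes> k [^] m"
    using cop[OF kAB] by blast
  have Tc: "n \<in> carrier G" if "n \<in> ?T" for n using subgroup.mem_carrier[OF T(1) that] .
  have Tcom: "n \<otimes> n' = n' \<otimes> n" if "n \<in> ?T" "n' \<in> ?T" for n n'
    using T(3)[OF that(2) Tc[OF that(1)]] T(3)[OF that(1) uw(1)] T(3)[OF that(1) uw(2)] uw by simp
  have kT: "k [^] m \<otimes> n = n \<otimes> k [^] m" if "n \<in> ?T" for n
    using T(3)[OF that _ m(2,3)] kc by simp
  define d where "d b = cj b u \<otimes> inv u" for b
  have dT: "d b \<in> ?T" if "b \<in> B" for b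
    unfolding d_def using subgroup.m_closed[OF T(1) bu[OF that] subgroup.m_inv_closed[OF T(1) T(4)]] .
  have dc: "d b \<in> carrier G" if "b \<in> B" for b using Tc dT that by blast
  have du: "cj b u = d b \<otimes> u" if "b \<in> B" for b using that uw by (simp add: d_def m_assoc)
  have du': "cj b u = u \<otimes> d b" if "b \<in> B" for b using du[OF that] Tcom[OF T(4) dT[OF that]] by simp
  show ?thesis
  proof (cases "\<forall>b\<in>B. d b = \<one>")
    case True
    then have "h \<otimes> u = u \<otimes> h" using du[OF gh(2)] gh uw cj_eq_iff[OF gc(2) uw(1)] by simp
    then have hu: "cj h u = u" "cj (inv h) u = u" using cj_eq_iff gc uw cj_inv_cancel by metis+
    have gu: "cj g u = u" "cj (inv g) u = u" using au[OF gh(1)] cj_eq_iff gc uw cj_inv_cancel by metis+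
    have "cj k u = u" unfolding k using gc uw hu gu by (simp add: cj_comp inv_mult_group)
    then show ?thesis using cj_eq_iff kc uw by blast
  next
    case False
    then obtain b1 where b1: "b1 \<in> B" "d b1 \<noteq> \<one>" by blast
    let ?d = "d b1"
    have dp: "?d [^] p = \<one>" using T(2) dT b1 by blast
    have line: "d b \<in> cyc G ?d" if b: "b \<in> B" for b
    proof -
      \<comment> \<open>A common generator \<open>b0\<close> of \<open>b\<close> and
        \<open>b1\<close> reduces the claim to the powers of one element: all
        \<open>d (b0 [^] r)\<close> lie in \<open>cyc G (d b0)\<close>.\<close>
      obtain b0 where b0: "b0 \<in> B" "b \<in> cyc G b0" "b1 \<in> cyc G b0" using plc_gen[OF plcB b b1(1)] by blast
      have b0c: "b0 \<in> carrier G" using b0 by simp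
      have d0: "d b0 \<in> ?T" "d b0 \<in> carrier G" using dT dc b0 by auto
      obtain x y where xy: "x \<in> cyc G u" "y \<in> cyc G w" "cj b0 u = x \<otimes> y" using bu[OF b0(1)] by (rule set_multE)
      obtain i0 where i0: "x = u [^] (i0::nat)" using xy(1) by (rule cycE)
      obtain j where j: "y = w [^] (j::nat)" using xy(2) by (rule cycE)
      \<comment> \<open>\<open>Suc i\<close> agrees with \<open>i0\<close> modulo \<open>p\<close>
        and exists even for \<open>i0 = 0\<close>. Splitting off one factor \<open>u\<close> leaves
        \<open>d b0 = u [^] i \<otimes> w [^] j\<close>.\<close>
      define i where "i = i0 + p - 1"
      have i: "Suc i = i0 + p" using prime_gt_0_nat[OF p] by (simp add: i_def)
      have "u [^] (i0 + p) = x" using uw i0 by (simp flip: nat_pow_mult)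
      then have x: "x = u \<otimes> u [^] i" using i nat_pow_Suc2[OF uw(1), of i] by simp
      have "cj b0 u = u \<otimes> (u [^] i \<otimes> w [^] j)"
        unfolding xy(3) x j using uw by (simp add: m_assoc)
      then have d0e: "d b0 = u [^] i \<otimes> w [^] j" using du'[OF b0(1)] d0 uw by simp
      have wj: "cj b0 (w [^] j) = w [^] j"
        using bw[OF b0(1)] cj_eq_iff[OF b0c uw(2)] uw b0c by (simp add: cj_pow)
      \<comment> \<open>\<open>b0\<close> fixes \<open>w\<close>, so only \<open>u [^] i\<close>
        moves; collecting terms shows that \<open>b0\<close> acts on \<open>d b0\<close> with the
        scalar \<open>i + 1\<close>.\<close>
      have "cj b0 (d b0) = (u \<otimes> d b0) [^] i \<otimes> w [^] j"
        using du'[OF b0(1)] wj b0c uw by (simp add: d0e cj_mult cj_pow)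
      also have "(u \<otimes> d b0) [^] i = d b0 [^] i \<otimes> u [^] i"
        using pow_mult_distrib[OF Tcom[OF d0(1) T(4)] d0(2) uw(1)] Tcom[OF d0(1) T(4)] by simp
      also have "d b0 [^] i \<otimes> u [^] i \<otimes> w [^] j = d b0 [^] Suc i"
        using d0e d0(2) uw by (simp add: m_assoc)
      finally have c0: "cj b0 (d b0) \<in> cyc G (d b0)" using pow_in_cyc by metis
      have pw: "d (b0 [^] r) \<in> cyc G (d b0)" for r :: nat
      proof (induction r)
        case 0
        have "d (b0 [^] (0::nat)) = \<one>" using uw by (simp add: d_def)
        then show ?case using one_in_cyc[of G "d b0"] by simp
      next
        case (Suc r)
        have rB: "b0 [^] r \<in> B" using b0 by simp
        have rc: "d (b0 [^] r) \<in> carrier G" using dc[OF rB] .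
        have "cj (b0 [^] Suc r) u = cj b0 (cj (b0 [^] r) u)"
          using b0c uw nat_pow_Suc2[OF b0c, of r] by (simp add: cj_comp)
        also have "\<dots> = cj b0 (d (b0 [^] r)) \<otimes> (d b0 \<otimes> u)"
          unfolding du[OF rB] using b0c rc uw du[OF b0(1)] by (simp add: cj_mult)
        finally have "d (b0 [^] Suc r) = cj b0 (d (b0 [^] r)) \<otimes> d b0"
          unfolding d_def[of "b0 [^] Suc r"] using b0c rc d0(2) uw by (simp add: m_assoc)
        moreover have "cj b0 (d (b0 [^] r)) \<in> cyc G (d (b0 [^] r))"
          using conj_cyc[OF b0c d0(2) c0[unfolded cj_def] Suc] by (simp add: cj_def)
        then have "cj b0 (d (b0 [^] r)) \<in> cyc G (d b0)" using cyc_trans[OF d0(2) Suc] by blast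
        ultimately show ?case using cyc_mult[OF d0(2) _ cyc_self[OF d0(2)]] by simp
      qed
      have "d b \<in> cyc G (d b0)" "?d \<in> cyc G (d b0)" using pw b0 cycE by metis+
      moreover then have "cyc G ?d = cyc G (d b0)"
        using cyc_prime_eq[OF d0(2) p T(2)[OF d0(1)] _ b1(2)] by blast
      ultimately show ?thesis by simp
    qed
    have dcc: "?d \<in> carrier G" using dc b1 by blast
    have sd: "subgroup (cyc G ?d) G"
      by (rule cyc_subgroup[OF dcc]) (use dp prime_gt_0_nat[OF p] in \<open>auto simp: torsion_def\<close>)
    have An: "cj a ?d \<in> cyc G ?d" if a: "a \<in> A" for a
    proof -
      \<comment> \<open>\<open>a\<close> and \<open>a'\<close> fix \<open>u\<close>, so moving
        \<open>a\<close> past \<open>b1\<close> turns \<open>d b1\<close> into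
        \<open>d b'\<close>.\<close>
      obtain b' a' where ba: "b' \<in> B" "a' \<in> A" "a \<otimes> b1 = b' \<otimes> a'" using perm'[OF a b1(1)] by blast
      have "cj a u = u" "cj a' u = u" using au a ba cj_eq_iff uw by auto
      moreover have "cj a (cj b1 u) = cj b' (cj a' u)"
        using ba a b1 uw by (simp flip: cj_comp)
      ultimately have "cj a ?d = d b'" using a b1 uw by (simp add: d_def cj_mult cj_inv)
      then show ?thesis using line ba by simp
    qed
    have Bn: "cj b ?d \<in> cyc G ?d" if b: "b \<in> B" for b
    proof -
      have bb: "b \<otimes> b1 \<in> B" using b b1 by simp
      have "cj b ?d = cj (b \<otimes> b1) u \<otimes> inv (cj b u)"
        using b b1 uw by (simp add: d_def cj_mult cj_inv cj_comp)
      also have "\<dots> = d (b \<otimes> b1) \<otimes> inv (d b)"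
        unfolding du[OF bb] du[OF b] using dc[OF bb] dc[OF b] uw by (simp add: m_assoc inv_mult_group)
      also have "\<dots> \<in> cyc G ?d" using subgroup.m_closed[OF sd line[OF bb] subgroup.m_inv_closed[OF sd line[OF b]]] .
      finally show ?thesis .
    qed
    have cycT: "cyc G ?d \<subseteq> ?T" using subgroup_cyc[OF T(1) dT[OF b1(1)]] .
    have kd: "k \<otimes> ?d = ?d \<otimes> k"
      using commutator_centralises_cyc[OF gc dcc An[OF gh(1)] Bn[OF gh(2)] k] kT[OF dT[OF b1(1)]] by blast
    have nrm: "cj x n \<in> cyc G ?d" if "x \<in> A \<union> B" "n \<in> cyc G ?d" for x n
    proof -
      have xc: "x \<in> carrier G" using that by auto
      have "cj x ?d \<in> cyc G ?d" using An Bn that by blast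
      then have "cj x n \<in> cyc G n" using conj_cyc[OF xc dcc _ that(2)] by (simp add: cj_def)
      then show ?thesis using cyc_trans[OF dcc that(2)] by blast
    qed
    \<comment> \<open>Modulo the line, which serves as \<open>W\<close>, both \<open>g\<close> and
      \<open>h\<close> act on \<open>u\<close> with scalar 1.\<close>
    show ?thesis
    proof (rule commutator_centralises[OF gc uw(1) sd, where p=p and m=m and i=1 and j=1 and ?w1.0=\<one> and ?w2.0="d h"])
      show "n [^] p = \<one>" if "n \<in> cyc G ?d" for n using T(2) cycT that by blast
      show "u \<otimes> n = n \<otimes> u" if "n \<in> cyc G ?d" for n using Tcom T(4) cycT that by blast
      show "k \<otimes> n = n \<otimes> k" if "n \<in> cyc G ?d" for n
        using commute_cyc[OF dcc kc kd[symmetric] that] by simp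
      show "cj g u = u [^] (1::nat) \<otimes> \<one>" using au[OF gh(1)] cj_eq_iff[OF gc(1) uw(1)] uw by simp
      show "cj h u = u [^] (1::nat) \<otimes> d h" using du'[OF gh(2)] uw by simp
      show "d h \<in> cyc G ?d" using line gh by blast
      show "k = inv (h \<otimes> g) \<otimes> (g \<otimes> h)" by (rule k)
      show "k [^] m \<otimes> u = u \<otimes> k [^] m" by (rule m)
      show "coprime m p" by (rule m)
      show "\<one> \<in> cyc G ?d" by (rule one_in_cyc)
    qed (use nrm gh in auto)
  qed
qed

subsection \<open>Pairwise permutable families\<close>

lemma finite_total_greatest:
  assumes "finite I" "I \<noteq> {}" "\<And>i j. i \<in> I \<Longrightarrow> j \<in> I \<Longrightarrow> R i j \<or> R j i"
    and tr: "\<And>i j k. R i j \<Longrightarrow> R j k \<Longrightarrow> R i k"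
  shows "\<exists>i\<in>I. \<forall>j\<in>I. R j i"
  using assms(1-3)
proof (induction I rule: finite_ne_induct)
  case (singleton x) then show ?case by blast
next
  case (insert x F)
  then obtain i where i: "i \<in> F" "\<forall>j\<in>F. R j i" by blast
  consider "R i x" | "R x i" using insert.prems i by blast
  then show ?case
  proof cases
    case 1
    moreover have "R x x" using insert.prems by blast
    ultimately show ?thesis using i tr by blast
  next
    case 2 then show ?thesis using i by blast
  qed
qed

lemma (in group) cj_cancel_inv: "g \<in> carrier G \<Longrightarrow> v \<in> carrier G \<Longrightarrow> cj g (cj (inv g) v) = v"
  by (simp add: cj_def m_assoc)

lemma (in group) normal_of_generators:
  assumes S: "S \<subseteq> carrier G" "carrier G = generate G S" "\<And>s. s \<in> S \<Longrightarrow> inv s \<in> S"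
    and z: "z \<in> carrier G" "torsion G z" "\<And>s. s \<in> S \<Longrightarrow> cj s z \<in> cyc G z"
  shows "cyc G z \<lhd> G"
proof (rule cyc_normalI[OF z(1,2)])
  fix g assume "g \<in> carrier G"
  then have "g \<in> generate G S" using S(2) by simp
  then have "cj g z \<in> cyc G z"
  proof (induction rule: generate.induct)
    case one then show ?case using z cyc_self by simp
  next
    case (incl h) then show ?case using z by blast
  next
    case (inv h) then show ?case using z S by blast
  next
    case (eng h1 h2)
    have hc: "h1 \<in> carrier G" "h2 \<in> carrier G" using eng generate_in_carrier[OF S(1)] by auto
    have "cj h1 (cj h2 z) \<in> cyc G (cj h2 z)"
      using conj_cyc[OF hc(1) z(1)] eng by (simp add: cj_def)
    then have "cj h1 (cj h2 z) \<in> cyc G z" using cyc_trans[OF z(1) eng(4)] by blast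
    then show ?case using hc z by (simp add: cj_comp)
  qed
  then show "g \<otimes> z \<otimes> inv g \<in> cyc G z" by (simp add: cj_def)
qed

text \<open>Generation by the \<open>A i\<close> is all that is kept of the product decomposition:
  it passes to quotients, and it holds for the prime parts inside the group that they
  generate.\<close>

locale permutable_family = group +
  fixes I :: "'i set" and A :: "'i \<Rightarrow> 'a set"
  assumes fin: "finite I" and plc_A: "\<And>i. i \<in> I \<Longrightarrow> plc G (A i)"
    and permutable: "\<And>i j. i \<in> I \<Longrightarrow> j \<in> I \<Longrightarrow> A i <#> A j = A j <#> A i"
    and gen: "carrier G = generate G (\<Union>i\<in>I. A i)"
begin

lemma two: "i \<in> I \<Longrightarrow> j \<in> I \<Longrightarrow> two_factors G (A i) (A j)"
  using two_factorsI[OF plc_A plc_A, of i j] permutable[of i j] set_multI[of _ "A j" _ "A i"] by metis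

context
  fixes p :: nat
  assumes p: "prime p" and bound: "\<And>i x. i \<in> I \<Longrightarrow> x \<in> A i \<Longrightarrow> pelt G (\<lambda>r. r \<le> p) x"
    and nontrivial: "\<exists>i\<in>I. \<exists>x\<in>A i. x \<noteq> \<one> \<and> x [^] p = \<one>"
begin

section \<open>The parts of largest exponent and their subgroups of order p\<close>

definition "P i = part G (\<lambda>r. r = p) (A i)"

lemma plc_P: "i \<in> I \<Longrightarrow> plc G (P i)"
  unfolding P_def using part_plc plc_A by blast

lemma P_c: "i \<in> I \<Longrightarrow> x \<in> P i \<Longrightarrow> x \<in> carrier G"
  using plc_P plc_closed by blast

lemma P_pelt: "x \<in> P i \<Longrightarrow> pelt G (\<lambda>r. r = p) x"
  by (simp add: P_def part_def)

lemma P_A: "x \<in> P i \<Longrightarrow> x \<in> A i"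
  by (simp add: P_def part_def)

lemma A_c: "i \<in> I \<Longrightarrow> x \<in> A i \<Longrightarrow> x \<in> carrier G"
  using plc_A plc_closed by blast

lemma bound2: "i \<in> I \<Longrightarrow> j \<in> I \<Longrightarrow> x \<in> A i \<union> A j \<Longrightarrow> pelt G (\<lambda>r. r \<le> p) x"
  using bound by blast

text \<open>\<open>dominated j i\<close> compares the exponents of the \<open>p\<close>-parts, which may be infinite.\<close>

definition "dominated j i \<longleftrightarrow> (\<forall>y\<in>P j. \<exists>x\<in>P i. ord x = ord y)"

text \<open>Orders in the parts are powers of \<open>p\<close>; if \<open>ord y\<close> were not
  smaller, some power of \<open>y\<close> would have exactly the order of \<open>x\<close>.\<close>

lemma ord_smaller:
  assumes ij: "i \<in> I" "j \<in> I" and x: "x \<in> P i" and y: "y \<in> P j" and ne: "\<And>y. y \<in> P j \<Longrightarrow> ord y \<noteq> ord x"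
  shows "ord y < ord x" "\<exists>x'\<in>P i. ord x' = ord y"
proof -
  have xc: "x \<in> carrier G" and yc: "y \<in> carrier G" using P_c ij x y by auto
  obtain k where k: "ord x = p ^ k" using ord_p_element[OF xc P_pelt[OF x]] by blast
  obtain l where l: "ord y = p ^ l" using ord_p_element[OF yc P_pelt[OF y]] by blast
  have p1: "p > 1" using p prime_gt_1_nat by blast
  have "l < k"
  proof (rule ccontr)
    assume "\<not> l < k"
    then have lk: "p ^ l = p ^ (l - k) * p ^ k" by (simp flip: power_add)
    then have "ord (y [^] (p ^ (l - k))) = p ^ k" using ord_pow[OF yc, of "p ^ (l - k)"] l p1 by simp
    moreover have "y [^] (p ^ (l - k)) \<in> P j" using subgroup_pow[OF plc_subgroup[OF plc_P[OF ij(2)]] y] .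
    ultimately show False using ne k by metis
  qed
  then show "ord y < ord x" using k l p1 by simp
  have "p ^ k = p ^ (k - l) * p ^ l" using \<open>l < k\<close> by (simp flip: power_add)
  then have "ord (x [^] (p ^ (k - l))) = p ^ l" using ord_pow[OF xc, of "p ^ (k - l)"] k p1 by simp
  moreover have "x [^] (p ^ (k - l)) \<in> P i" using subgroup_pow[OF plc_subgroup[OF plc_P[OF ij(1)]] x] .
  ultimately show "\<exists>x'\<in>P i. ord x' = ord y" using l by metis
qed

lemma dominated_total: "i \<in> I \<Longrightarrow> j \<in> I \<Longrightarrow> dominated i j \<or> dominated j i"
  unfolding dominated_def using ord_smaller(2)[of i j] by metis

lemma dominated_trans: "dominated i j \<Longrightarrow> dominated j k \<Longrightarrow> dominated i k"
  unfolding dominated_def by metis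

definition "maximal = {i \<in> I. \<forall>j\<in>I. dominated j i}"

lemma maximal_I: "i \<in> maximal \<Longrightarrow> i \<in> I" by (simp add: maximal_def)

lemma maximal_dominates: "i \<in> maximal \<Longrightarrow> j \<in> I \<Longrightarrow> y \<in> P j \<Longrightarrow> \<exists>x\<in>P i. ord x = ord y"
  by (auto simp: maximal_def dominated_def)

lemma maximal_nonempty: "maximal \<noteq> {}"
proof -
  have "I \<noteq> {}" using nontrivial by blast
  then have "\<exists>i\<in>I. \<forall>j\<in>I. dominated j i"
  proof (rule finite_total_greatest[OF fin])
    show "dominated i j \<or> dominated j i" if "i \<in> I" "j \<in> I" for i j using dominated_total that .
    show "dominated i k" if "dominated i j" "dominated j k" for i j k using dominated_trans that .
  qed
  then show ?thesis by (auto simp: maximal_def)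
qed

definition "Z i = (SOME z. z \<in> P i \<and> z \<noteq> \<one> \<and> z [^] p = \<one>)"

lemma Z_props:
  assumes i: "i \<in> maximal" shows "Z i \<in> P i" "Z i \<noteq> \<one>" "Z i [^] p = \<one>"
proof -
  obtain j y where y: "j \<in> I" "y \<in> A j" "y \<noteq> \<one>" "y [^] p = \<one>" using nontrivial by blast
  have yc: "y \<in> carrier G" using A_c y by blast
  have "pelt G (\<lambda>r. r = p) y"
    by (rule peltI[OF prime_gt_0_nat[OF p] y(4)]) (use p primes_dvd_imp_eq in blast)
  then have "y \<in> P j" using y by (simp add: P_def part_def)
  then obtain x where x: "x \<in> P i" "ord x = ord y" using maximal_dominates[OF i y(1)] by blast
  have xc: "x \<in> carrier G" using P_c maximal_I i x by blast
  have "x [^] p = \<one>" using x(2) y(4) pow_eq_id xc yc by simp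
  moreover have "x \<noteq> \<one>" using x(2) y(3) ord_eq_1 xc yc by metis
  ultimately have "\<exists>z. z \<in> P i \<and> z \<noteq> \<one> \<and> z [^] p = \<one>" using x by blast
  then have "Z i \<in> P i \<and> Z i \<noteq> \<one> \<and> Z i [^] p = \<one>" unfolding Z_def by (rule someI_ex)
  then show "Z i \<in> P i" "Z i \<noteq> \<one>" "Z i [^] p = \<one>" by auto
qed

lemma Z_c: "i \<in> maximal \<Longrightarrow> Z i \<in> carrier G" using P_c Z_props(1) maximal_I by blast

lemma Z_torsion: "i \<in> maximal \<Longrightarrow> torsion G (Z i)"
  using Z_props(3) prime_gt_0_nat[OF p] unfolding torsion_def by blast

lemma Z_central:
  assumes i: "i \<in> maximal" and k: "k \<in> I" and y: "y \<in> P k"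
  shows "y \<otimes> Z i = Z i \<otimes> y"
proof -
  interpret T: two_factors G "A i" "A k" using two maximal_I[OF i] k .
  show ?thesis
  proof (rule T.centralises_socle[OF p])
    show "pelt G (\<lambda>r. r \<le> p) x" if "x \<in> A i \<union> A k" for x using bound2 maximal_I[OF i] k that by blast
    show "Z i \<in> part G (\<lambda>r. r = p) (A i)" using Z_props(1)[OF i] by (simp add: P_def)
    show "y \<in> part G (\<lambda>r. r = p) (A k)" using y by (simp add: P_def)
    show "\<exists>x\<in>part G (\<lambda>r. r = p) (A i). ord x = ord y" if "y \<in> part G (\<lambda>r. r = p) (A k)" for y
      using maximal_dominates[OF i k] that by (simp add: P_def)
  qed (use Z_props(2,3)[OF i] in auto)
qed

lemma Z_own: "i \<in> maximal \<Longrightarrow> a \<in> A i \<Longrightarrow> a \<otimes> Z i = Z i \<otimes> a"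
  using plc_commute[OF plc_A] maximal_I P_A Z_props(1) by metis

lemma Z_comm: "i \<in> maximal \<Longrightarrow> j \<in> maximal \<Longrightarrow> Z i \<otimes> Z j = Z j \<otimes> Z i"
  using Z_central Z_props(1) maximal_I by metis

lemma Z_moved_maximal:
  assumes i: "i \<in> maximal" and k: "k \<in> maximal" and g: "g \<in> A k"
  shows "cj g (Z i) \<in> cyc G (Z i) <#> cyc G (Z k)"
proof -
  interpret T: two_factors G "A i" "A k" using two maximal_I i k by blast
  have "g \<otimes> Z i \<otimes> inv g \<in> cyc G (Z i) <#> cyc G (Z k)"
  proof (rule T.socle_invariant[OF p])
    show "pelt G (\<lambda>r. r \<le> p) x" if "x \<in> A i \<union> A k" for x using bound2 maximal_I i k that by blast
    show "Z i \<in> part G (\<lambda>r. r = p) (A i)" "Z k \<in> part G (\<lambda>r. r = p) (A k)"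
      using Z_props(1) i k by (auto simp: P_def)
    show "y \<otimes> Z i = Z i \<otimes> y" if "y \<in> part G (\<lambda>r. r = p) (A k)" for y
      using Z_central[OF i maximal_I[OF k]] that by (simp add: P_def)
  qed (use Z_props(2,3) i k g in auto)
  then show ?thesis by (simp add: cj_def)
qed

text \<open>Nonmaximality provides an \<open>x\<close> in \<open>P i\<close> of larger order than
  all elements of \<open>P k\<close>. By \<open>normalises_small\<close>, \<open>g\<close> preserves
  a nontrivial subgroup of \<open>cyc G x\<close>, and every such subgroup contains
  \<open>Z i\<close>.\<close>

lemma Z_fixed_nonmaximal:
  assumes i: "i \<in> maximal" and k: "k \<in> I" "k \<notin> maximal" and g: "g \<in> A k"
  shows "cj g (Z i) \<in> cyc G (Z i)"
proof -
  have iI: "i \<in> I" using maximal_I i .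
  have "\<not> dominated i k"
  proof
    assume "dominated i k"
    then have "\<forall>j\<in>I. dominated j k" using i dominated_trans unfolding maximal_def by blast
    then show False using k by (simp add: maximal_def)
  qed
  then obtain x where x: "x \<in> P i" "\<And>y. y \<in> P k \<Longrightarrow> ord y \<noteq> ord x" unfolding dominated_def by blast
  interpret T: two_factors G "A i" "A k" using two iI k(1) .
  have gc: "g \<in> carrier G" using A_c k g by blast
  have "\<exists>y\<in>cyc G x. y \<noteq> \<one> \<and> g \<otimes> y \<otimes> inv g \<in> cyc G y"
  proof (rule T.normalises_small[OF p])
    show "pelt G (\<lambda>r. r \<le> p) x" if "x \<in> A i \<union> A k" for x using bound2 iI k that by blast
    show "x \<in> part G (\<lambda>r. r = p) (A i)" using x by (simp add: P_def)
    show "ord y < ord x" if "y \<in> part G (\<lambda>r. r = p) (A k)" for y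
      using ord_smaller(1)[OF iI k(1) x(1) _ x(2)] that by (simp add: P_def)
  qed (rule g)
  then obtain y where y: "y \<in> cyc G x" "y \<noteq> \<one>" "g \<otimes> y \<otimes> inv g \<in> cyc G y" by blast
  have yP: "y \<in> P i" using y(1) subgroup_cyc[OF plc_subgroup[OF plc_P[OF iI]] x(1)] by blast
  have "Z i \<in> cyc G y"
    using plc_p_mem[OF plc_P[OF iI] yP Z_props(1)[OF i] y(2) P_pelt[OF yP] P_pelt[OF Z_props(1)[OF i]] Z_props(3)[OF i] p] .
  then show ?thesis using conj_cyc[OF gc P_c[OF iI yP] y(3)] by (simp add: cj_def)
qed

text \<open>Nonmaximal factors map \<open>Z i\<close> into \<open>cyc G (Z i)\<close>; giving them a
  trivial \<open>Zo k\<close> lets the single formula \<open>Z_moved\<close> serve for all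
  factors.\<close>

definition "Zo k = (if k \<in> maximal then Z k else \<one>)"

lemma Zo_props:
  assumes "k \<in> I"
  shows "Zo k \<in> carrier G" "Zo k [^] p = \<one>" "\<And>a. a \<in> A k \<Longrightarrow> a \<otimes> Zo k = Zo k \<otimes> a"
    "\<And>i. i \<in> maximal \<Longrightarrow> Z i \<otimes> Zo k = Zo k \<otimes> Z i"
  using Z_c Z_props Z_own Z_comm A_c[OF assms] by (auto simp: Zo_def)

lemma Zo_comm: "j \<in> I \<Longrightarrow> k \<in> I \<Longrightarrow> Zo j \<otimes> Zo k = Zo k \<otimes> Zo j"
  using Zo_props(1)[of j] Zo_props(1)[of k] Z_comm by (auto simp: Zo_def)

lemma Z_moved:
  assumes i: "i \<in> maximal" and k: "k \<in> I" and g: "g \<in> A k"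
  shows "cj g (Z i) \<in> cyc G (Z i) <#> cyc G (Zo k)"
proof (cases "k \<in> maximal")
  case True then show ?thesis using Z_moved_maximal[OF i True g] by (simp add: Zo_def)
next
  case False
  have "cj g (Z i) \<otimes> \<one> \<in> cyc G (Z i) <#> cyc G (Zo k)"
    using set_multI[OF Z_fixed_nonmaximal[OF i k False g] one_in_cyc[of G "Zo k"]] .
  then show ?thesis using A_c[OF k g] Z_c[OF i] by simp
qed

lemma coprime_power:
  assumes jk: "j \<in> I" "k \<in> I" and c: "c \<in> A j <#> A k"
  shows "\<exists>m::nat. coprime m p \<and> (\<forall>i\<in>maximal. c [^] m \<otimes> Z i = Z i \<otimes> c [^] m)"
proof -
  interpret T: two_factors G "A j" "A k" using two jk .
  have b: "pelt G (\<lambda>r. r \<le> p) x" if "x \<in> A j \<union> A k" for x using bound2 jk that by blast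
  obtain m d where m: "coprime m p" "m > 0" "d \<in> P j <#> P k" "c [^] (m::nat) = d"
    using T.coprime_power_in_parts[OF p b c] unfolding P_def by metis
  obtain x y where xy: "x \<in> P j" "y \<in> P k" "d = x \<otimes> y" using m(3) by (rule set_multE)
  have xyc: "x \<in> carrier G" "y \<in> carrier G" using xy P_c jk by auto
  have "d \<otimes> Z i = Z i \<otimes> d" if i: "i \<in> maximal" for i
  proof -
    have "d \<otimes> Z i = x \<otimes> (Z i \<otimes> y)" unfolding xy(3) using xyc Z_c[OF i] Z_central[OF i jk(2) xy(2)] by (simp add: m_assoc)
    also have "\<dots> = (x \<otimes> Z i) \<otimes> y" using xyc Z_c[OF i] by (simp add: m_assoc)
    also have "\<dots> = Z i \<otimes> d" unfolding Z_central[OF i jk(1) xy(1)] xy(3) using xyc Z_c[OF i] by (simp add: m_assoc)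
    finally show ?thesis .
  qed
  then show ?thesis using m by blast
qed

lemma commutator_in_product:
  assumes "j \<in> I" "k \<in> I" "g \<in> A j" "h \<in> A k"
  shows "inv (h \<otimes> g) \<otimes> (g \<otimes> h) \<in> A j <#> A k"
proof -
  interpret T: two_factors G "A j" "A k" using two assms by blast
  have "g \<in> A j <#> A k" "h \<in> A j <#> A k" using T.AB_incl assms by auto
  then show ?thesis using T.AB_subgroup subgroup.m_closed subgroup.m_inv_closed by metis
qed

text \<open>For \<open>j\<close> maximal there are two cases: if \<open>k\<close> is maximal too,
  \<open>commutator_fixes\<close> applies; if not, both elements act on \<open>Z j\<close> as
  scalars.\<close>

lemma commutator_fixes_Zo:
  assumes jk: "j \<in> I" "k \<in> I" and gh: "g \<in> A j" "h \<in> A k" and c: "c = inv (h \<otimes> g) \<otimes> (g \<otimes> h)"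
  shows "c \<otimes> Zo j = Zo j \<otimes> c"
proof -
  have gc: "g \<in> carrier G" "h \<in> carrier G" using gh A_c jk by auto
  have cc: "c \<in> carrier G" using c gc by simp
  have cAB: "c \<in> A j <#> A k" unfolding c using commutator_in_product jk gh .
  obtain m where m: "coprime m p" "\<And>i. i \<in> maximal \<Longrightarrow> c [^] (m::nat) \<otimes> Z i = Z i \<otimes> c [^] m"
    using coprime_power[OF jk cAB] by blast
  show ?thesis
  proof (cases "j \<in> maximal")
    case False then show ?thesis using cc by (simp add: Zo_def)
  next
    case j: True
    show ?thesis
    proof (cases "k \<in> maximal")
      case False
      have "cj g (Z j) \<in> cyc G (Z j)"
        using Z_own[OF j gh(1)] cj_eq_iff[OF gc(1) Z_c[OF j]] cyc_self[OF Z_c[OF j]] by simp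
      then have "c \<otimes> Z j = Z j \<otimes> c"
        using commutator_centralises_cyc[OF gc Z_c[OF j] _ Z_fixed_nonmaximal[OF j jk(2) False gh(2)] c m(2)[OF j]] by blast
      then show ?thesis using j by (simp add: Zo_def)
    next
      case k: True
      interpret T: two_factors G "A j" "A k" using two jk .
      have "c \<otimes> Z j = Z j \<otimes> c"
      proof (rule T.commutator_fixes[OF Z_c[OF j] Z_c[OF k] Z_comm[OF j k] Z_props(3)[OF j] Z_props(3)[OF k] p])
        show "a \<otimes> Z j = Z j \<otimes> a" if "a \<in> A j" for a using Z_own[OF j that] .
        show "b \<otimes> Z k = Z k \<otimes> b" if "b \<in> A k" for b using Z_own[OF k that] .
        show "cj b (Z j) \<in> cyc G (Z j) <#> cyc G (Z k)" if "b \<in> A k" for b using Z_moved_maximal[OF j k that] .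
        show "\<exists>m::nat. coprime m p \<and> c [^] m \<otimes> Z j = Z j \<otimes> c [^] m \<and> c [^] m \<otimes> Z k = Z k \<otimes> c [^] m"
          if "c \<in> A j <#> A k" for c using coprime_power[OF jk that] j k by blast
      qed (use gh c in auto)
      then show ?thesis using j by (simp add: Zo_def)
    qed
  qed
qed

text \<open>The commutator fixes \<open>Zo j\<close> and, with the factors exchanged,
  \<open>Zo k\<close>, so it acts trivially on the group \<open>?W\<close> that they generate.
  Modulo \<open>?W\<close> both elements act on \<open>Z i\<close> as scalars, which is the
  situation of \<open>commutator_centralises\<close>.\<close>

lemma commutator_fixes_Z:
  assumes i: "i \<in> maximal" and jk: "j \<in> I" "k \<in> I" and gh: "g \<in> A j" "h \<in> A k"
    and c: "c = inv (h \<otimes> g) \<otimes> (g \<otimes> h)"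
  shows "c \<otimes> Z i = Z i \<otimes> c"
proof -
  have gc: "g \<in> carrier G" "h \<in> carrier G" using gh A_c jk by auto
  have cc: "c \<in> carrier G" using c gc by simp
  have cAB: "c \<in> A j <#> A k" unfolding c using commutator_in_product jk gh .
  obtain m where m: "coprime m p" "\<And>i. i \<in> maximal \<Longrightarrow> c [^] (m::nat) \<otimes> Z i = Z i \<otimes> c [^] m"
    using coprime_power[OF jk cAB] by blast
  note Xj = Zo_props[OF jk(1)] and Xk = Zo_props[OF jk(2)]
  let ?W = "cyc G (Zo j) <#> cyc G (Zo k)"
  note W = elementary_pair[OF Xj(1) Xk(1) Zo_comm[OF jk] Xj(2) Xk(2) prime_gt_0_nat[OF p]]
  have sub: "cyc G (Zo j) \<subseteq> ?W" "cyc G (Zo k) \<subseteq> ?W" using subgroup_cyc[OF W(1)] W(4,5) by auto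
  have mv: "cj g (Zo k) \<in> ?W" "cj h (Zo j) \<in> ?W" if g: "g \<in> A j" and h: "h \<in> A k" for g h
  proof -
    have gc: "g \<in> carrier G" "h \<in> carrier G" using A_c jk g h by auto
    show "cj g (Zo k) \<in> ?W"
    proof (cases "k \<in> maximal")
      case True
      then obtain x y where xy: "x \<in> cyc G (Zo k)" "y \<in> cyc G (Zo j)" "cj g (Zo k) = x \<otimes> y"
        using Z_moved[OF True jk(1) g] by (auto simp: Zo_def[of k] elim!: set_multE)
      show ?thesis unfolding xy(3) using subgroup.m_closed[OF W(1) subsetD[OF sub(2) xy(1)] subsetD[OF sub(1) xy(2)]] .
    next
      case False then show ?thesis using gc subgroup.one_closed[OF W(1)] by (simp add: Zo_def[of k])
    qed
    show "cj h (Zo j) \<in> ?W"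
    proof (cases "j \<in> maximal")
      case True
      then obtain x y where xy: "x \<in> cyc G (Zo j)" "y \<in> cyc G (Zo k)" "cj h (Zo j) = x \<otimes> y"
        using Z_moved[OF True jk(2) h] by (auto simp: Zo_def[of j] elim!: set_multE)
      show ?thesis unfolding xy(3) using subgroup.m_closed[OF W(1) subsetD[OF sub(1) xy(1)] subsetD[OF sub(2) xy(2)]] .
    next
      case False then show ?thesis using gc subgroup.one_closed[OF W(1)] by (simp add: Zo_def[of j])
    qed
  qed
  have own: "cj g (Zo j) \<in> ?W" "cj h (Zo k) \<in> ?W" if g: "g \<in> A j" and h: "h \<in> A k" for g h
    using Xj(3)[OF g] Xk(3)[OF h] cj_eq_iff[OF A_c[OF jk(1) g] Xj(1)] cj_eq_iff[OF A_c[OF jk(2) h] Xk(1)]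
      W(4,5) by simp_all
  have ig: "inv g \<in> A j" "inv h \<in> A k"
    using gh subgroup.m_inv_closed plc_subgroup plc_A jk by metis+
  have nrm: "cj x n \<in> ?W" if "n \<in> ?W" "x \<in> {g, h, inv g, inv h}" for x n
    using W(6)[OF that(1)] that(2) mv[OF gh] mv[OF ig] own[OF gh] own[OF ig] gc by auto
  \<comment> \<open>The inverse is the commutator with the two factors exchanged.\<close>
  have "inv c = inv (g \<otimes> h) \<otimes> (h \<otimes> g)" unfolding c using gc by (simp add: inv_mult_group m_assoc)
  then have "inv c \<otimes> Zo k = Zo k \<otimes> inv c" using commutator_fixes_Zo[OF jk(2,1) gh(2,1)] by blast
  then have "c \<otimes> (inv c \<otimes> Zo k) \<otimes> c = c \<otimes> (Zo k \<otimes> inv c) \<otimes> c" by simp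
  then have ck: "c \<otimes> Zo k = Zo k \<otimes> c" using cc Xk(1) by (simp add: m_assoc)
  have cj': "c \<otimes> Zo j = Zo j \<otimes> c" using commutator_fixes_Zo[OF jk gh c] .
  obtain x w1 where 1: "x \<in> cyc G (Z i)" "w1 \<in> cyc G (Zo j)" "cj g (Z i) = x \<otimes> w1"
    using Z_moved[OF i jk(1) gh(1)] by (rule set_multE)
  obtain y w2 where 2: "y \<in> cyc G (Z i)" "w2 \<in> cyc G (Zo k)" "cj h (Z i) = y \<otimes> w2"
    using Z_moved[OF i jk(2) gh(2)] by (rule set_multE)
  obtain r where r: "x = Z i [^] (r::nat)" using 1(1) by (rule cycE)
  obtain s where s: "y = Z i [^] (s::nat)" using 2(1) by (rule cycE)
  show ?thesis
  proof (rule commutator_centralises[OF gc Z_c[OF i] W(1,2), where m=m and i=r and j=s and ?w1.0=w1 and ?w2.0=w2])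
    show "Z i \<otimes> n = n \<otimes> Z i" if "n \<in> ?W" for n
      using W(3)[OF that Z_c[OF i] Xj(4)[OF i] Xk(4)[OF i]] .
    show "c \<otimes> n = n \<otimes> c" if "n \<in> ?W" for n using W(3)[OF that cc cj' ck] .
    show "w1 \<in> ?W" "w2 \<in> ?W" using 1(2) 2(2) sub by auto
    show "cj g (Z i) = Z i [^] r \<otimes> w1" using 1(3) r by simp
    show "cj h (Z i) = Z i [^] s \<otimes> w2" using 2(3) s by simp
    show "c = inv (h \<otimes> g) \<otimes> (g \<otimes> h)" by (rule c)
    show "c [^] m \<otimes> Z i = Z i \<otimes> c [^] m" using m(2)[OF i] .
    show "coprime m p" using m(1) .
  qed (use nrm in auto)
qed

definition "movers i = {k \<in> I. \<exists>g\<in>A k. cj g (Z i) \<notin> cyc G (Z i)}"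

text \<open>Some \<open>h\<close> in \<open>A j\<close> sends \<open>Z i\<close> to
  \<open>x \<otimes> y\<close> with \<open>y \<noteq> \<one>\<close> in \<open>cyc G (Z j)\<close>.
  An element \<open>g\<close> acting on \<open>Z i\<close> by a scalar \<open>f\<close> commutes
  with \<open>h\<close> there, so it acts by \<open>f\<close> on \<open>x \<otimes> y\<close> and on
  \<open>x\<close>, hence on \<open>y\<close> and on \<open>Z j\<close>. The inclusion is strict
  because \<open>A j\<close> is abelian and does not move \<open>Z j\<close>.\<close>

lemma movers_mono:
  assumes i: "i \<in> maximal" and j: "j \<in> movers i"
  shows "movers j \<subset> movers i"
proof -
  obtain h where jI: "j \<in> I" and h: "h \<in> A j" "cj h (Z i) \<notin> cyc G (Z i)" using j by (auto simp: movers_def)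
  have jt: "j \<in> maximal" using Z_fixed_nonmaximal[OF i jI _ h(1)] h(2) by blast
  have hc: "h \<in> carrier G" using A_c jI h by blast
  note Zi = Z_c[OF i] and Zj = Z_c[OF jt]
  obtain x y where xy: "x \<in> cyc G (Z i)" "y \<in> cyc G (Z j)" "cj h (Z i) = x \<otimes> y"
    using Z_moved_maximal[OF i jt h(1)] by (rule set_multE)
  have xyc: "x \<in> carrier G" "y \<in> carrier G" using xy cyc_closed Zi Zj by blast+
  have y1: "y \<noteq> \<one>" using xy xyc h(2) by auto
  have Zjy: "Z j \<in> cyc G y" using cyc_prime_gen[OF Zj p Z_props(3)[OF jt] xy(2) y1] .
  obtain e where e: "x = Z i [^] (e::nat)" using xy(1) by (rule cycE)
  have Ziy: "Z i \<otimes> y = y \<otimes> Z i" using commute_cyc[OF Zj Zi Z_comm[OF jt i] xy(2)] by simp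
  have "k \<in> movers i" if k: "k \<in> movers j" for k
  proof (rule ccontr)
    assume "k \<notin> movers i"
    moreover obtain g where kI: "k \<in> I" and g: "g \<in> A k" "cj g (Z j) \<notin> cyc G (Z j)" using k by (auto simp: movers_def)
    ultimately have gi: "cj g (Z i) \<in> cyc G (Z i)" by (auto simp: movers_def)
    obtain f where f: "cj g (Z i) = Z i [^] (f::nat)" using gi by (rule cycE)
    have gc: "g \<in> carrier G" using A_c kI g by blast
    have "(inv (h \<otimes> g) \<otimes> (g \<otimes> h)) \<otimes> Z i = Z i \<otimes> (inv (h \<otimes> g) \<otimes> (g \<otimes> h))"
      using commutator_fixes_Z[OF i kI jI g(1) h(1) refl] .
    then have "cj (inv (h \<otimes> g)) (cj (g \<otimes> h) (Z i)) = Z i"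
      using cj_eq_iff[of "inv (h \<otimes> g) \<otimes> (g \<otimes> h)" "Z i"] gc hc Zi
        cj_comp[of "inv (h \<otimes> g)" "g \<otimes> h" "Z i"] by simp
    then have "cj (h \<otimes> g) (Z i) = cj (g \<otimes> h) (Z i)"
      using cj_cancel_inv[of "h \<otimes> g" "cj (g \<otimes> h) (Z i)"] gc hc Zi by simp
    then have "cj g (cj h (Z i)) = cj h (cj g (Z i))" using gc hc Zi by (simp add: cj_comp)
    then have "cj g (x \<otimes> y) = (x \<otimes> y) [^] f"
      unfolding f xy(3) using hc Zi xy(3) by (simp add: cj_pow)
    also have "(x \<otimes> y) [^] f = x [^] f \<otimes> y [^] f"
      by (rule pow_mult_distrib[OF _ xyc]) (use commute_cyc[OF Zi xyc(2) Ziy xy(1)] in simp)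
    finally have "cj g x \<otimes> cj g y = x [^] f \<otimes> y [^] f" using gc xyc by (simp add: cj_mult)
    moreover have "cj g x = x [^] f"
      unfolding e using gc Zi f by (simp add: cj_pow nat_pow_pow mult.commute)
    ultimately have "cj g y = y [^] f" using xyc gc by simp
    then have "cj g y \<in> cyc G y" using pow_in_cyc by metis
    then have "cj g (Z j) \<in> cyc G (Z j)"
      using conj_cyc[OF gc xyc(2) _ Zjy] by (simp add: cj_def)
    then show False using g by blast
  qed
  moreover have "j \<notin> movers j"
  proof
    assume "j \<in> movers j"
    then obtain g where g: "g \<in> A j" "cj g (Z j) \<notin> cyc G (Z j)" by (auto simp: movers_def)
    then have "cj g (Z j) = Z j" using Z_own[OF jt] cj_eq_iff A_c jI Zj by blast
    then show False using g cyc_self[OF Zj] by simp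
  qed
  ultimately show ?thesis using j by blast
qed

lemma exists_normal_socle: "\<exists>i\<in>maximal. cyc G (Z i) \<lhd> G"
proof -
  obtain i where i: "i \<in> maximal" "\<And>j. j \<in> maximal \<Longrightarrow> card (movers i) \<le> card (movers j)"
  proof -
    obtain i0 where "i0 \<in> maximal" using maximal_nonempty by blast
    then show ?thesis
      using ex_has_least_nat[of "\<lambda>i. i \<in> maximal" i0 "\<lambda>i. card (movers i)"] that by blast
  qed
  have "movers i = {}"
  proof (rule ccontr)
    assume "movers i \<noteq> {}"
    then obtain j where j: "j \<in> movers i" by blast
    have "finite (movers i)" using fin by (simp add: movers_def)
    then have "card (movers j) < card (movers i)" using movers_mono[OF i(1) j] by (rule psubset_card_mono)
    moreover have "j \<in> maximal"
      using j Z_fixed_nonmaximal[OF i(1)] by (auto simp: movers_def)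
    ultimately show False using i(2) by fastforce
  qed
  then have "cj g (Z i) \<in> cyc G (Z i)" if "g \<in> (\<Union>i\<in>I. A i)" for g using that by (auto simp: movers_def)
  moreover have "(\<Union>i\<in>I. A i) \<subseteq> carrier G" using A_c by blast
  moreover have "inv g \<in> (\<Union>i\<in>I. A i)" if g: "g \<in> (\<Union>i\<in>I. A i)" for g
  proof -
    obtain j where j: "j \<in> I" "g \<in> A j" using g by blast
    then have "inv g \<in> A j" using subgroup.m_inv_closed[OF plc_subgroup[OF plc_A[OF j(1)]]] by blast
    then show ?thesis using j by blast
  qed
  ultimately have "cyc G (Z i) \<lhd> G"
    using normal_of_generators[of "\<Union>i\<in>I. A i" "Z i"] gen Z_c[OF i(1)] Z_torsion[OF i(1)] by blast
  then show ?thesis using i by blast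
qed

end

text \<open>The bound \<open>M\<close> may fail to be attained, so \<open>p\<close> is taken as the
  largest prime that occurs as the order of an element of some factor; all orders then involve only
  primes up to \<open>p\<close>.\<close>

lemma exists_normal_prime:
  assumes bnd: "\<And>i x. i \<in> I \<Longrightarrow> x \<in> A i \<Longrightarrow> pelt G (\<lambda>r. r \<le> M) x" and nt: "carrier G \<noteq> {\<one>}"
  obtains z p where "z \<in> carrier G" "prime (p::nat)" "z \<noteq> \<one>" "z [^] p = \<one>" "cyc G z \<lhd> G"
proof -
  define S where "S = {p::nat. prime p \<and> (\<exists>i\<in>I. \<exists>x\<in>A i. x \<noteq> \<one> \<and> x [^] p = \<one>)}"
  have Ac: "x \<in> carrier G" "torsion G x" if "i \<in> I" "x \<in> A i" for i x
    using that plc_A plc_closed plc_torsion by blast+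
  have inS: "q \<in> S" if q: "prime q" "q dvd ord x" and x: "i \<in> I" "x \<in> A i" for q i x
  proof -
    define y where "y = x [^] (ord x div q)"
    have o: "ord x > 0" using ord_pos Ac x by blast
    have "y [^] q = \<one>" using q Ac(1)[OF x] by (simp add: y_def nat_pow_pow)
    moreover have "y \<noteq> \<one>"
    proof
      assume "y = \<one>"
      then have "ord x dvd ord x div q" using pow_eq_id Ac(1)[OF x] by (simp add: y_def)
      moreover have "0 < ord x div q" "ord x div q < ord x"
        using q o prime_gt_1_nat[OF q(1)] by (auto simp: div_greater_zero_iff dest: dvd_imp_le)
      ultimately show False using dvd_imp_le by fastforce
    qed
    moreover have "y \<in> A i" unfolding y_def using subgroup_pow[OF plc_subgroup[OF plc_A[OF x(1)]] x(2)] .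
    ultimately show ?thesis unfolding S_def using q x by blast
  qed
  have "S \<subseteq> {..M}"
  proof
    fix q assume "q \<in> S"
    then obtain i x where x: "prime q" "i \<in> I" "x \<in> A i" "x \<noteq> \<one>" "x [^] q = \<one>" by (auto simp: S_def)
    then show "q \<in> {..M}" using pelt_prime_coprime[OF Ac(1)[OF x(2,3)] bnd[OF x(2,3)] x(5,1)] by auto
  qed
  then have finS: "finite S" using finite_subset by blast
  have "S \<noteq> {}"
  proof
    assume "S = {}"
    have "x = \<one>" if x: "i \<in> I" "x \<in> A i" for i x
    proof (rule ccontr)
      assume "x \<noteq> \<one>"
      then have "ord x \<noteq> 1" using ord_eq_1 Ac x by blast
      then obtain q where "prime q" "q dvd ord x" using prime_factor_nat by blast
      then show False using inS x \<open>S = {}\<close> by blast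
    qed
    then have "(\<Union>i\<in>I. A i) \<subseteq> {\<one>}" by blast
    then have "generate G (\<Union>i\<in>I. A i) \<subseteq> {\<one>}" using generate_subgroup_incl triv_subgroup by blast
    then show False using nt gen by auto
  qed
  define p where "p = Max S"
  have pS: "p \<in> S" unfolding p_def using Max_in finS \<open>S \<noteq> {}\<close> by blast
  have p: "prime p" "\<exists>i\<in>I. \<exists>x\<in>A i. x \<noteq> \<one> \<and> x [^] p = \<one>" using pS by (auto simp: S_def)
  have bp: "pelt G (\<lambda>r. r \<le> p) x" if x: "i \<in> I" "x \<in> A i" for i x
  proof (rule peltI[of "ord x"])
    show "ord x > 0" using ord_pos Ac x by blast
    show "x [^] ord x = \<one>" using Ac x by simp
    show "q \<le> p" if "prime q" "q dvd ord x" for q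
      unfolding p_def using Max_ge[OF finS inS[OF that x]] .
  qed
  have "\<exists>i\<in>maximal p. cyc G (Z p i) \<lhd> G" by (rule exists_normal_socle[OF p(1) _ p(2)]) (rule bp)
  then obtain i where i: "i \<in> maximal p" "cyc G (Z p i) \<lhd> G" by blast
  have "Z p i \<in> carrier G" by (rule Z_c[OF p(1) _ p(2) i(1)]) (rule bp)
  moreover have "Z p i \<noteq> \<one>" by (rule Z_props(2)[OF p(1) _ p(2) i(1)]) (rule bp)
  moreover have "Z p i [^] p = \<one>" by (rule Z_props(3)[OF p(1) _ p(2) i(1)]) (rule bp)
  ultimately show ?thesis using that p(1) i(2) by blast
qed

end

subsection \<open>Local supersolubility\<close>

lemma (in permutable_family) quotient_family:
  assumes N: "N \<lhd> G"
  shows "permutable_family (G Mod N) I (\<lambda>i. (\<lambda>x. N #> x) ` A i)"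
proof -
  interpret h: group_hom G "G Mod N" "\<lambda>x. N #> x" using quotient_hom[OF N] .
  have sub: "A i \<subseteq> carrier G" if "i \<in> I" for i using plc_A[OF that] plc_closed by blast
  show ?thesis
  proof unfold_locales
    show "finite I" by (rule fin)
    show "plc (G Mod N) ((\<lambda>x. N #> x) ` A i)" if "i \<in> I" for i using h.plc_image plc_A that by blast
    show "(\<lambda>x. N #> x) ` A i <#>\<^bsub>G Mod N\<^esub> (\<lambda>x. N #> x) ` A j = (\<lambda>x. N #> x) ` A j <#>\<^bsub>G Mod N\<^esub> (\<lambda>x. N #> x) ` A i"
      if ij: "i \<in> I" "j \<in> I" for i j
      using h.set_mult_image[OF sub sub, OF ij] h.set_mult_image[OF sub sub, OF ij(2,1)] permutable[OF ij] by metis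
    have "carrier (G Mod N) = (\<lambda>x. N #> x) ` generate G (\<Union>i\<in>I. A i)"
      using gen by (simp add: carrier_FactGroup)
    also have "\<dots> = generate (G Mod N) ((\<lambda>x. N #> x) ` (\<Union>i\<in>I. A i))"
      using h.generate_img[of "\<Union>i\<in>I. A i"] sub by blast
    finally show "carrier (G Mod N) = generate (G Mod N) (\<Union>i\<in>I. (\<lambda>x. N #> x) ` A i)"
      by (simp only: image_UN)
  qed
qed

locale bounded_family = permutable_family +
  fixes M :: nat
  assumes bnd: "\<And>i x. i \<in> I \<Longrightarrow> x \<in> A i \<Longrightarrow> pelt G (\<lambda>r. r \<le> M) x"

lemma (in bounded_family) family_climb:
  assumes N: "N \<lhd> G" "N \<noteq> carrier G"
  shows "\<exists>z\<in>carrier G. \<exists>p. prime (p::nat) \<and> z \<notin> N \<and> (N #> z) [^]\<^bsub>G Mod N\<^esub> p = \<one>\<^bsub>G Mod N\<^esub> \<and>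
    cyc (G Mod N) (N #> z) \<lhd> G Mod N"
proof -
  interpret h: group_hom G "G Mod N" "\<lambda>x. N #> x" using quotient_hom[OF N(1)] .
  interpret Q: permutable_family "G Mod N" I "\<lambda>i. (\<lambda>x. N #> x) ` A i" using quotient_family[OF N(1)] .
  have nt: "carrier (G Mod N) \<noteq> {\<one>\<^bsub>G Mod N\<^esub>}"
  proof
    assume *: "carrier (G Mod N) = {\<one>\<^bsub>G Mod N\<^esub>}"
    have "x \<in> N" if "x \<in> carrier G" for x
      using h.hom_closed[OF that] * quotient_one[OF N(1) that] by blast
    then show False using N normal_carrier by blast
  qed
  have "pelt (G Mod N) (\<lambda>r. r \<le> M) x" if i: "i \<in> I" and x: "x \<in> (\<lambda>x. N #> x) ` A i" for i x
  proof -
    obtain a where a: "a \<in> A i" "x = N #> a" using x by blast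
    have "a \<in> carrier G" using a plc_closed[OF plc_A[OF i]] by blast
    then show ?thesis unfolding a(2) using h.pelt_image bnd[OF i a(1)] by blast
  qed
  then obtain y p where y: "y \<in> carrier (G Mod N)" "prime (p::nat)" "y \<noteq> \<one>\<^bsub>G Mod N\<^esub>"
    "y [^]\<^bsub>G Mod N\<^esub> p = \<one>\<^bsub>G Mod N\<^esub>" "cyc (G Mod N) y \<lhd> G Mod N"
    using Q.exists_normal_prime[OF _ nt] by metis
  then obtain z where z: "z \<in> carrier G" "y = N #> z" by (auto simp: carrier_FactGroup)
  then have "z \<notin> N" using quotient_one[OF N(1) z(1)] y(3) by blast
  then show ?thesis using y z by blast
qed

text \<open>The climb carries \<open>L N\<close>: a finite set closed under products modulo
  \<open>N\<close> lies in a finite set that is closed outright. Modulo the whole group any set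
  containing \<open>\<one>\<close> is closed.\<close>

lemma (in bounded_family) locally_finite:
  assumes S: "finite S" "S \<subseteq> carrier G"
  obtains T where "finite T" "S \<subseteq> T" "T \<subseteq> carrier G" "\<one> \<in> T" "\<And>x y. x \<in> T \<Longrightarrow> y \<in> T \<Longrightarrow> x \<otimes> y \<in> T"
proof -
  define L where "L N \<longleftrightarrow> (\<forall>T. finite T \<longrightarrow> T \<subseteq> carrier G \<longrightarrow> (\<forall>x\<in>T. \<forall>y\<in>T. \<exists>n\<in>N. \<exists>t\<in>T. x \<otimes> y = n \<otimes> t) \<longrightarrow>
    (\<exists>T'. finite T' \<and> T \<subseteq> T' \<and> T' \<subseteq> carrier G \<and> (\<forall>x\<in>T'. \<forall>y\<in>T'. x \<otimes> y \<in> T')))" for N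
  have LG: "L (carrier G)"
  proof (rule normal_climb[of "carrier G" L, OF family_climb subset_refl])
    show "L {\<one>}" unfolding L_def
    proof (intro allI impI)
      fix T assume T: "finite T" "T \<subseteq> carrier G" "\<forall>x\<in>T. \<forall>y\<in>T. \<exists>n\<in>{\<one>}. \<exists>t\<in>T. x \<otimes> y = n \<otimes> t"
      have "x \<otimes> y \<in> T" if xy: "x \<in> T" "y \<in> T" for x y
      proof -
        obtain t where "t \<in> T" "x \<otimes> y = \<one> \<otimes> t" using T(3) xy by blast
        then show ?thesis using T(2) by auto
      qed
      then show "\<exists>T'. finite T' \<and> T \<subseteq> T' \<and> T' \<subseteq> carrier G \<and> (\<forall>x\<in>T'. \<forall>y\<in>T'. x \<otimes> y \<in> T')"
        using T by blast
    qed
  next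
    fix C :: "'a set set"
    assume C: "C \<noteq> {}" "\<And>N. N \<in> C \<Longrightarrow> N \<lhd> G \<and> L N"
      "\<And>M N. M \<in> C \<Longrightarrow> N \<in> C \<Longrightarrow> M \<subseteq> N \<or> N \<subseteq> M"
    show "L (\<Union>C)" unfolding L_def
    proof (intro allI impI)
      fix T assume T: "finite T" "T \<subseteq> carrier G" "\<forall>x\<in>T. \<forall>y\<in>T. \<exists>n\<in>\<Union>C. \<exists>t\<in>T. x \<otimes> y = n \<otimes> t"
      then obtain f where f: "\<And>x y. x \<in> T \<Longrightarrow> y \<in> T \<Longrightarrow> f x y \<in> \<Union>C \<and> (\<exists>t\<in>T. x \<otimes> y = f x y \<otimes> t)" by metis
      define F where "F = (\<lambda>(x, y). f x y) ` (T \<times> T)"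
      have "F \<subseteq> \<Union>C" using f unfolding F_def by auto
      moreover have "finite F" unfolding F_def using T(1) by simp
      ultimately obtain N where N: "N \<in> C" "F \<subseteq> N" using finite_chain_subset[of F C] C by metis
      have "\<forall>x\<in>T. \<forall>y\<in>T. \<exists>n\<in>N. \<exists>t\<in>T. x \<otimes> y = n \<otimes> t"
      proof (intro ballI)
        fix x y assume xy: "x \<in> T" "y \<in> T"
        then have "f x y \<in> N" using N(2) unfolding F_def by auto
        then show "\<exists>n\<in>N. \<exists>t\<in>T. x \<otimes> y = n \<otimes> t" using f[OF xy] by blast
      qed
      then show "\<exists>T'. finite T' \<and> T \<subseteq> T' \<and> T' \<subseteq> carrier G \<and> (\<forall>x\<in>T'. \<forall>y\<in>T'. x \<otimes> y \<in> T')"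
        using C(2)[OF N(1)] T(1,2) unfolding L_def by blast
    qed
  next
    fix N M z p
    assume N: "N \<lhd> G" "L N" and z: "z \<in> carrier G" "prime (p::nat)"
      "(N #> z) [^]\<^bsub>G Mod N\<^esub> p = \<one>\<^bsub>G Mod N\<^esub>" and M: "M \<lhd> G"
      "\<And>x. x \<in> carrier G \<Longrightarrow> x \<in> M \<longleftrightarrow> N #> x \<in> cyc (G Mod N) (N #> z)"
    interpret h: group_hom G "G Mod N" "\<lambda>x. N #> x" using quotient_hom[OF N(1)] .
    have p0: "p > 0" using z(2) prime_gt_0_nat by blast
    have Mc: "M \<subseteq> carrier G" using normal_carrier[OF M(1)] .
    have Ms: "subgroup M G" using normal_imp_subgroup[OF M(1)] .
    have dec: "\<exists>n\<in>N. \<exists>k<p. m = n \<otimes> z [^] k" if m: "m \<in> M" for m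
    proof -
      have mc: "m \<in> carrier G" using m Mc by blast
      obtain k where k: "N #> m = (N #> z) [^]\<^bsub>G Mod N\<^esub> (k::nat)" using M(2)[OF mc] m cycE by metis
      have "(N #> z) [^]\<^bsub>G Mod N\<^esub> k = (N #> z) [^]\<^bsub>G Mod N\<^esub> (k mod p)"
        by (rule h.H.pow_cong[OF h.hom_closed[OF z(1)] z(3)]) simp
      then have "N #> m = N #> (z [^] (k mod p))" using k h.hom_nat_pow[OF z(1)] by metis
      then show ?thesis using quotient_eq[OF N(1) mc nat_pow_closed[OF z(1)]] mod_less_divisor[OF p0] by blast
    qed
    have zM: "z [^] (k::nat) \<in> M" for k
    proof -
      have "z \<in> M" using M(2)[OF z(1)] h.H.cyc_self[OF h.hom_closed[OF z(1)]] by blast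
      then show ?thesis using subgroup_pow[OF Ms] by blast
    qed
    show "L M" unfolding L_def
    proof (intro allI impI)
      fix T assume T: "finite T" "T \<subseteq> carrier G" "\<forall>x\<in>T. \<forall>y\<in>T. \<exists>n\<in>M. \<exists>t\<in>T. x \<otimes> y = n \<otimes> t"
      \<comment> \<open>\<open>M\<close> consists of the products of \<open>N\<close> with the
        powers \<open>z [^] i\<close> for \<open>i < p\<close>, so multiplying by these powers turns
        a set closed modulo \<open>M\<close> into one closed modulo \<open>N\<close>.\<close>
      define T2 where "T2 = (\<lambda>(i, t). z [^] i \<otimes> t) ` ({..<p} \<times> T)"
      have T2I: "z [^] i \<otimes> t \<in> T2" if "i < p" "t \<in> T" for i t
        unfolding T2_def by (rule image_eqI[of _ _ "(i, t)"]) (use that in auto)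
      have "T \<subseteq> T2"
      proof
        fix t assume t: "t \<in> T"
        have "z [^] (0::nat) \<otimes> t = t" using T(2) t by auto
        then show "t \<in> T2" using T2I[OF p0 t] by simp
      qed
      have T2F: "finite T2" unfolding T2_def using T(1) by simp
      have T2c: "T2 \<subseteq> carrier G" unfolding T2_def using T(2) z(1) by auto
      have T2m: "\<forall>x\<in>T2. \<forall>y\<in>T2. \<exists>n\<in>N. \<exists>t\<in>T2. x \<otimes> y = n \<otimes> t"
      proof (intro ballI)
        fix x y assume "x \<in> T2" "y \<in> T2"
        then obtain i s j t where x: "s \<in> T" "x = z [^] (i::nat) \<otimes> s" and y: "t \<in> T" "y = z [^] (j::nat) \<otimes> t"
          unfolding T2_def by auto
        have c: "s \<in> carrier G" "t \<in> carrier G" using x y T(2) by auto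
        obtain m where m: "m \<in> M" "s \<otimes> z [^] j = m \<otimes> s" using normal_swap'[OF M(1) zM c(1)] by metis
        obtain m' r where r: "m' \<in> M" "r \<in> T" "s \<otimes> t = m' \<otimes> r" using T(3) x(1) y(1) by blast
        have mc: "m \<in> carrier G" "m' \<in> carrier G" "r \<in> carrier G" using m r Mc T(2) by auto
        have "z [^] i \<otimes> (m \<otimes> m') \<in> M" using subgroup.m_closed[OF Ms zM subgroup.m_closed[OF Ms m(1) r(1)]] .
        then obtain n k where n: "n \<in> N" "k < p" "z [^] i \<otimes> (m \<otimes> m') = n \<otimes> z [^] k" using dec by blast
        have nc: "n \<in> carrier G" using n normal_carrier[OF N(1)] by blast
        have "x \<otimes> y = z [^] i \<otimes> ((s \<otimes> z [^] j) \<otimes> t)" unfolding x(2) y(2) using c z(1) by (simp add: m_assoc)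
        also have "\<dots> = z [^] i \<otimes> (m \<otimes> (s \<otimes> t))" unfolding m(2) using c mc by (simp add: m_assoc)
        also have "\<dots> = (z [^] i \<otimes> (m \<otimes> m')) \<otimes> r" unfolding r(3) using mc z(1) by (simp add: m_assoc)
        also have "\<dots> = n \<otimes> (z [^] k \<otimes> r)" unfolding n(3) using mc nc z(1) by (simp add: m_assoc)
        finally show "\<exists>n\<in>N. \<exists>t\<in>T2. x \<otimes> y = n \<otimes> t" using n(1) T2I[OF n(2) r(2)] by blast
      qed
      have "\<exists>T'. finite T' \<and> T2 \<subseteq> T' \<and> T' \<subseteq> carrier G \<and> (\<forall>x\<in>T'. \<forall>y\<in>T'. x \<otimes> y \<in> T')"
        by (rule N(2)[unfolded L_def, THEN spec, THEN mp, THEN mp, THEN mp, OF T2F T2c T2m])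
      then obtain T' where T': "finite T'" "T2 \<subseteq> T'" "T' \<subseteq> carrier G" "\<forall>x\<in>T'. \<forall>y\<in>T'. x \<otimes> y \<in> T'"
        by (elim exE conjE)
      have "T \<subseteq> T'" using \<open>T \<subseteq> T2\<close> T'(2) by (rule subset_trans)
      with T' show "\<exists>T'. finite T' \<and> T \<subseteq> T' \<and> T' \<subseteq> carrier G \<and> (\<forall>x\<in>T'. \<forall>y\<in>T'. x \<otimes> y \<in> T')"
        by (intro exI[of _ T'] conjI)
    qed
  qed
  have mul: "\<forall>x\<in>insert \<one> S. \<forall>y\<in>insert \<one> S. \<exists>n\<in>carrier G. \<exists>t\<in>insert \<one> S. x \<otimes> y = n \<otimes> t"
  proof (intro ballI)
    fix x y assume "x \<in> insert \<one> S" "y \<in> insert \<one> S"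
    then have "x \<in> carrier G" "y \<in> carrier G" using S(2) by auto
    then show "\<exists>n\<in>carrier G. \<exists>t\<in>insert \<one> S. x \<otimes> y = n \<otimes> t"
      by (intro bexI[of _ "x \<otimes> y"] bexI[of _ \<one>]) simp_all
  qed
  have "finite (insert \<one> S)" "insert \<one> S \<subseteq> carrier G" using S by auto
  then have "\<exists>T. finite T \<and> insert \<one> S \<subseteq> T \<and> T \<subseteq> carrier G \<and> (\<forall>x\<in>T. \<forall>y\<in>T. x \<otimes> y \<in> T)"
    by (rule LG[unfolded L_def, THEN spec, THEN mp, THEN mp, THEN mp, OF _ _ mul])
  then obtain T where "finite T" "insert \<one> S \<subseteq> T" "T \<subseteq> carrier G" "\<forall>x\<in>T. \<forall>y\<in>T. x \<otimes> y \<in> T"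
    by (elim exE conjE)
  then show ?thesis using that[of T] by simp
qed

section \<open>Normal series of finite subgroups\<close>

lemma (in group) finite_closed_subgroup:
  assumes T: "finite T" "T \<subseteq> carrier G" "\<one> \<in> T" "\<And>x y. x \<in> T \<Longrightarrow> y \<in> T \<Longrightarrow> x \<otimes> y \<in> T"
  shows "subgroup T G"
proof (rule subgroupI)
  fix x assume x: "x \<in> T"
  then have xc: "x \<in> carrier G" using T by blast
  have "inj_on (\<lambda>y. x \<otimes> y) T"
  proof (rule inj_onI)
    fix y z assume yz: "y \<in> T" "z \<in> T" "x \<otimes> y = x \<otimes> z"
    then have "y \<in> carrier G" "z \<in> carrier G" using T(2) by auto
    then show "y = z" using yz(3) xc l_cancel by blast
  qed
  moreover have "(\<lambda>y. x \<otimes> y) ` T \<subseteq> T" using T(4) x by blast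
  ultimately have "(\<lambda>y. x \<otimes> y) ` T = T" using T(1) by (simp add: endo_inj_surj)
  then obtain y where y: "y \<in> T" "x \<otimes> y = \<one>" using T(3) by (metis imageE)
  have "y \<in> carrier G" using y T by blast
  then have "inv x = y" using y(2) xc by (metis inv_equality inv_inv inv_closed)
  then show "inv x \<in> T" using y by simp
qed (use T in auto)

lemma (in group) quotient_cyclic:
  assumes K: "K \<lhd> G" and L: "subgroup L G" "K \<subseteq> L" and w: "w \<in> L"
    and e: "\<And>x. x \<in> L \<Longrightarrow> \<exists>n\<in>K. \<exists>i::nat. x = n \<otimes> w [^] i"
  shows "cyclic_group ((G\<lparr>carrier := L\<rparr>) Mod K)"
proof -
  let ?L = "G\<lparr>carrier := L\<rparr>"
  interpret L: group ?L using subgroup.subgroup_is_group[OF L(1) is_group] .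
  have Lc: "x \<in> carrier G" if "x \<in> L" for x using subgroup.mem_carrier[OF L(1) that] .
  have KL: "K \<lhd> ?L"
  proof (rule L.normal_invI)
    show "subgroup K ?L" using subgroup_incl[OF normal_imp_subgroup[OF K] L] .
    fix x h assume xh: "x \<in> carrier ?L" "h \<in> K"
    then have "x \<otimes> h \<otimes> inv x \<in> K" using normal_invE(2)[OF K] Lc by simp
    then show "x \<otimes>\<^bsub>?L\<^esub> h \<otimes>\<^bsub>?L\<^esub> inv\<^bsub>?L\<^esub> x \<in> K" using m_inv_consistent[OF L(1), of x] xh by simp
  qed
  interpret h: group_hom ?L "?L Mod K" "\<lambda>x. K #>\<^bsub>?L\<^esub> x" using L.quotient_hom[OF KL] .
  let ?w = "K #>\<^bsub>?L\<^esub> w"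
  have wL: "w \<in> carrier ?L" using w by simp
  have wc: "?w \<in> carrier (?L Mod K)" using h.hom_closed[OF wL] .
  have "carrier (?L Mod K) = range (\<lambda>n::int. ?w [^]\<^bsub>?L Mod K\<^esub> n)"
  proof (intro subset_antisym subsetI)
    fix y assume "y \<in> carrier (?L Mod K)"
    then obtain x where x: "x \<in> L" "y = K #>\<^bsub>?L\<^esub> x" by (auto simp: carrier_FactGroup)
    obtain n i where n: "n \<in> K" "x = n \<otimes> w [^] (i::nat)" using e[OF x(1)] by blast
    have "x = n \<otimes>\<^bsub>?L\<^esub> w [^]\<^bsub>?L\<^esub> i" using n(2) by (simp flip: nat_pow_consistent)
    then have "y = K #>\<^bsub>?L\<^esub> (w [^]\<^bsub>?L\<^esub> i)"
      unfolding x(2) using L.quotient_mult_left[OF KL n(1) L.nat_pow_closed[OF wL]] by simp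
    then have "y = ?w [^]\<^bsub>?L Mod K\<^esub> int i" using h.hom_nat_pow[OF wL] by (simp add: int_pow_int)
    then show "y \<in> range (\<lambda>n::int. ?w [^]\<^bsub>?L Mod K\<^esub> n)" by blast
  next
    fix y assume "y \<in> range (\<lambda>n::int. ?w [^]\<^bsub>?L Mod K\<^esub> n)"
    then obtain n :: int where "y = ?w [^]\<^bsub>?L Mod K\<^esub> n" by blast
    then show "y \<in> carrier (?L Mod K)" using h.H.int_pow_closed[OF wc] by simp
  qed
  then show ?thesis using h.H.cyclic_group wc by blast
qed

text \<open>The condition in \<open>supersoluble\<close> with \<open>L\<close> as the end point, so
  that a series can grow along the climb while its terms stay normal in the whole group.\<close>

definition cyclic_series :: "('a, 'b) monoid_scheme \<Rightarrow> 'a set \<Rightarrow> bool"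
  where "cyclic_series G L \<longleftrightarrow> (\<exists>(k::nat) N. N 0 = {\<one>\<^bsub>G\<^esub>} \<and> N k = L \<and> (\<forall>i \<le> k. N i \<lhd> G) \<and>
    (\<forall>i < k. N i \<subseteq> N (Suc i) \<and> cyclic_group ((G\<lparr>carrier := N (Suc i)\<rparr>) Mod (N i))))"

lemma cyclic_series_extend:
  assumes K: "cyclic_series G K" and L: "L \<lhd> G" "K \<subseteq> L" "cyclic_group ((G\<lparr>carrier := L\<rparr>) Mod K)"
  shows "cyclic_series G L"
proof -
  obtain k :: nat and N where N: "N 0 = {\<one>\<^bsub>G\<^esub>}" "N k = K" "\<And>i. i \<le> k \<Longrightarrow> N i \<lhd> G"
    "\<And>i. i < k \<Longrightarrow> N i \<subseteq> N (Suc i) \<and> cyclic_group ((G\<lparr>carrier := N (Suc i)\<rparr>) Mod (N i))"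
    using K unfolding cyclic_series_def by metis
  define N' where "N' i = (if i \<le> k then N i else L)" for i
  have "N' 0 = {\<one>\<^bsub>G\<^esub>}" "N' (Suc k) = L" using N(1) by (auto simp: N'_def)
  moreover have "\<forall>i \<le> Suc k. N' i \<lhd> G" using N(3) L(1) by (auto simp: N'_def)
  moreover have "\<forall>i < Suc k. N' i \<subseteq> N' (Suc i) \<and> cyclic_group ((G\<lparr>carrier := N' (Suc i)\<rparr>) Mod (N' i))"
  proof (intro allI impI)
    fix i assume "i < Suc k"
    then consider "i < k" | "i = k" by linarith
    then show "N' i \<subseteq> N' (Suc i) \<and> cyclic_group ((G\<lparr>carrier := N' (Suc i)\<rparr>) Mod (N' i))"
    proof cases
      case 1 then show ?thesis using N(4)[of i] by (simp add: N'_def)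
    next
      case 2 then show ?thesis using N(2) L by (simp add: N'_def)
    qed
  qed
  ultimately show ?thesis unfolding cyclic_series_def by blast
qed

lemma (in group) restricted_normal:
  assumes "N \<lhd> G" "subgroup F G" shows "F \<inter> N \<lhd> G\<lparr>carrier := F\<rparr>"
proof (rule group.normal_invI[OF subgroup.subgroup_is_group[OF assms(2) is_group]])
  have s: "subgroup N G" using normal_imp_subgroup[OF assms(1)] .
  then have "subgroup (F \<inter> N) G" using assms(2) subgroups_Inter_pair by blast
  then show "subgroup (F \<inter> N) (G\<lparr>carrier := F\<rparr>)" using subgroup_incl assms(2) by blast
  fix x h assume xh: "x \<in> carrier (G\<lparr>carrier := F\<rparr>)" "h \<in> F \<inter> N"
  then have xF: "x \<in> F" and xc: "x \<in> carrier G" using subgroup.mem_carrier[OF assms(2)] by auto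
  have "x \<otimes> h \<otimes> inv x \<in> N" using normal_invE(2)[OF assms(1) xc] xh by blast
  moreover have "x \<otimes> h \<otimes> inv x \<in> F"
    using subgroup.m_closed[OF assms(2) subgroup.m_closed[OF assms(2) xF] subgroup.m_inv_closed[OF assms(2) xF]] xh by blast
  ultimately show "x \<otimes>\<^bsub>G\<lparr>carrier := F\<rparr>\<^esub> h \<otimes>\<^bsub>G\<lparr>carrier := F\<rparr>\<^esub> inv\<^bsub>G\<lparr>carrier := F\<rparr>\<^esub> x \<in> F \<inter> N"
    using m_inv_consistent[OF assms(2) xF] by simp
qed

text \<open>The series is cut out by the intersections \<open>F \<inter> N\<close>. A finite
  \<open>F\<close> meets the union of a chain inside one of its members. In a step of prime order,
  \<open>F \<inter> M\<close> either equals \<open>F \<inter> N\<close> or is generated modulo it by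
  any \<open>w\<close> outside \<open>N\<close>, since \<open>N #> w\<close> generates the whole
  step.\<close>

lemma (in bounded_family) finite_subgroup_supersoluble:
  assumes F: "subgroup F G" "finite F"
  shows "supersoluble (G\<lparr>carrier := F\<rparr>)"
proof -
  let ?F = "G\<lparr>carrier := F\<rparr>"
  interpret F: group ?F using subgroup.subgroup_is_group[OF F(1) is_group] .
  have Fc: "x \<in> carrier G" if "x \<in> F" for x using subgroup.mem_carrier[OF F(1) that] .
  have "cyclic_series ?F (F \<inter> carrier G)"
  proof (rule normal_climb[of "carrier G" "\<lambda>N. cyclic_series ?F (F \<inter> N)", OF family_climb subset_refl])
    have "F \<inter> {\<one>} = {\<one>}" using subgroup.one_closed[OF F(1)] by blast
    then show "cyclic_series ?F (F \<inter> {\<one>})"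
      unfolding cyclic_series_def using F.one_is_normal
      by (intro exI[of _ "0::nat"] exI[of _ "\<lambda>_. {\<one>}"]) simp
  next
    fix C :: "'a set set"
    assume C: "C \<noteq> {}" "\<And>N. N \<in> C \<Longrightarrow> N \<lhd> G \<and> cyclic_series ?F (F \<inter> N)"
      "\<And>M N. M \<in> C \<Longrightarrow> N \<in> C \<Longrightarrow> M \<subseteq> N \<or> N \<subseteq> M"
    have "finite (F \<inter> \<Union>C)" "F \<inter> \<Union>C \<subseteq> \<Union>C" using F(2) by auto
    then obtain N where N: "N \<in> C" "F \<inter> \<Union>C \<subseteq> N" using finite_chain_subset[of "F \<inter> \<Union>C" C] C by metis
    then have "F \<inter> \<Union>C = F \<inter> N" by blast
    then show "cyclic_series ?F (F \<inter> \<Union>C)" using C(2)[OF N(1)] by simp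
  next
    fix N M z p
    assume N: "N \<lhd> G" "cyclic_series ?F (F \<inter> N)" and z: "z \<in> carrier G" "prime (p::nat)"
      "(N #> z) [^]\<^bsub>G Mod N\<^esub> p = \<one>\<^bsub>G Mod N\<^esub>" and M: "M \<lhd> G"
      "\<And>x. x \<in> carrier G \<Longrightarrow> x \<in> M \<longleftrightarrow> N #> x \<in> cyc (G Mod N) (N #> z)"
    interpret h: group_hom G "G Mod N" "\<lambda>x. N #> x" using quotient_hom[OF N(1)] .
    have NM: "N \<subseteq> M"
    proof
      fix x assume x: "x \<in> N"
      then have xc: "x \<in> carrier G" using normal_carrier[OF N(1)] by blast
      then have "N #> x = \<one>\<^bsub>G Mod N\<^esub>" using quotient_one[OF N(1)] x by blast
      then show "x \<in> M" using M(2)[OF xc] one_in_cyc[of "G Mod N"] by simp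
    qed
    show "cyclic_series ?F (F \<inter> M)"
    proof (cases "F \<inter> M \<subseteq> N")
      case True
      then have "F \<inter> M = F \<inter> N" using NM by blast
      then show ?thesis using N(2) by simp
    next
      case False
      then obtain w where w: "w \<in> F" "w \<in> M" "w \<notin> N" by blast
      have wc: "w \<in> carrier G" using Fc w by blast
      have fw: "N #> w \<in> cyc (G Mod N) (N #> z)" "N #> w \<noteq> \<one>\<^bsub>G Mod N\<^esub>"
        using M(2)[OF wc] w quotient_one[OF N(1) wc] by auto
      have eq: "cyc (G Mod N) (N #> w) = cyc (G Mod N) (N #> z)"
        using h.H.cyc_prime_eq[OF h.hom_closed[OF z(1)] z(2,3) fw] .
      have NF: "F \<inter> N \<lhd> ?F" "F \<inter> M \<lhd> ?F" using restricted_normal N(1) M(1) F(1) by auto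
      have "cyclic_group ((?F\<lparr>carrier := F \<inter> M\<rparr>) Mod (F \<inter> N))"
      proof (rule F.quotient_cyclic[OF NF(1)])
        show "subgroup (F \<inter> M) ?F" using normal_imp_subgroup[OF NF(2)] .
        show "F \<inter> N \<subseteq> F \<inter> M" using NM by blast
        show "w \<in> F \<inter> M" using w by blast
        show "\<exists>n\<in>F \<inter> N. \<exists>i::nat. x = n \<otimes>\<^bsub>?F\<^esub> w [^]\<^bsub>?F\<^esub> i" if x: "x \<in> F \<inter> M" for x
        proof -
          have xc: "x \<in> carrier G" using x Fc by blast
          have "N #> x \<in> cyc (G Mod N) (N #> w)" unfolding eq using M(2)[OF xc] x by blast
          then obtain i where i: "N #> x = (N #> w) [^]\<^bsub>G Mod N\<^esub> (i::nat)" by (rule cycE)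
          then have "N #> x = N #> (w [^] i)" using h.hom_nat_pow[OF wc] by simp
          then obtain n where n: "n \<in> N" "x = n \<otimes> w [^] i" using quotient_eq[OF N(1) xc nat_pow_closed[OF wc]] by blast
          have nc: "n \<in> carrier G" using n normal_carrier[OF N(1)] by blast
          have "n = x \<otimes> inv (w [^] i)" unfolding n(2) using nc wc by (simp add: m_assoc)
          then have "n \<in> F"
            using subgroup.m_closed[OF F(1) _ subgroup.m_inv_closed[OF F(1) subgroup_pow[OF F(1) w(1)]]] x by blast
          moreover have "x = n \<otimes>\<^bsub>?F\<^esub> w [^]\<^bsub>?F\<^esub> i" using n(2) by (simp flip: nat_pow_consistent)
          ultimately show ?thesis using n(1) by blast
        qed
      qed
      then show ?thesis using cyclic_series_extend[OF N(2) NF(2)] NM by blast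
    qed
  qed
  moreover have "F \<inter> carrier G = F" using Fc by blast
  ultimately show ?thesis unfolding cyclic_series_def supersoluble_def by simp
qed

section \<open>From the notions of the theorem to bounded families\<close>

lemma (in group) torsion_int_pow:
  assumes "x \<in> carrier G" "torsion G x" shows "x [^] (n::int) \<in> cyc G x"
proof (cases n rule: int_cases2)
  case (nonneg k) then show ?thesis using pow_in_cyc[of G x k] by (simp add: int_pow_int)
next
  case (nonpos k)
  then have "x [^] n = inv (x [^] k)" using assms by (simp add: int_pow_neg int_pow_int)
  then show ?thesis using inv_pow_in_cyc assms by simp
qed

lemma (in group) locally_cyclic_plc:
  assumes A: "subgroup A G" and per: "periodic_group (G\<lparr>carrier := A\<rparr>)" and loc: "locally_cyclic (G\<lparr>carrier := A\<rparr>)"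
  shows "plc G A"
  unfolding plc_def
proof (intro conjI ballI)
  let ?A = "G\<lparr>carrier := A\<rparr>"
  interpret A: group ?A using subgroup.subgroup_is_group[OF A is_group] .
  show "subgroup A G" by fact
  show tor: "torsion G x" if "x \<in> A" for x
    using per that unfolding periodic_group_def torsion_def by (simp flip: nat_pow_consistent)
  fix x y assume xy: "x \<in> A" "y \<in> A"
  let ?C = "subgroup_generated ?A {x, y}"
  interpret C: group ?C by (rule A.group_subgroup_generated)
  have "cyclic_group ?C" using loc xy unfolding locally_cyclic_def by simp
  then obtain z where z: "z \<in> carrier ?C" "carrier ?C = range (\<lambda>n::int. z [^]\<^bsub>?C\<^esub> n)"
    using C.cyclic_group by blast
  have xyC: "x \<in> carrier ?C" "y \<in> carrier ?C"
    using A.subgroup_generated_subset_carrier_subset[of "{x, y}"] xy by auto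
  have zA: "z \<in> A" using z(1) A.carrier_subgroup_generated_subset by fastforce
  have pw: "z [^]\<^bsub>?C\<^esub> k = z [^] k" for k :: nat
    by (simp add: pow_subgroup_generated flip: nat_pow_consistent)
  have "torsion ?C z" using tor[OF zA] unfolding torsion_def pw by simp
  moreover have "cyc ?C z = cyc G z" unfolding cyc_def pw ..
  \<comment> \<open>Torsion turns the integer exponents of the generator into natural ones.\<close>
  ultimately have "carrier ?C \<subseteq> cyc G z" using z C.torsion_int_pow[OF z(1)] by auto
  then show "\<exists>z\<in>A. x \<in> cyc G z \<and> y \<in> cyc G z" using xyC zA by blast
qed

lemma (in group) finite_torsion_bound:
  assumes "finite E" "\<And>x. x \<in> E \<Longrightarrow> x \<in> carrier G \<and> torsion G x"
  obtains M where "\<And>x. x \<in> E \<Longrightarrow> pelt G (\<lambda>r. r \<le> M) x"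
proof -
  have "pelt G (\<lambda>r. r \<le> Max (ord ` E)) x" if x: "x \<in> E" for x
  proof (rule peltI[of "ord x"])
    show o: "ord x > 0" using ord_pos assms(2)[OF x] by blast
    show "x [^] ord x = \<one>" using assms(2)[OF x] by simp
    show "q \<le> Max (ord ` E)" if "prime q" "q dvd ord x" for q
    proof -
      have "q \<le> ord x" using dvd_imp_le[OF that(2) o] .
      also have "\<dots> \<le> Max (ord ` E)" using assms(1) x by simp
      finally show ?thesis .
    qed
  qed
  then show ?thesis using that by blast
qed

lemma (in group) foldr_in_subgroup:
  assumes "subgroup K G" "\<And>i. i \<in> set xs \<Longrightarrow> a i \<in> K"
  shows "foldr (\<lambda>x y. x \<otimes> y) (map a xs) \<one> \<in> K"
  using assms(2)
proof (induction xs)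
  case Nil then show ?case using subgroup.one_closed[OF assms(1)] by simp
next
  case (Cons i xs) then show ?case using subgroup.m_closed[OF assms(1)] by simp
qed

text \<open>\<open>S\<close> lies in the group \<open>K\<close> generated by the parts
  \<open>B i\<close> at the primes up to \<open>M\<close>, where \<open>M\<close> bounds the primes
  in the factors of the chosen product expressions. \<open>K\<close> is the carrier of a bounded
  family, which makes the group generated by \<open>S\<close> finite and then supersoluble.\<close>

lemma (in group) product_finite_supersoluble:
  fixes n :: nat and A :: "nat \<Rightarrow> 'a set"
  assumes A: "\<And>i. i \<in> {1..n} \<Longrightarrow> plc G (A i)" and perm: "pairwise_permutable G n A"
    and prod: "is_product_of G n A" and S: "finite S" "S \<subseteq> carrier G"
  shows "finite (generate G S)" "supersoluble (subgroup_generated G S)"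
proof -
  have "\<forall>s\<in>S. \<exists>a. (\<forall>i \<in> {1..n}. a i \<in> A i) \<and> s = foldr (\<lambda>x y. x \<otimes> y) (map a [1..<Suc n]) \<one>"
    using prod S(2) unfolding is_product_of_def by blast
  then obtain a where a: "\<And>s i. s \<in> S \<Longrightarrow> i \<in> {1..n} \<Longrightarrow> a s i \<in> A i"
    "\<And>s. s \<in> S \<Longrightarrow> s = foldr (\<lambda>x y. x \<otimes> y) (map (a s) [1..<Suc n]) \<one>" by metis
  define E where "E = (\<lambda>(s, i). a s i) ` (S \<times> {1..n})"
  have finE: "finite E" unfolding E_def using S(1) by simp
  have Ec: "x \<in> carrier G \<and> torsion G x" if x: "x \<in> E" for x
  proof -
    obtain s i where si: "s \<in> S" "i \<in> {1..n}" "x = a s i" using x unfolding E_def by auto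
    then show ?thesis using a(1) A plc_closed plc_torsion by blast
  qed
  obtain M where M: "\<And>x. x \<in> E \<Longrightarrow> pelt G (\<lambda>r. r \<le> M) x" using finite_torsion_bound[OF finE Ec] by blast
  define B where "B i = part G (\<lambda>r. r \<le> M) (A i)" for i
  have plcB: "plc G (B i)" if "i \<in> {1..n}" for i unfolding B_def using part_plc A that by blast
  define U where "U = (\<Union>i\<in>{1..n}. B i)"
  have Uc: "U \<subseteq> carrier G" unfolding U_def using plcB plc_closed by blast
  define K where "K = generate G U"
  have K: "subgroup K G" unfolding K_def using generate_is_subgroup[OF Uc] .
  have BK: "B i \<subseteq> K" if "i \<in> {1..n}" for i 
  proof
    fix x assume "x \<in> B i"
    then have "x \<in> U" unfolding U_def using that by blast
    then show "x \<in> K" unfolding K_def by (rule generate.incl)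
  qed
  have SK: "S \<subseteq> K"
  proof
    fix s assume s: "s \<in> S"
    have "a s i \<in> K" if i: "i \<in> {1..n}" for i
    proof -
      have "a s i \<in> E" unfolding E_def by (rule image_eqI[of _ _ "(s, i)"]) (use s i in auto)
      then have "a s i \<in> B i" unfolding B_def part_def using M a(1)[OF s i] by blast
      then show ?thesis using BK[OF i] by blast
    qed
    then have "foldr (\<lambda>x y. x \<otimes> y) (map (a s) [1..<Suc n]) \<one> \<in> K"
      by (intro foldr_in_subgroup[OF K]) auto
    then show "s \<in> K" using a(2)[OF s] by simp
  qed
  let ?K = "G\<lparr>carrier := K\<rparr>"
  interpret K: bounded_family ?K "{1..n}" B M
  proof (unfold_locales)
    show "carrier ?K \<subseteq> Units ?K" using group.Units[OF subgroup.subgroup_is_group[OF K is_group]] by auto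
    show "finite {1..n}" by simp
    show "plc ?K (B i)" if "i \<in> {1..n}" for i using restricted_plc[OF K plcB[OF that] BK[OF that]] .
    show "B i <#>\<^bsub>?K\<^esub> B j = B j <#>\<^bsub>?K\<^esub> B i" if ij: "i \<in> {1..n}" "j \<in> {1..n}" for i j
    proof -
      have "A i <#> A j = A j <#> A i" using perm ij unfolding pairwise_permutable_def by blast
      then have "two_factors G (A i) (A j)"
        using two_factorsI[OF A[OF ij(1)] A[OF ij(2)]] set_multI[of _ "A j" _ "A i"] by metis
      then have "two_factors G (B i) (B j)" unfolding B_def by (rule two_factors.part_two_factors)
      then have "B i <#> B j = B j <#> B i" by (rule two_factors.AB_commute)
      then show ?thesis by (simp add: set_mult_def)
    qed
    show "carrier ?K = generate ?K (\<Union>i\<in>{1..n}. B i)"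
      using generate_consistent[of U K] K generate.incl[of _ U G] unfolding K_def U_def by auto
    show "pelt ?K (\<lambda>r. r \<le> M) x" if "i \<in> {1..n}" "x \<in> B i" for i x
      using that by (simp add: B_def part_def restricted_pelt)
  qed (auto simp: m_assoc subgroup.m_closed[OF K] subgroup.one_closed[OF K] subgroup.mem_carrier[OF K])
  obtain T where T: "finite T" "S \<subseteq> T" "T \<subseteq> K" "\<one> \<in> T" "\<And>x y. x \<in> T \<Longrightarrow> y \<in> T \<Longrightarrow> x \<otimes> y \<in> T"
    using K.locally_finite[OF S(1)] SK by auto
  have "subgroup T G"
    by (rule finite_closed_subgroup[OF T(1) _ T(4,5)]) (use T(3) subgroup.mem_carrier[OF K] in blast)
  then have "generate G S \<subseteq> T" using generate_subgroup_incl T(2) by blast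
  then show fin: "finite (generate G S)" using T(1) finite_subset by blast
  have gs: "subgroup (generate G S) G" using generate_is_subgroup[OF S(2)] .
  have "generate G S \<subseteq> K" using generate_subgroup_incl[OF SK K] .
  then have "subgroup (generate G S) ?K" using subgroup_incl[OF gs K] by blast
  then have "supersoluble (?K\<lparr>carrier := generate G S\<rparr>)" using K.finite_subgroup_supersoluble fin by blast
  moreover have "carrier G \<inter> S = S" using S(2) by blast
  ultimately show "supersoluble (subgroup_generated G S)" unfolding subgroup_generated_def by simp
qed

theorem theorem1p3:
  fixes G :: "('a, 'b) monoid_scheme" and n :: nat and A :: "nat \<Rightarrow> 'a set"
  assumes "group G"
    and "1 \<le> n"
    and "\<And>i. i \<in> {1..n} \<Longrightarrow> subgroup (A i) G"
    and "\<And>i. i \<in> {1..n} \<Longrightarrow> periodic_group (G\<lparr>carrier := A i\<rparr>)"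
    and "\<And>i. i \<in> {1..n} \<Longrightarrow> locally_cyclic (G\<lparr>carrier := A i\<rparr>)"
    and "pairwise_permutable G n A"
    and "is_product_of G n A"
  shows "periodic_group G \<and> locally_supersoluble G"
proof -
  interpret group G by fact
  have A: "plc G (A i)" if "i \<in> {1..n}" for i using locally_cyclic_plc assms(3-5)[OF that] by blast
  have fin: "finite (generate G S)" and ss: "supersoluble (subgroup_generated G S)"
    if "finite S" "S \<subseteq> carrier G" for S
    using product_finite_supersoluble[OF A assms(6,7) that] by blast+
  \<comment> \<open>Periodicity is the finiteness of the groups generated by single
    elements.\<close>
  have "\<exists>m::nat. m > 0 \<and> x [^]\<^bsub>G\<^esub> m = \<one>\<^bsub>G\<^esub>" if x: "x \<in> carrier G" for x
  proof -
    have "finite (carrier (subgroup_generated G {x}))"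
      using fin[of "{x}"] x by (simp add: carrier_subgroup_generated)
    then show ?thesis using finite_cyclic_subgroup[OF x] by auto
  qed
  then have "periodic_group G" unfolding periodic_group_def by blast
  moreover have "locally_supersoluble G" unfolding locally_supersoluble_def using ss by blast
  ultimately show ?thesis by blast
qed

end
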